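(* Let $K$ be an arbitrary infinite field and let $m,n\ge 1$ be integers. Then $$\varphi\bigl(B_n(-2m)\bigr)=\operatorname{End}_{K GSp(V)}\bigl(V^{\otimes n}\bigr)=\operatorname{End}_{K Sp(V)}\bigl(V^{\otimes n}\bigr),$$ and if $m\ge n$, then $\varphi$ is also injective, and hence an isomorphism onto $\operatorname{End}_{K GSp(V)}\bigl(V^{\otimes n}\bigr)$.
   Context: $V$ is a $2m$-dimensional $K$-vector space with a non-degenerate skew-symmetric bilinear form $(\,,)$. For $1\le i\le 2m$ put $i'=2m+1-i$. Fix an ordered basis $v_1,\dots,v_{2m}$ of $V$ with $(v_i,v_j)=0=(v_{i'},v_{j'})$ and $(v_i,v_{j'})=\delta_{ij}=-(v_{j'},v_i)$ for $1\le i,j\le m$. $GSp(V)=\{g\in GL(V): \exists\,0\ne d\in K,\ (gv,gw)=d(v,w)\ \forall v,w\in V\}$ and $Sp(V)=\{g\in GL(V):(gv,gw)=(v,w)\ \forall v,w\in V\}$; both act diagonally on $V^{\otimes n}$ from the left, so $V^{\otimes n}$ is a module over the group algebras $K GSp(V)$ and $K Sp(V)$. The Brauer algebra $B_n(x)$ ($x\in K$) is the unital $K$-algebra with generators $s_1,\dots,s_{n-1},e_1,\dots,e_{n-1}$ and relations: $s_i^2=1$, $e_i^2=xe_i$, $e_is_i=e_i=s_ie_i$ ($1\le i\le n-1$); $s_is_j=s_js_i$, $s_ie_j=e_js_i$, $e_ie_j=e_je_i$ for commuting positions $|i-j|>1$; $s_is_{i+1}s_i=s_{i+1}s_is_{i+1}$,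 $e_ie_{i+1}e_i=e_i$, $e_{i+1}e_ie_{i+1}=e_{i+1}$, $s_ie_{i+1}e_i=s_{i+1}e_i$, $e_{i+1}e_is_{i+1}=e_{i+1}s_i$ ($1\le i\le n-2$). Here $x=-2m$ (that is, $-2m\cdot 1_K$). For $i,j\in\{1,\dots,2m\}$ let $\epsilon_{ij}=1$ if $j=i'$ and $i<j$; $\epsilon_{ij}=-1$ if $j=i'$ and $i>j$; $\epsilon_{ij}=0$ otherwise. $B_n(-2m)$ acts on $V^{\otimes n}$ from the right by $$(v_{i_1}\otimes\cdots\otimes v_{i_n})s_j=-\,v_{i_1}\otimes\cdots\otimes v_{i_{j-1}}\otimes v_{i_{j+1}}\otimes v_{i_j}\otimes v_{i_{j+2}}\otimes\cdots\otimes v_{i_n},$$ $$(v_{i_1}\otimes\cdots\otimes v_{i_n})e_j=\epsilon_{i_ji_{j+1}}\,v_{i_1}\otimes\cdots\otimes v_{i_{j-1}}\otimes\Bigl(\sum_{k=1}^m(v_{k'}\otimes v_k-v_k\otimes v_{k'})\Bigr)\otimes v_{i_{j+2}}\otimes\cdots\otimes v_{i_n}.$$ $\varphi:(B_n(-2m))^{op}\to\operatorname{End}_K(V^{\otimes n})$ is the corresponding $K$-algebra homomorphism. *)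

theory Defs
  imports Complex_Main "HOL-Algebra.QuotRing" "HOL-Algebra.Module" "HOL-Library.Poly_Mapping"
begin

section \<open>Symplectic spaces\<close>

text \<open>
  Vector spaces over a field \<open>'k\<close> are types of class \<^class>\<open>ab_group_add\<close> with an explicit scalar
  multiplication \<open>sV :: 'k \<Rightarrow> 'v \<Rightarrow> 'v\<close> satisfying \<^const>\<open>vector_space\<close>; the underlying set is
  the whole type.
\<close>

definition symplectic_space ::
    "('k::field \<Rightarrow> 'v::ab_group_add \<Rightarrow> 'v) \<Rightarrow> ('v \<Rightarrow> 'v \<Rightarrow> 'k) \<Rightarrow> nat \<Rightarrow> bool" where
  "symplectic_space sV form m \<longleftrightarrow>
     vector_space sV \<and> vector_space.dim sV UNIV = 2 * m \<and>
     (\<forall>w. Vector_Spaces.linear sV (*) (\<lambda>v. form v w)) \<and>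
     (\<forall>v. Vector_Spaces.linear sV (*) (\<lambda>w. form v w)) \<and>
     (\<forall>v w. form v w = - form w v) \<and>
     (\<forall>v. (\<forall>w. form v w = 0) \<longrightarrow> v = 0)"

definition prime_index :: "nat \<Rightarrow> nat \<Rightarrow> nat" where
  "prime_index m i = 2 * m + 1 - i"

definition symplectic_basis ::
    "('k::field \<Rightarrow> 'v::ab_group_add \<Rightarrow> 'v) \<Rightarrow> ('v \<Rightarrow> 'v \<Rightarrow> 'k) \<Rightarrow> nat \<Rightarrow> (nat \<Rightarrow> 'v) \<Rightarrow> bool" where
  "symplectic_basis sV form m v \<longleftrightarrow>
     inj_on v {1..2*m} \<and>
     \<not> Modules.module.dependent sV (v ` {1..2*m}) \<and>
     Modules.module.span sV (v ` {1..2*m}) = UNIV \<and>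
     (\<forall>i\<in>{1..m}. \<forall>j\<in>{1..m}.
        form (v i) (v j) = 0 \<and>
        form (v (prime_index m i)) (v (prime_index m j)) = 0 \<and>
        form (v i) (v (prime_index m j)) = (if i = j then 1 else 0) \<and>
        form (v (prime_index m j)) (v i) = - (if i = j then 1 else 0))"

definition GL :: "('k::field \<Rightarrow> 'v::ab_group_add \<Rightarrow> 'v) \<Rightarrow> ('v \<Rightarrow> 'v) set" where
  "GL sV = {g. Vector_Spaces.linear sV sV g \<and> bij g}"

definition GSp ::
    "('k::field \<Rightarrow> 'v::ab_group_add \<Rightarrow> 'v) \<Rightarrow> ('v \<Rightarrow> 'v \<Rightarrow> 'k) \<Rightarrow> ('v \<Rightarrow> 'v) set" where
  "GSp sV form = {g \<in> GL sV. \<exists>d. d \<noteq> 0 \<and> (\<forall>v w. form (g v) (g w) = d * form v w)}"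

definition Sp ::
    "('k::field \<Rightarrow> 'v::ab_group_add \<Rightarrow> 'v) \<Rightarrow> ('v \<Rightarrow> 'v \<Rightarrow> 'k) \<Rightarrow> ('v \<Rightarrow> 'v) set" where
  "Sp sV form = {g \<in> GL sV. \<forall>v w. form (g v) (g w) = form v w}"


section \<open>Tensor powers\<close>

definition multilinear ::
    "('k::field \<Rightarrow> 'v::ab_group_add \<Rightarrow> 'v) \<Rightarrow> ('k \<Rightarrow> 'w::ab_group_add \<Rightarrow> 'w) \<Rightarrow> nat \<Rightarrow>
     ('v list \<Rightarrow> 'w) \<Rightarrow> bool" where
  "multilinear sV sW n f \<longleftrightarrow>
     (\<forall>vs i. length vs = n \<longrightarrow> i < n \<longrightarrow> Vector_Spaces.linear sV sW (\<lambda>x. f (vs[i := x])))"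

text \<open>
  \<open>\<tau> [v\<^sub>1, \<dots>, v\<^sub>n]\<close> plays the role of the pure tensor of \<open>v\<^sub>1, \<dots>, v\<^sub>n\<close>; \<open>\<tau>\<close> is only relevant on
  lists of length \<open>n\<close>.  The universal property cannot quantify over target types inside the
  definition, so it is stated for \<open>'k\<close>-valued maps; the lemma \<open>tensor_power_universal\<close> shows that
  it then holds for every target space.
\<close>

definition tensor_power ::
    "('k::field \<Rightarrow> 'v::ab_group_add \<Rightarrow> 'v) \<Rightarrow> nat \<Rightarrow> ('k \<Rightarrow> 't::ab_group_add \<Rightarrow> 't) \<Rightarrow>
     ('v list \<Rightarrow> 't) \<Rightarrow> bool" where
  "tensor_power sV n sT \<tau> \<longleftrightarrow>
     vector_space sV \<and> vector_space sT \<and> multilinear sV sT n \<tau> \<and>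
     (\<forall>f. multilinear sV (*) n f \<longrightarrow>
        (\<exists>!F. Vector_Spaces.linear sT (*) F \<and> (\<forall>vs. length vs = n \<longrightarrow> F (\<tau> vs) = f vs)))"

lemma multilinear_compose:
  assumes "multilinear sV sW n f" and "Vector_Spaces.linear sW sU h"
  shows "multilinear sV sU n (\<lambda>vs. h (f vs))"
  using assms Vector_Spaces.linear_compose[of sV sW _ sU h]
  by (simp add: multilinear_def o_def)

lemma separating_functional:
  fixes sU :: "'k::field \<Rightarrow> 'u::ab_group_add \<Rightarrow> 'u"
  assumes "vector_space sU" and "Modules.module.subspace sU S" and "u \<notin> S"
  obtains h where "Vector_Spaces.linear sU (*) h" "\<And>s. s \<in> S \<Longrightarrow> h s = 0" "h u = 1"
proof -
  interpret U: vector_space sU by fact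
  interpret K: vector_space "(*) :: 'k \<Rightarrow> 'k \<Rightarrow> 'k"
    by unfold_locales (auto simp: algebra_simps)
  interpret P: vector_space_pair sU "(*) :: 'k \<Rightarrow> 'k \<Rightarrow> 'k" ..
  obtain B where B: "B \<subseteq> S" "U.independent B" "S \<subseteq> U.span B"
    using U.maximal_independent_subset by blast
  have "U.span B = S"
    using B assms(2) by (meson U.span_minimal antisym)
  then have ind: "U.independent (insert u B)"
    using B assms(3) by (simp add: U.independent_insert)
  have uB: "u \<notin> B" using B(1) assms(3) by blast
  let ?h = "P.construct (insert u B) (\<lambda>b. if b = u then 1 else 0)"
  have lin: "Vector_Spaces.linear sU (*) ?h" by (rule P.linear_construct[OF ind])
  have "?h s = 0" if "s \<in> S" for s
  proof (rule P.linear_eq_0_on_span[OF lin])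
    show "s \<in> U.span B" using that B(3) by blast
    show "?h b = 0" if "b \<in> B" for b
      using P.construct_basis[OF ind, of b] that uB by auto
  qed
  moreover have "?h u = 1" using P.construct_basis[OF ind, of u] by simp
  ultimately show thesis using that lin by blast
qed

lemma tensor_power_span:
  assumes tp: "tensor_power sV n sT \<tau>"
  shows "Modules.module.span sT (\<tau> ` {vs. length vs = n}) = UNIV"
proof (rule ccontr)
  interpret T: vector_space sT using tp by (simp add: tensor_power_def)
  interpret V: vector_space sV using tp by (simp add: tensor_power_def)
  let ?S = "T.span (\<tau> ` {vs. length vs = n})"
  assume "?S \<noteq> UNIV"
  then obtain u where "u \<notin> ?S" by blast
  then obtain h where h: "Vector_Spaces.linear sT (*) h" "\<And>s. s \<in> ?S \<Longrightarrow> h s = 0" "h u = 1"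
    using separating_functional[OF T.vector_space_axioms T.subspace_span] by metis
  interpret P: vector_space_pair sT "(*)"
    using h(1) by (simp add: vector_space_pair_def Vector_Spaces.linear_def)
  interpret Q: vector_space_pair sV "(*)" ..
  have "multilinear sV (*) n (\<lambda>_. 0)"
    by (simp add: multilinear_def Q.linear_zero)
  then have "\<exists>!F. Vector_Spaces.linear sT (*) F \<and> (\<forall>vs. length vs = n \<longrightarrow> F (\<tau> vs) = 0)"
    using tp by (simp add: tensor_power_def)
  moreover have "h (\<tau> vs) = 0" if "length vs = n" for vs
    using that by (intro h(2) T.span_base) auto
  moreover have "Vector_Spaces.linear sT (*) (\<lambda>_. 0)" by (rule P.linear_zero)
  ultimately have "h = (\<lambda>_. 0)" using h(1) by blast
  with h(3) show False by simp
qed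

lemma tensor_power_universal:
  fixes sV :: "'k::field \<Rightarrow> 'v::ab_group_add \<Rightarrow> 'v"
    and sT :: "'k \<Rightarrow> 't::ab_group_add \<Rightarrow> 't"
    and sU :: "'k \<Rightarrow> 'u::ab_group_add \<Rightarrow> 'u"
  assumes tp: "tensor_power sV n sT \<tau>" and U: "vector_space sU" and f: "multilinear sV sU n f"
  shows "\<exists>!F. Vector_Spaces.linear sT sU F \<and> (\<forall>vs. length vs = n \<longrightarrow> F (\<tau> vs) = f vs)"
proof -
  interpret T: vector_space sT using tp by (simp add: tensor_power_def)
  interpret U: vector_space sU by fact
  interpret P: vector_space_pair sT sU ..
  let ?R = "\<tau> ` {vs. length vs = n}"
  have sp: "T.span ?R = UNIV" by (rule tensor_power_span[OF tp])
  obtain B where B: "B \<subseteq> ?R" "T.independent B" "?R \<subseteq> T.span B"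
    using T.maximal_independent_subset by blast
  have spB: "T.span B = UNIV"
    using B(3) sp by (metis T.span_minimal T.subspace_span top.extremum_uniqueI)
  have "\<forall>b\<in>B. \<exists>vs. length vs = n \<and> b = \<tau> vs" using B(1) by blast
  then obtain r where r: "\<And>b. b \<in> B \<Longrightarrow> length (r b) = n \<and> b = \<tau> (r b)" by metis
  define F where "F = P.construct B (\<lambda>b. f (r b))"
  have linF: "Vector_Spaces.linear sT sU F"
    unfolding F_def by (rule P.linear_construct[OF B(2)])
  have FB: "F b = f (r b)" if "b \<in> B" for b
    unfolding F_def using P.construct_basis[OF B(2) that] .
  have val: "F (\<tau> vs) = f vs" if vs: "length vs = n" for vs
  proof (rule ccontr)
    assume "F (\<tau> vs) \<noteq> f vs"
    then have "F (\<tau> vs) - f vs \<notin> {0}" by simp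
    then obtain h where h: "Vector_Spaces.linear sU (*) h" "h (F (\<tau> vs) - f vs) = 1"
      using separating_functional[OF U U.subspace_single_0] by metis
    interpret h: Vector_Spaces.linear sU "(*)" h by fact
    interpret Q: vector_space_pair sT "(*)" ..
    have "multilinear sV (*) n (\<lambda>vs. h (f vs))" by (rule multilinear_compose[OF f h(1)])
    then obtain G where G: "Vector_Spaces.linear sT (*) G"
        "\<And>vs. length vs = n \<Longrightarrow> G (\<tau> vs) = h (f vs)"
      using tp unfolding tensor_power_def by blast
    have linhF: "Vector_Spaces.linear sT (*) (h \<circ> F)"
      by (rule Vector_Spaces.linear_compose[OF linF h(1)])
    have "(h \<circ> F) (\<tau> vs) = G (\<tau> vs)"
    proof (rule Q.linear_eq_on[OF linhF G(1)])
      show "\<tau> vs \<in> T.span B" by (simp add: spB)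
      show "(h \<circ> F) b = G b" if "b \<in> B" for b
        using FB[OF that] G(2)[of "r b"] r[OF that] by simp
    qed
    then show False using h(2) G(2)[OF vs] by (simp add: h.diff)
  qed
  show ?thesis
  proof (rule ex1I[of _ F])
    show "Vector_Spaces.linear sT sU F \<and> (\<forall>vs. length vs = n \<longrightarrow> F (\<tau> vs) = f vs)"
      using linF val by blast
    fix G assume G: "Vector_Spaces.linear sT sU G \<and> (\<forall>vs. length vs = n \<longrightarrow> G (\<tau> vs) = f vs)"
    show "G = F"
    proof
      fix t
      show "G t = F t"
      proof (rule P.linear_eq_on[of G F])
        show "t \<in> T.span ?R" by (simp add: sp)
      qed (use G linF val in auto)
    qed
  qed
qed

definition tensor_action ::
    "nat \<Rightarrow> ('k::field \<Rightarrow> 't::ab_group_add \<Rightarrow> 't) \<Rightarrow> ('v list \<Rightarrow> 't) \<Rightarrow> ('v \<Rightarrow> 'v) \<Rightarrow> 't \<Rightarrow> 't" where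
  "tensor_action n sT \<tau> g =
     (THE F. Vector_Spaces.linear sT sT F \<and> (\<forall>vs. length vs = n \<longrightarrow> F (\<tau> vs) = \<tau> (map g vs)))"


section \<open>Endomorphism algebras\<close>

definition End_alg :: "('k::field \<Rightarrow> 't::ab_group_add \<Rightarrow> 't) \<Rightarrow> ('k, 't \<Rightarrow> 't) module" where
  "End_alg sT =
     \<lparr>carrier = {F. Vector_Spaces.linear sT sT F}, mult = (\<circ>), one = id,
      zero = (\<lambda>_. 0), add = (\<lambda>F G t. F t + G t), smult = (\<lambda>c F t. sT c (F t))\<rparr>"

text \<open>
  The group algebra of a set \<open>G\<close> of transformations of \<open>'v\<close> consists of the finitely supported
  functions on \<open>G\<close>; only its action on the tensor power is needed.
\<close>

definition group_algebra :: "('v \<Rightarrow> 'v) set \<Rightarrow> (('v \<Rightarrow> 'v) \<Rightarrow>\<^sub>0 'k::field) set" where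
  "group_algebra G = {a. Poly_Mapping.keys a \<subseteq> G}"

definition group_algebra_action ::
    "nat \<Rightarrow> ('k::field \<Rightarrow> 't::ab_group_add \<Rightarrow> 't) \<Rightarrow> ('v list \<Rightarrow> 't) \<Rightarrow>
     (('v \<Rightarrow> 'v) \<Rightarrow>\<^sub>0 'k) \<Rightarrow> 't \<Rightarrow> 't" where
  "group_algebra_action n sT \<tau> a t =
     (\<Sum>g\<in>Poly_Mapping.keys a. sT (Poly_Mapping.lookup a g) (tensor_action n sT \<tau> g t))"

definition End_group_algebra ::
    "nat \<Rightarrow> ('k::field \<Rightarrow> 't::ab_group_add \<Rightarrow> 't) \<Rightarrow> ('v list \<Rightarrow> 't) \<Rightarrow> ('v \<Rightarrow> 'v) set \<Rightarrow>
     ('k, 't \<Rightarrow> 't) module" where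
  "End_group_algebra n sT \<tau> G =
     (End_alg sT)\<lparr>carrier :=
        {F \<in> carrier (End_alg sT). \<forall>a\<in>group_algebra G. \<forall>t.
           F (group_algebra_action n sT \<tau> a t) = group_algebra_action n sT \<tau> a (F t)}\<rparr>"

definition opposite :: "('k, 'a) module \<Rightarrow> ('k, 'a) module" where
  "opposite A = A\<lparr>mult := \<lambda>x y. y \<otimes>\<^bsub>A\<^esub> x\<rparr>"

definition alg_hom :: "('k, 'a) module \<Rightarrow> ('k, 'b) module \<Rightarrow> ('a \<Rightarrow> 'b) set" where
  "alg_hom A B =
     {h \<in> ring_hom A B. \<forall>c. \<forall>x\<in>carrier A. h (c \<odot>\<^bsub>A\<^esub> x) = c \<odot>\<^bsub>B\<^esub> h x}"

definition alg_iso :: "('k, 'a) module \<Rightarrow> ('k, 'b) module \<Rightarrow> ('a \<Rightarrow> 'b) set" where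
  "alg_iso A B = {h \<in> alg_hom A B. bij_betw h (carrier A) (carrier B)}"


section \<open>The Brauer algebra\<close>

text \<open>
  Words form a monoid under concatenation, written additively so that \<open>'g word \<Rightarrow>\<^sub>0 'k\<close>
  with its convolution product is the free unital associative algebra on \<open>'g\<close>.
\<close>

datatype 'g word = Word (letters: "'g list")

instantiation word :: (type) monoid_add
begin

definition zero_word :: "'g word" where
  "zero_word = Word []"

definition plus_word :: "'g word \<Rightarrow> 'g word \<Rightarrow> 'g word" where
  "plus_word u w = Word (letters u @ letters w)"

instance
  by standard (simp_all add: zero_word_def plus_word_def)

end

datatype brauer_gen = GenS nat | GenE nat

definition brauer_gens :: "nat \<Rightarrow> brauer_gen set" where
  "brauer_gens n = GenS ` {i. 1 \<le> i \<and> i < n} \<union> GenE ` {i. 1 \<le> i \<and> i < n}"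

definition free_alg :: "'g set \<Rightarrow> ('g word \<Rightarrow>\<^sub>0 'k::field) ring" where
  "free_alg X =
     \<lparr>carrier = {p. \<forall>w\<in>Poly_Mapping.keys p. set (letters w) \<subseteq> X},
      mult = (*), one = 1, zero = 0, add = (+)\<rparr>"

definition monomial :: "'k \<Rightarrow> 'g list \<Rightarrow> 'g word \<Rightarrow>\<^sub>0 'k::field" where
  "monomial c w = Poly_Mapping.single (Word w) c"

text \<open>Differences of the two sides of the defining relations.\<close>

definition brauer_relators :: "nat \<Rightarrow> 'k::field \<Rightarrow> (brauer_gen word \<Rightarrow>\<^sub>0 'k) set" where
  "brauer_relators n x =
     (let M = monomial 1; M' = monomial in
      (\<Union>i\<in>{i. 1 \<le> i \<and> i < n}.
         {M [GenS i, GenS i] - 1,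
          M [GenE i, GenE i] - M' x [GenE i],
          M [GenE i, GenS i] - M [GenE i],
          M [GenS i, GenE i] - M [GenE i]}) \<union>
      (\<Union>(i, j)\<in>{(i, j). 1 \<le> i \<and> i < n \<and> 1 \<le> j \<and> j < n \<and> (i + 1 < j \<or> j + 1 < i)}.
         {M [GenS i, GenS j] - M [GenS j, GenS i],
          M [GenS i, GenE j] - M [GenE j, GenS i],
          M [GenE i, GenE j] - M [GenE j, GenE i]}) \<union>
      (\<Union>i\<in>{i. 1 \<le> i \<and> i + 1 < n}.
         {M [GenS i, GenS (i+1), GenS i] - M [GenS (i+1), GenS i, GenS (i+1)],
          M [GenE i, GenE (i+1), GenE i] - M [GenE i],
          M [GenE (i+1), GenE i, GenE (i+1)] - M [GenE (i+1)],
          M [GenS i, GenE (i+1), GenE i] - M [GenS (i+1), GenE i],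
          M [GenE (i+1), GenE i, GenS (i+1)] - M [GenE (i+1), GenS i]}))"

definition brauer_ideal :: "nat \<Rightarrow> 'k::field \<Rightarrow> (brauer_gen word \<Rightarrow>\<^sub>0 'k) set" where
  "brauer_ideal n x = Idl\<^bsub>free_alg (brauer_gens n)\<^esub> (brauer_relators n x)"

text \<open>The scalar \<open>c\<close> acts as multiplication by the class of the constant \<open>c\<close>.\<close>

definition brauer_algebra ::
    "nat \<Rightarrow> 'k::field \<Rightarrow> ('k, (brauer_gen word \<Rightarrow>\<^sub>0 'k) set) module" where
  "brauer_algebra n x =
     (let F = free_alg (brauer_gens n); I = brauer_ideal n x; Q = F Quot I in
      \<lparr>carrier = carrier Q, mult = mult Q, one = one Q, zero = zero Q, add = add Q,
       smult = (\<lambda>c X. (I +>\<^bsub>F\<^esub> monomial c []) \<otimes>\<^bsub>Q\<^esub> X)\<rparr>)"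


section \<open>The action of the Brauer algebra on tensor space\<close>

definition eps :: "nat \<Rightarrow> nat \<Rightarrow> nat \<Rightarrow> 'k::field" where
  "eps m i j =
     (if j = prime_index m i \<and> i < j then 1
      else if j = prime_index m i \<and> i > j then - 1 else 0)"

text \<open>
  Positions in a tensor are numbered from 1 but list positions from 0, hence the entries at
  tensor positions \<open>j\<close> and \<open>j + 1\<close> are \<open>is ! (j - 1)\<close> and \<open>is ! j\<close>.
\<close>

definition put2 :: "nat \<Rightarrow> 'a \<Rightarrow> 'a \<Rightarrow> 'a list \<Rightarrow> 'a list" where
  "put2 j a b is = is[j - 1 := a, j := b]"

definition s_op ::
    "nat \<Rightarrow> nat \<Rightarrow> (nat \<Rightarrow> 'v) \<Rightarrow> ('k::field \<Rightarrow> 't::ab_group_add \<Rightarrow> 't) \<Rightarrow> ('v list \<Rightarrow> 't) \<Rightarrow>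
     nat \<Rightarrow> 't \<Rightarrow> 't" where
  "s_op m n v sT \<tau> j =
     (THE F. Vector_Spaces.linear sT sT F \<and>
        (\<forall>is. length is = n \<and> set is \<subseteq> {1..2*m} \<longrightarrow>
           F (\<tau> (map v is)) = - \<tau> (map v (put2 j (is ! j) (is ! (j - 1)) is))))"

definition e_op ::
    "nat \<Rightarrow> nat \<Rightarrow> (nat \<Rightarrow> 'v) \<Rightarrow> ('k::field \<Rightarrow> 't::ab_group_add \<Rightarrow> 't) \<Rightarrow> ('v list \<Rightarrow> 't) \<Rightarrow>
     nat \<Rightarrow> 't \<Rightarrow> 't" where
  "e_op m n v sT \<tau> j =
     (THE F. Vector_Spaces.linear sT sT F \<and>
        (\<forall>is. length is = n \<and> set is \<subseteq> {1..2*m} \<longrightarrow>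
           F (\<tau> (map v is)) =
             sT (eps m (is ! (j - 1)) (is ! j))
               (\<Sum>k=1..m. \<tau> (map v (put2 j (prime_index m k) k is))
                        - \<tau> (map v (put2 j k (prime_index m k) is)))))"

fun gen_op ::
    "nat \<Rightarrow> nat \<Rightarrow> (nat \<Rightarrow> 'v) \<Rightarrow> ('k::field \<Rightarrow> 't::ab_group_add \<Rightarrow> 't) \<Rightarrow> ('v list \<Rightarrow> 't) \<Rightarrow>
     brauer_gen \<Rightarrow> 't \<Rightarrow> 't" where
  "gen_op m n v sT \<tau> (GenS j) = s_op m n v sT \<tau> j"
| "gen_op m n v sT \<tau> (GenE j) = e_op m n v sT \<tau> j"

text \<open>
  As this is a right action, the letters of a word are applied from left to right, which is what
  \<^const>\<open>fold\<close> does.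
\<close>

definition free_action ::
    "nat \<Rightarrow> nat \<Rightarrow> (nat \<Rightarrow> 'v) \<Rightarrow> ('k::field \<Rightarrow> 't::ab_group_add \<Rightarrow> 't) \<Rightarrow> ('v list \<Rightarrow> 't) \<Rightarrow>
     (brauer_gen word \<Rightarrow>\<^sub>0 'k) \<Rightarrow> 't \<Rightarrow> 't" where
  "free_action m n v sT \<tau> p t =
     (\<Sum>w\<in>Poly_Mapping.keys p.
        sT (Poly_Mapping.lookup p w) (fold (gen_op m n v sT \<tau>) (letters w) t))"

text \<open>
  An element of the Brauer algebra is a coset \<open>X\<close> of the ideal of relations, all of whose
  representatives act in the same way.
\<close>

definition brauer_phi ::
    "nat \<Rightarrow> nat \<Rightarrow> (nat \<Rightarrow> 'v) \<Rightarrow> ('k::field \<Rightarrow> 't::ab_group_add \<Rightarrow> 't) \<Rightarrow> ('v list \<Rightarrow> 't) \<Rightarrow>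
     (brauer_gen word \<Rightarrow>\<^sub>0 'k) set \<Rightarrow> 't \<Rightarrow> 't" where
  "brauer_phi m n v sT \<tau> X = the_elem (free_action m n v sT \<tau> ` X)"

end

theory Submission
  imports Defs "HOL-Computational_Algebra.Polynomial" "HOL-Library.Function_Algebras"
    "HOL-Combinatorics.Permutations"
begin

text \<open>
  Pairing the values of an endomorphism of the \<open>n\<close>-th tensor power with \<open>n\<close> more vectors turns it
  into a form in \<open>2n\<close> arguments.  Endomorphisms that commute with the symplectic group become
  invariant forms, and Brauer diagrams become, up to sign, the matching forms: products of values of
  the symplectic form on the pairs of a perfect matching of the \<open>2n\<close> arguments.  So the theorem rests
  on two statements.

  \<^item> Every invariant form is a combination of matching forms
  (\<open>invariant_forms_spanned_by_matchings\<close>).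

  \<^item> The Brauer algebra is spanned by at most \<open>(2n - 1)!!\<close> elements (\<open>brauer_spanning_set\<close>).

  For the first statement, write a form by its coefficients at words in the basis vectors.  The least
  word with nonzero coefficient in a nonzero invariant form, chosen letter by letter, is dominant:
  the weights of its prefixes stay in the dominant chamber, and the total weight is zero
  (\<open>invariant_form_zero\<close>).  This uses only the torus and the simple root elements, together with an
  inclusion-exclusion argument in place of representation theory of \<open>SL_2\<close> (\<open>act_invariant_zero\<close>).
  Dominant words of zero weight and length \<open>2n\<close> are closed walks in the lattice of
  partitions, and the relation \<open>DU - UD = 1\<close> of this lattice shows that there are at most
  \<open>(2n - 1)!!\<close> of them (\<open>card_dominant_closed\<close>).  For a rank of at least \<open>n\<close>, the \<open>(2n - 1)!!\<close> matching
  forms are independent (\<open>matching_forms_independent\<close>), and so they realise all possible values at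
  the dominant words.  As matching forms and dominant words for a small rank are restrictions of
  those for a large rank, the same follows for a small rank, where the matching forms
  can be dependent.  An invariant form is thus corrected by matching forms until it vanishes at all
  dominant words, and then it is zero.

  For the second statement, the relations yield elements \<open>ee a b\<close> for arbitrary pairs of points,
  conjugate to the generators \<open>e_i\<close>.  Every product of generators is then, up to a power of the
  parameter, a product of such elements for disjoint pairs times a permutation, and it is
  determined by its diagram (\<open>products_normal\<close>, \<open>card_normal_forms\<close>).

  All matching forms arise from the Brauer algebra, by induction on the number of caps
  (\<open>matching_form_realizable\<close>), which gives surjectivity.  For \<open>n \<le> m\<close> the matching forms
  are independent, so the image has dimension \<open>(2n - 1)!!\<close> and the spanning set shows that the
  action is faithful (\<open>faithful\<close>).
\<close>

section \<open>Closed walks in the lattice of partitions\<close>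

text \<open>
  A shape is a partition, given by its rows and indexed from \<open>0\<close>.  It also records the weight of
  a prefix of a word, and it is integer-valued because such a weight can be negative.
\<close>
definition partition_shape :: "(nat \<Rightarrow> int) \<Rightarrow> bool" where
  "partition_shape l \<longleftrightarrow> (\<forall>i. l (Suc i) \<le> l i \<and> 0 \<le> l i) \<and> finite {i. l i \<noteq> 0}"

definition bump :: "(nat \<Rightarrow> int) \<Rightarrow> nat \<Rightarrow> int \<Rightarrow> nat \<Rightarrow> int" where
  "bump l i c = l(i := l i + c)"

definition up_rows :: "(nat \<Rightarrow> int) \<Rightarrow> nat set" where
  "up_rows l = {i. partition_shape (bump l i 1)}"

definition down_rows :: "(nat \<Rightarrow> int) \<Rightarrow> nat set" where
  "down_rows l = {i. partition_shape (bump l i (-1))}"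

fun walks :: "nat \<Rightarrow> (nat \<Rightarrow> int) \<Rightarrow> nat" where
  "walks 0 l = (if l = (\<lambda>_. 0) then 1 else 0)"
| "walks (Suc r) l = (\<Sum>i\<in>up_rows l. walks r (bump l i 1)) + (\<Sum>i\<in>down_rows l. walks r (bump l i (-1)))"

lemma finite_support_bump:
  "finite {j. bump l i c j \<noteq> 0} \<longleftrightarrow> finite {j. l j \<noteq> 0}"
proof -
  have "{j. bump l i c j \<noteq> 0} \<subseteq> insert i {j. l j \<noteq> 0}" "{j. l j \<noteq> 0} \<subseteq> insert i {j. bump l i c j \<noteq> 0}"
    by (auto simp: bump_def split: if_splits)
  then show ?thesis by (meson finite_insert finite_subset)
qed

lemma up_rows_iff:
  assumes "partition_shape l"
  shows "i \<in> up_rows l \<longleftrightarrow> i = 0 \<or> l i < l (i - 1)"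
proof -
  have "(\<forall>j. bump l i 1 (Suc j) \<le> bump l i 1 j \<and> 0 \<le> bump l i 1 j) \<longleftrightarrow> i = 0 \<or> l i < l (i - 1)"
  proof
    assume "\<forall>j. bump l i 1 (Suc j) \<le> bump l i 1 j \<and> 0 \<le> bump l i 1 j"
    from this[rule_format, of "i - 1"] show "i = 0 \<or> l i < l (i - 1)"
      by (cases i) (auto simp: bump_def)
  next
    assume a: "i = 0 \<or> l i < l (i - 1)"
    show "\<forall>j. bump l i 1 (Suc j) \<le> bump l i 1 j \<and> 0 \<le> bump l i 1 j"
    proof
      fix j
      have "l (Suc j) \<le> l j" "0 \<le> l j" using assms by (auto simp: partition_shape_def)
      then show "bump l i 1 (Suc j) \<le> bump l i 1 j \<and> 0 \<le> bump l i 1 j"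
        using a by (auto simp: bump_def)
    qed
  qed
  then show ?thesis using assms finite_support_bump[of l i 1]
    by (auto simp: up_rows_def partition_shape_def)
qed

lemma down_rows_iff:
  assumes "partition_shape l"
  shows "i \<in> down_rows l \<longleftrightarrow> l (Suc i) < l i"
proof -
  have "(\<forall>j. bump l i (-1) (Suc j) \<le> bump l i (-1) j \<and> 0 \<le> bump l i (-1) j) \<longleftrightarrow> l (Suc i) < l i"
  proof
    assume "\<forall>j. bump l i (-1) (Suc j) \<le> bump l i (-1) j \<and> 0 \<le> bump l i (-1) j"
    from this[rule_format, of i] show "l (Suc i) < l i"
      by (auto simp: bump_def)
  next
    assume a: "l (Suc i) < l i"
    show "\<forall>j. bump l i (-1) (Suc j) \<le> bump l i (-1) j \<and> 0 \<le> bump l i (-1) j"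
    proof
      fix j
      have "l (Suc j) \<le> l j" "0 \<le> l j" "0 \<le> l (Suc j)" using assms by (auto simp: partition_shape_def)
      then show "bump l i (-1) (Suc j) \<le> bump l i (-1) j \<and> 0 \<le> bump l i (-1) j"
        using a by (auto simp: bump_def)
    qed
  qed
  then show ?thesis using assms finite_support_bump[of l i "-1"]
    by (auto simp: down_rows_def partition_shape_def)
qed

text \<open>
  A box can be added at the start of the row below each removable one, and always in the top row;
  hence a shape has exactly one more addable than removable box.
\<close>
lemma up_rows_eq:
  assumes "partition_shape l"
  shows "up_rows l = insert 0 (Suc ` down_rows l)"
proof (rule Set.set_eqI)
  fix i show "i \<in> up_rows l \<longleftrightarrow> i \<in> insert 0 (Suc ` down_rows l)"
    using up_rows_iff[OF assms, of i] down_rows_iff[OF assms, of "i - 1"] by (cases i) auto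
qed

lemma finite_down_rows:
  assumes "partition_shape l"
  shows "finite (down_rows l)"
proof (rule finite_subset)
  show "down_rows l \<subseteq> {i. l i \<noteq> 0}"
  proof
    fix i assume "i \<in> down_rows l"
    then have "l (Suc i) < l i" using down_rows_iff[OF assms] by blast
    moreover have "0 \<le> l (Suc i)" using assms by (auto simp: partition_shape_def)
    ultimately show "i \<in> {i. l i \<noteq> 0}" by auto
  qed
  show "finite {i. l i \<noteq> 0}" using assms by (simp add: partition_shape_def)
qed

lemma finite_up_rows: "partition_shape l \<Longrightarrow> finite (up_rows l)"
  by (simp add: up_rows_eq finite_down_rows)

lemma card_up_rows: "partition_shape l \<Longrightarrow> card (up_rows l) = Suc (card (down_rows l))"
  by (simp add: up_rows_eq finite_down_rows card_image)

lemma bump_bump_same [simp]: "bump (bump l i c) i d = bump l i (c + d)" "bump l i 0 = l"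
  by (auto simp: bump_def)

lemma bump_commute: "i \<noteq> j \<Longrightarrow> bump (bump l i c) j d = bump (bump l j d) i c"
  by (auto simp: bump_def fun_eq_iff)

text \<open>
  Adding a box in row \<open>i\<close> and removing one in another row \<open>j\<close> can be done in either order.
\<close>
lemma up_down_exchange:
  assumes "partition_shape l" "i \<noteq> j"
  shows "(i \<in> up_rows l \<and> j \<in> down_rows (bump l i 1)) \<longleftrightarrow> (j \<in> down_rows l \<and> i \<in> up_rows (bump l j (-1)))"
proof -
  have dec: "l (Suc k) \<le> l k" for k using assms(1) by (auto simp: partition_shape_def)
  have eq: "bump (bump l i 1) j (-1) = bump (bump l j (-1)) i 1"
    using assms(2) by (rule bump_commute)
  have "i \<in> up_rows l \<and> j \<in> down_rows l" if p: "partition_shape (bump (bump l i 1) j (-1))"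
  proof
    have P: "bump (bump l i 1) j (-1) (Suc k) \<le> bump (bump l i 1) j (-1) k" for k
      using p by (auto simp: partition_shape_def)
    show "i \<in> up_rows l"
      unfolding up_rows_iff[OF assms(1)]
      using P[of "i - 1"] dec[of "i - 1"] assms(2) by (cases i) (auto simp: bump_def split: if_splits)
    show "j \<in> down_rows l"
      unfolding down_rows_iff[OF assms(1)]
      using P[of j] dec[of j] assms(2) by (auto simp: bump_def split: if_splits)
  qed
  then show ?thesis using eq by (auto simp: up_rows_def down_rows_def)
qed

lemma partition_shape_up: "i \<in> up_rows l \<Longrightarrow> partition_shape (bump l i 1)"
  by (simp add: up_rows_def)

lemma partition_shape_down: "i \<in> down_rows l \<Longrightarrow> partition_shape (bump l i (-1))"
  by (simp add: down_rows_def)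

text \<open>
  On functions of shapes, let \<open>U\<close> and \<open>D\<close> be the operators that sum over all ways to add,
  respectively to remove, a box.  This is the relation \<open>DU - UD = 1\<close>: for distinct rows the two
  orders correspond, and for equal rows the surplus is one addable box.
\<close>
lemma sum_up_down:
  fixes h :: "(nat \<Rightarrow> int) \<Rightarrow> nat"
  assumes l: "partition_shape l"
  shows "(\<Sum>i\<in>up_rows l. \<Sum>j\<in>down_rows (bump l i 1). h (bump (bump l i 1) j (-1)))
       = h l + (\<Sum>j\<in>down_rows l. \<Sum>i\<in>up_rows (bump l j (-1)). h (bump (bump l j (-1)) i 1))"
proof -
  have fu: "finite (up_rows l)" and fd: "finite (down_rows l)"
    using l by (simp_all add: finite_up_rows finite_down_rows)
  have split1: "(\<Sum>j\<in>down_rows (bump l i 1). h (bump (bump l i 1) j (-1)))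
      = h l + (\<Sum>j\<in>down_rows (bump l i 1) - {i}. h (bump (bump l i 1) j (-1)))" if "i \<in> up_rows l" for i
  proof -
    have "i \<in> down_rows (bump l i 1)" using l by (simp add: down_rows_def)
    then show ?thesis
      using finite_down_rows[OF partition_shape_up[OF that]] by (simp add: sum.remove)
  qed
  have split2: "(\<Sum>i\<in>up_rows (bump l j (-1)). h (bump (bump l j (-1)) i 1))
      = h l + (\<Sum>i\<in>up_rows (bump l j (-1)) - {j}. h (bump (bump l j (-1)) i 1))" if "j \<in> down_rows l" for j
  proof -
    have "j \<in> up_rows (bump l j (-1))" using l by (simp add: up_rows_def)
    then show ?thesis
      using finite_up_rows[OF partition_shape_down[OF that]] by (simp add: sum.remove)
  qed
  let ?A = "SIGMA i:up_rows l. down_rows (bump l i 1) - {i}"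
  let ?B = "SIGMA j:down_rows l. up_rows (bump l j (-1)) - {j}"
  have "(\<Sum>i\<in>up_rows l. \<Sum>j\<in>down_rows (bump l i 1) - {i}. h (bump (bump l i 1) j (-1)))
      = (\<Sum>(i,j)\<in>?A. h (bump (bump l i 1) j (-1)))"
    using fu finite_down_rows[OF partition_shape_up] by (subst sum.Sigma) auto
  also have "\<dots> = (\<Sum>(j,i)\<in>?B. h (bump (bump l j (-1)) i 1))"
  proof (rule sum.reindex_bij_witness[of _ prod.swap prod.swap])
    fix a assume "a \<in> ?A" then show "prod.swap a \<in> ?B"
      using up_down_exchange[OF l, of "fst a" "snd a"] by (cases a) auto
  next
    fix b assume "b \<in> ?B" then show "prod.swap b \<in> ?A"
      using up_down_exchange[OF l, of "snd b" "fst b"] by (cases b) auto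
  next
    fix a assume "a \<in> ?A"
    then show "(case prod.swap a of (j, i) \<Rightarrow> h (bump (bump l j (- 1)) i 1)) =
         (case a of (i, j) \<Rightarrow> h (bump (bump l i 1) j (- 1)))"
      using bump_commute[of "fst a" "snd a" l 1 "-1"] by (cases a) auto
  qed auto
  also have "\<dots> = (\<Sum>j\<in>down_rows l. \<Sum>i\<in>up_rows (bump l j (-1)) - {j}. h (bump (bump l j (-1)) i 1))"
    using fd finite_up_rows[OF partition_shape_down] by (subst sum.Sigma) auto
  finally have eq: "(\<Sum>i\<in>up_rows l. \<Sum>j\<in>down_rows (bump l i 1) - {i}. h (bump (bump l i 1) j (-1))) = \<dots>" .
  have "(\<Sum>i\<in>up_rows l. \<Sum>j\<in>down_rows (bump l i 1). h (bump (bump l i 1) j (-1)))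
     = card (up_rows l) * h l + (\<Sum>i\<in>up_rows l. \<Sum>j\<in>down_rows (bump l i 1) - {i}. h (bump (bump l i 1) j (-1)))"
    by (simp add: split1 sum.distrib)
  also have "\<dots> = h l + (card (down_rows l) * h l + (\<Sum>j\<in>down_rows l. \<Sum>i\<in>up_rows (bump l j (-1)) - {j}. h (bump (bump l j (-1)) i 1)))"
    using eq card_up_rows[OF l] by simp
  also have "\<dots> = h l + (\<Sum>j\<in>down_rows l. \<Sum>i\<in>up_rows (bump l j (-1)). h (bump (bump l j (-1)) i 1))"
    by (simp add: split2 sum.distrib)
  finally show ?thesis .
qed

text \<open>
  By \<open>DU - UD = 1\<close> the operator \<open>U\<close> acts as a derivation: with \<open>X = U + D\<close>, the commutator of
  \<open>X^r\<close> and \<open>U\<close> is \<open>r X^(r-1)\<close>.  The remaining term vanishes since no box can be added to a shape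
  in order to reach the empty one.
\<close>
lemma sum_up_walks:
  "partition_shape l \<Longrightarrow> (\<Sum>i\<in>up_rows l. walks r (bump l i 1)) = r * walks (r - 1) l"
proof (induction r arbitrary: l)
  case 0
  have "bump l i 1 \<noteq> (\<lambda>_. 0)" for i
  proof
    assume "bump l i 1 = (\<lambda>_. 0)"
    then have "l i + 1 = 0" by (auto simp: bump_def fun_eq_iff split: if_splits dest: spec[of _ i])
    moreover have "0 \<le> l i" using 0 by (auto simp: partition_shape_def)
    ultimately show False by linarith
  qed
  then show ?case by simp
next
  case (Suc r)
  have "(\<Sum>i\<in>up_rows l. walks (Suc r) (bump l i 1))
      = (\<Sum>i\<in>up_rows l. \<Sum>j\<in>up_rows (bump l i 1). walks r (bump (bump l i 1) j 1))
      + (\<Sum>i\<in>up_rows l. \<Sum>j\<in>down_rows (bump l i 1). walks r (bump (bump l i 1) j (-1)))"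
    by (simp add: sum.distrib)
  also have "(\<Sum>i\<in>up_rows l. \<Sum>j\<in>up_rows (bump l i 1). walks r (bump (bump l i 1) j 1))
      = r * (\<Sum>i\<in>up_rows l. walks (r - 1) (bump l i 1))"
    by (simp add: Suc.IH[OF partition_shape_up] sum_distrib_left)
  also have "(\<Sum>i\<in>up_rows l. \<Sum>j\<in>down_rows (bump l i 1). walks r (bump (bump l i 1) j (-1)))
      = walks r l + r * (\<Sum>j\<in>down_rows l. walks (r - 1) (bump l j (-1)))"
    by (simp add: sum_up_down[OF Suc.prems] Suc.IH[OF partition_shape_down] sum_distrib_left)
  finally have "(\<Sum>i\<in>up_rows l. walks (Suc r) (bump l i 1))
     = walks r l + r * ((\<Sum>i\<in>up_rows l. walks (r - 1) (bump l i 1)) + (\<Sum>j\<in>down_rows l. walks (r - 1) (bump l j (-1))))"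
    by (simp add: algebra_simps)
  also have "\<dots> = walks r l + r * walks r l"
    by (cases r) auto
  finally show ?case by simp
qed

text \<open>
  The double factorial \<open>(2n - 1)!!\<close>.
\<close>
fun num_matchings :: "nat \<Rightarrow> nat" where
  "num_matchings 0 = 1"
| "num_matchings (Suc n) = (2 * n + 1) * num_matchings n"

lemma partition_shape_zero: "partition_shape (\<lambda>_. 0)"
  by (simp add: partition_shape_def)

lemma walks_closed: "walks (2 * n) (\<lambda>_. 0) = num_matchings n"
proof (induction n)
  case (Suc n)
  have "down_rows (\<lambda>_. 0) = {}"
    using down_rows_iff[OF partition_shape_zero] by auto
  then have "walks (Suc (Suc (2 * n))) (\<lambda>_. 0) = (\<Sum>i\<in>up_rows (\<lambda>_. 0). walks (Suc (2 * n)) (bump (\<lambda>_. 0) i 1))"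
    by simp
  also have "\<dots> = Suc (2 * n) * walks (2 * n) (\<lambda>_. 0)"
    using sum_up_walks[OF partition_shape_zero, of "Suc (2*n)"] by simp
  finally show ?case using Suc by simp
qed simp

text \<open>
  A letter is a nonzero integer.  The letter \<open>i + 1\<close> adds a box in row \<open>i\<close>, the letter
  \<open>- (i + 1)\<close> removes one.
\<close>
definition row :: "int \<Rightarrow> nat" where
  "row a = nat (\<bar>a\<bar> - 1)"

definition step :: "(nat \<Rightarrow> int) \<Rightarrow> int \<Rightarrow> nat \<Rightarrow> int" where
  "step l a = bump l (row a) (sgn a)"

fun dominant_from :: "(nat \<Rightarrow> int) \<Rightarrow> int list \<Rightarrow> bool" where
  "dominant_from l [] \<longleftrightarrow> l = (\<lambda>_. 0)"
| "dominant_from l (a # w) \<longleftrightarrow> a \<noteq> 0 \<and> partition_shape (step l a) \<and> dominant_from (step l a) w"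

lemma card_dominant_from:
  assumes "partition_shape l"
  shows "finite {w. length w = r \<and> dominant_from l w} \<and> card {w. length w = r \<and> dominant_from l w} \<le> walks r l"
  using assms
proof (induction r arbitrary: l)
  case 0
  have "{w. length w = 0 \<and> dominant_from l w} = (if l = (\<lambda>_. 0) then {[]} else {})"
    by auto
  then show ?case by simp
next
  case (Suc r)
  let ?W = "\<lambda>l. {w. length w = r \<and> dominant_from l w}"
  let ?U = "\<Union>i\<in>up_rows l. (#) (int i + 1) ` ?W (bump l i 1)"
  let ?D = "\<Union>i\<in>down_rows l. (#) (- int i - 1) ` ?W (bump l i (-1))"
  have fin: "finite (up_rows l)" "finite (down_rows l)"
    using Suc.prems by (simp_all add: finite_up_rows finite_down_rows)
  have sub: "{w. length w = Suc r \<and> dominant_from l w} \<subseteq> ?U \<union> ?D"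
  proof
    fix w assume "w \<in> {w. length w = Suc r \<and> dominant_from l w}"
    then obtain a u where w: "w = a # u" "length u = r" "a \<noteq> 0" "partition_shape (step l a)" "dominant_from (step l a) u"
      by (cases w) auto
    show "w \<in> ?U \<union> ?D"
    proof (cases "a > 0")
      case True
      then have "step l a = bump l (row a) 1" "a = int (row a) + 1" by (auto simp: step_def row_def)
      then show ?thesis using w by (auto simp: up_rows_def image_iff)
    next
      case False
      then have "step l a = bump l (row a) (-1)" "a = - int (row a) - 1" using w(3) by (auto simp: step_def row_def)
      then show ?thesis using w by (auto simp: down_rows_def image_iff)
    qed
  qed
  have finUD: "finite ?U" "finite ?D"
    using fin Suc.IH[OF partition_shape_up] Suc.IH[OF partition_shape_down] by auto
  have "card {w. length w = Suc r \<and> dominant_from l w} \<le> card (?U \<union> ?D)"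
    using finUD sub by (intro card_mono) auto
  also have "\<dots> \<le> card ?U + card ?D" by (rule card_Un_le)
  also have "card ?U \<le> (\<Sum>i\<in>up_rows l. card ((#) (int i + 1) ` ?W (bump l i 1)))"
    using fin(1) by (rule card_UN_le)
  also have "\<dots> \<le> (\<Sum>i\<in>up_rows l. walks r (bump l i 1))"
    by (intro sum_mono) (simp add: card_image Suc.IH[OF partition_shape_up])
  also have "card ?D \<le> (\<Sum>i\<in>down_rows l. card ((#) (- int i - 1) ` ?W (bump l i (-1))))"
    using fin(2) by (rule card_UN_le)
  also have "\<dots> \<le> (\<Sum>i\<in>down_rows l. walks r (bump l i (-1)))"
    by (intro sum_mono) (simp add: card_image Suc.IH[OF partition_shape_down])
  finally show ?case using finUD sub finite_subset[of _ "?U \<union> ?D"] by auto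
qed

text \<open>
  Hence there are no more dominant closed words of length \<open>2n\<close> than perfect matchings of
  \<open>2n\<close> points.
\<close>
lemma card_dominant_closed:
  "finite {w. length w = 2 * n \<and> dominant_from (\<lambda>_. 0) w}"
  "card {w. length w = 2 * n \<and> dominant_from (\<lambda>_. 0) w} \<le> num_matchings n"
  using card_dominant_from[OF partition_shape_zero, of "2 * n"] by (simp_all add: walks_closed)

section \<open>Multilinear forms in coordinates\<close>

text \<open>
  The letter \<open>l\<close> with \<open>0 < l \<le> m\<close> stands for the basis vector of index \<open>l\<close>, and \<open>- l\<close> for its dual
  partner.  With these names a word over a small alphabet is also a word over every larger one, so
  forms for different ranks can be compared.
\<close>
definition alphabet :: "nat \<Rightarrow> int set" where
  "alphabet m = {l. l \<noteq> 0 \<and> \<bar>l\<bar> \<le> int m}"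

definition pairing :: "int \<Rightarrow> int \<Rightarrow> 'k::field" where
  "pairing l k = (if k = - l then of_int (sgn l) else 0)"

definition words :: "nat \<Rightarrow> nat \<Rightarrow> int list set" where
  "words m r = {w. length w = r \<and> set w \<subseteq> alphabet m}"

text \<open>
  The value at \<open>(x_1, ..., x_r)\<close> of the multilinear map with coefficients \<open>f\<close>, where the entries
  \<open>A x\<close> are the coordinates of \<open>x\<close>.  If the \<open>x_i\<close> are letters, then \<open>A\<close> is a matrix and this is the
  action of \<open>A\<close> on forms.
\<close>
fun expand :: "('k \<Rightarrow> 'u \<Rightarrow> 'u::comm_monoid_add) \<Rightarrow> 'l set \<Rightarrow> ('x \<Rightarrow> 'l \<Rightarrow> 'k) \<Rightarrow> ('l list \<Rightarrow> 'u) \<Rightarrow> 'x list \<Rightarrow> 'u" where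
  "expand s L A f [] = f []"
| "expand s L A f (x # xs) = (\<Sum>b\<in>L. s (A x b) (expand s L A (\<lambda>w. f (b # w)) xs))"

definition symplectic_matrix :: "nat \<Rightarrow> (int \<Rightarrow> int \<Rightarrow> 'k::field) \<Rightarrow> bool" where
  "symplectic_matrix m A \<longleftrightarrow> (\<forall>a\<in>alphabet m. \<forall>a'\<in>alphabet m.
     (\<Sum>b\<in>alphabet m. \<Sum>c\<in>alphabet m. A a b * A a' c * pairing b c) = pairing a a')"

definition invariant_form :: "nat \<Rightarrow> nat \<Rightarrow> (int list \<Rightarrow> 'k::field) \<Rightarrow> bool" where
  "invariant_form m r f \<longleftrightarrow> (\<forall>A. symplectic_matrix m A \<longrightarrow>
     (\<forall>w\<in>words m r. expand (*) (alphabet m) A f w = f w))"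

lemma finite_alphabet [simp]: "finite (alphabet m)"
  by (rule finite_subset[of _ "{- int m..int m}"]) (auto simp: alphabet_def)

lemma uminus_alphabet [simp]: "- l \<in> alphabet m \<longleftrightarrow> l \<in> alphabet m"
  by (auto simp: alphabet_def)

lemma expand_cong:
  assumes "\<And>w. length w = length xs \<Longrightarrow> set w \<subseteq> L \<Longrightarrow> f w = g w"
  shows "expand s L A f xs = expand s L A g xs"
  using assms
proof (induction xs arbitrary: f g)
  case (Cons x xs)
  show ?case
    by (simp, intro sum.cong refl arg_cong2[where f = s] Cons.IH) (auto intro!: Cons.prems)
qed simp

lemma expand_zero: "expand (*) L A (\<lambda>_. 0 :: 'k::field) xs = 0"
  by (induction xs) auto

lemma expand_add:
  "expand (*) L A (\<lambda>w. f w + g w :: 'k::field) xs = expand (*) L A f xs + expand (*) L A g xs"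
  by (induction xs arbitrary: f g) (auto simp: distrib_left sum.distrib)

lemma expand_scale:
  "expand (*) L A (\<lambda>w. c * f w :: 'k::field) xs = c * expand (*) L A f xs"
  by (induction xs arbitrary: f) (auto simp: sum_distrib_left mult_ac)

lemma expand_sum:
  "finite I \<Longrightarrow> expand (*) L A (\<lambda>w. \<Sum>i\<in>I. f i w :: 'k::field) xs = (\<Sum>i\<in>I. expand (*) L A (f i) xs)"
  by (induction I rule: finite_induct) (auto simp: expand_zero expand_add)

lemma expand_diagonal:
  assumes "finite L" "set w \<subseteq> L"
  shows "expand (*) L (\<lambda>a b. if b = a then d a else 0 :: 'k::field) f w = prod_list (map d w) * f w"
  using assms(2)
proof (induction w arbitrary: f)
  case (Cons a w)
  then show ?case using assms(1)
    by (simp add: if_distrib[of "\<lambda>x. x * _"] sum.delta mult.assoc cong: if_cong)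
qed simp

definition weight :: "int list \<Rightarrow> nat \<Rightarrow> int" where
  "weight w i = (\<Sum>a\<leftarrow>w. if row a = i then sgn a else 0)"

lemma foldl_step: "foldl step l w = (\<lambda>i. l i + weight w i)"
  by (induction w arbitrary: l) (auto simp: weight_def step_def bump_def fun_eq_iff)

text \<open>
  This is the only place where the infinity of the field enters: it separates the weights of a
  torus.
\<close>
lemma power_int_all_one:
  assumes inf: "infinite (UNIV :: 'k::field set)" and one: "\<And>t::'k. t \<noteq> 0 \<Longrightarrow> t powi k = 1"
  shows "k = 0"
proof (rule ccontr)
  assume "k \<noteq> 0"
  have pw: "t ^ nat \<bar>k\<bar> = 1" if "t \<noteq> 0" for t :: 'k
  proof (cases "k \<ge> 0")
    case True then show ?thesis using one[OF that] by (simp add: power_int_def)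
  next
    case False then show ?thesis using one[OF that] by (simp add: power_int_def power_inverse)
  qed
  define p :: "'k poly" where "p = monom 1 (nat \<bar>k\<bar>) - 1"
  have "coeff p (nat \<bar>k\<bar>) = 1" using \<open>k \<noteq> 0\<close> by (simp add: p_def)
  then have "p \<noteq> 0" by auto
  then have "finite {t. poly p t = 0}" by (rule poly_roots_finite)
  moreover have "UNIV - {0} \<subseteq> {t. poly p t = 0}" using pw by (auto simp: p_def poly_monom)
  ultimately have "finite (UNIV - {0::'k})" by (rule finite_subset[rotated])
  then show False using inf by simp
qed

text \<open>
  The diagonal matrices that multiply the basis vector of one letter by \<open>t\<close> and its partner by
  \<open>1/t\<close> are symplectic.
\<close>
lemma invariant_weight_zero:
  fixes f :: "int list \<Rightarrow> 'k::field"
  assumes inf: "infinite (UNIV :: 'k set)" and f: "invariant_form m r f"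
    and w: "w \<in> words m r" and nz: "f w \<noteq> 0"
  shows "weight w = (\<lambda>_. 0)"
proof
  fix i
  have "(t::'k) powi weight w i = 1" if t: "t \<noteq> 0" for t
  proof -
    define d where "d a = (if row a = i then t powi sgn a else 1)" for a
    let ?A = "\<lambda>a b. if b = a then d a else 0"
    have dd: "d a * d (- a) = 1" if "a \<noteq> 0" for a
      using that t by (auto simp: d_def row_def power_int_minus)
    have "symplectic_matrix m ?A"
      unfolding symplectic_matrix_def
    proof (intro ballI)
      fix a a' assume a: "a \<in> alphabet m" "a' \<in> alphabet m"
      have "(\<Sum>b\<in>alphabet m. \<Sum>c\<in>alphabet m. ?A a b * ?A a' c * pairing b c)
          = (\<Sum>b\<in>alphabet m. if b = a then (\<Sum>c\<in>alphabet m. if c = a' then d a * d a' * pairing a a' else 0) else 0)"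
      proof (intro sum.cong refl)
        fix b
        have "?A a b * ?A a' c * pairing b c = (if b = a then if c = a' then d a * d a' * pairing a a' else 0 else 0)" for c
          by simp
        then show "(\<Sum>c\<in>alphabet m. ?A a b * ?A a' c * pairing b c)
            = (if b = a then (\<Sum>c\<in>alphabet m. if c = a' then d a * d a' * pairing a a' else 0) else 0)"
          by simp
      qed
      also have "\<dots> = d a * d a' * pairing a a'" using a by (simp add: sum.delta)
      also have "\<dots> = pairing a a'" using dd[of a] a by (auto simp: pairing_def alphabet_def)
      finally show "(\<Sum>b\<in>alphabet m. \<Sum>c\<in>alphabet m. ?A a b * ?A a' c * pairing b c) = pairing a a'" .
    qed
    then have "f w = prod_list (map d w) * f w"
      using f w expand_diagonal[OF finite_alphabet, of w m d f] by (auto simp: invariant_form_def words_def)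
    then have "prod_list (map d w) = 1" using nz by simp
    moreover have "prod_list (map d w) = t powi weight w i"
      using t by (induction w) (auto simp: weight_def d_def power_int_add)
    ultimately show ?thesis by simp
  qed
  then show "weight w i = 0" by (rule power_int_all_one[OF inf])
qed

section \<open>Root elements\<close>

text \<open>
  The transformation that adds to each letter \<open>a\<close> of \<open>S\<close> the multiple \<open>ep a\<close> of the letter \<open>tg a\<close> in
  \<open>T\<close> is a root element of a group of type \<open>SL_2\<close>, in which each pair \<open>(a, tg a)\<close> spans a natural
  module and the other letters are fixed.  The function \<open>key\<close> orders the letters in such a way that
  the element is upper triangular.
\<close>
locale root_element =
  fixes L S T :: "int set" and tg sr :: "int \<Rightarrow> int" and ep :: "int \<Rightarrow> 'k::field"
    and key :: "int \<Rightarrow> int"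
  assumes finite_L: "finite L" and S_sub: "S \<subseteq> L" and T_sub: "T \<subseteq> L" and disjoint: "S \<inter> T = {}"
    and tg: "a \<in> S \<Longrightarrow> tg a \<in> T" and sr: "b \<in> T \<Longrightarrow> sr b \<in> S"
    and tg_sr: "b \<in> T \<Longrightarrow> tg (sr b) = b"
    and ep: "a \<in> S \<Longrightarrow> ep a \<noteq> 0"
    and key: "a \<in> S \<Longrightarrow> key (tg a) < key a"
begin

definition mat :: "int \<Rightarrow> int \<Rightarrow> 'k" where
  "mat a b = (if b = a then 1 else 0) + (if a \<in> S \<and> b = tg a then ep a else 0)"

abbreviation act :: "(int list \<Rightarrow> 'k) \<Rightarrow> int list \<Rightarrow> 'k" where
  "act \<equiv> expand (*) L mat"

lemma sum_mat:
  assumes "a \<in> L"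
  shows "(\<Sum>b\<in>L. mat a b * F b) = F a + (if a \<in> S then ep a * F (tg a) else 0)"
proof -
  have "(\<Sum>b\<in>L. mat a b * F b) = (\<Sum>b\<in>L. (if b = a then F a else 0) + (if a \<in> S then (if b = tg a then ep a * F (tg a) else 0) else 0))"
    by (intro sum.cong refl) (auto simp: mat_def distrib_right)
  also have "\<dots> = F a + (if a \<in> S then ep a * F (tg a) else 0)"
    using assms finite_L tg T_sub by (auto simp: sum.distrib sum.delta)
  finally show ?thesis .
qed

lemma act_Cons:
  "a \<in> L \<Longrightarrow> act f (a # w) = act (\<lambda>u. f (a # u)) w + (if a \<in> S then ep a * act (\<lambda>u. f (tg a # u)) w else 0)"
  by (simp add: sum_mat)

text \<open>
  The weight for the torus of this \<open>SL_2\<close>.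
\<close>
definition bal :: "int list \<Rightarrow> int" where
  "bal u = (\<Sum>a\<leftarrow>u. if a \<in> T then 1 else if a \<in> S then - 1 else 0)"

lemma bal_simps [simp]:
  "bal [] = 0"
  "bal (a # u) = (if a \<in> T then 1 else if a \<in> S then - 1 else 0) + bal u"
  "bal (u @ w) = bal u + bal w"
  by (simp_all add: bal_def)

text \<open>
  On one tensor position, with \<open>b = tg a\<close>, the functional \<open>ep a\<close> times the \<open>b\<close>-coefficient minus
  the \<open>a\<close>-coefficient; on all positions of the word with a letter in \<open>T\<close> at once.  Applied to a form
  transformed by the root element, it becomes minus the \<open>a\<close>-coefficient alone, as the two multiples
  of the \<open>b\<close>-coefficient cancel.  So it plays the part of the Weyl group reflection.
\<close>
fun reflect :: "(int list \<Rightarrow> 'k) \<Rightarrow> int list \<Rightarrow> 'k" where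
  "reflect f [] = f []"
| "reflect f (b # u) = (if b \<in> T
     then ep (sr b) * reflect (\<lambda>u. f (b # u)) u - reflect (\<lambda>u. f (sr b # u)) u
     else reflect (\<lambda>u. f (b # u)) u)"

lemma reflect_linear: "reflect (\<lambda>u. f u + c * g u) u = reflect f u + c * reflect g u"
  by (induction u arbitrary: f g) (auto simp: algebra_simps)

lemma reflect_cong:
  assumes "\<And>w. length w = length u \<Longrightarrow> set w \<subseteq> L \<Longrightarrow> f w = g w" "set u \<subseteq> L"
  shows "reflect f u = reflect g u"
  using assms
proof (induction u arbitrary: f g)
  case (Cons b u)
  have *: "reflect (\<lambda>u. f (c # u)) u = reflect (\<lambda>u. g (c # u)) u" if "c \<in> L" for c
    using Cons that by (intro Cons.IH) auto
  show ?case using *[of b] *[of "sr b"] Cons.prems(2) sr S_sub by auto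
qed simp

lemma reflect_zero:
  "(\<And>w. length w = length u \<Longrightarrow> set w \<subseteq> L \<Longrightarrow> bal w \<le> bal u \<Longrightarrow> f w = 0) \<Longrightarrow> set u \<subseteq> L \<Longrightarrow> reflect f u = 0"
proof (induction u arbitrary: f)
  case (Cons b u)
  have 1: "reflect (\<lambda>u. f (b # u)) u = 0"
    using Cons by (intro Cons.IH) auto
  have 2: "reflect (\<lambda>u. f (sr b # u)) u = 0" if "b \<in> T"
    using Cons that sr[OF that] S_sub disjoint by (intro Cons.IH) auto
  show ?case using 1 2 by auto
qed simp

lemma reflect_lowest:
  "(\<And>w. length w = length u \<Longrightarrow> set w \<subseteq> L \<Longrightarrow> bal w < bal u \<Longrightarrow> f w = 0) \<Longrightarrow> set u \<subseteq> L
   \<Longrightarrow> \<exists>c. c \<noteq> 0 \<and> reflect f u = c * f u"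
proof (induction u arbitrary: f)
  case Nil
  show ?case by (intro exI[of _ 1]) auto
next
  case (Cons b u)
  have 1: "\<exists>c. c \<noteq> 0 \<and> reflect (\<lambda>u. f (b # u)) u = c * f (b # u)"
    using Cons by (intro Cons.IH) auto
  have 2: "reflect (\<lambda>u. f (sr b # u)) u = 0" if "b \<in> T"
  proof -
    have "sr b \<in> S" "sr b \<in> L" "sr b \<notin> T" using sr[OF that] S_sub disjoint by auto
    then show ?thesis using Cons that by (intro reflect_zero) auto
  qed
  obtain c where c: "c \<noteq> 0" "reflect (\<lambda>u. f (b # u)) u = c * f (b # u)" using 1 by blast
  show ?case
  proof (cases "b \<in> T")
    case True
    then have "ep (sr b) * c \<noteq> 0" "reflect f (b # u) = (ep (sr b) * c) * f (b # u)"
      using c 2 ep[OF sr] by auto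
    then show ?thesis by blast
  qed (use c in auto)
qed

text \<open>
  By the cancellation just described, the reflection of the transformed form reads coefficients
  in which all letters of \<open>T\<close> have been moved to \<open>S\<close>, and their balance is at most \<open>- bal u\<close>.
\<close>
lemma reflect_act:
  "(\<And>w. length w = length u \<Longrightarrow> set w \<subseteq> L \<Longrightarrow> bal w \<le> - bal u \<Longrightarrow> f w = 0) \<Longrightarrow> set u \<subseteq> L
   \<Longrightarrow> reflect (act f) u = 0"
proof (induction u arbitrary: f)
  case (Cons b u)
  have bL: "b \<in> L" and uL: "set u \<subseteq> L" using Cons.prems by auto
  consider "b \<in> T" | "b \<in> S" | "b \<notin> T" "b \<notin> S" by blast
  then show ?case
  proof cases
    case 1
    have s: "sr b \<in> S" "sr b \<in> L" "sr b \<notin> T" "tg (sr b) = b" using sr[OF 1] S_sub tg_sr[OF 1] disjoint by auto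
    have bS: "b \<notin> S" using 1 disjoint by blast
    have "reflect (\<lambda>u. act f (sr b # u)) u
        = reflect (act (\<lambda>u. f (sr b # u))) u + ep (sr b) * reflect (act (\<lambda>u. f (b # u))) u"
      using s by (simp only: act_Cons if_True reflect_linear)
    moreover have "reflect (\<lambda>u. act f (b # u)) u = reflect (act (\<lambda>u. f (b # u))) u"
      using bL bS by (simp only: act_Cons) simp
    moreover have "reflect (act (\<lambda>u. f (sr b # u))) u = 0"
      using Cons.prems 1 s by (intro Cons.IH) auto
    ultimately show ?thesis using 1 by (simp del: expand.simps)
  next
    case 2
    have t: "tg b \<in> T" "tg b \<in> L" using tg[OF 2] T_sub by auto
    have bT: "b \<notin> T" using 2 disjoint by blast
    have "reflect (\<lambda>u. act f (b # u)) u
        = reflect (act (\<lambda>u. f (b # u))) u + ep b * reflect (act (\<lambda>u. f (tg b # u))) u"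
      using bL 2 by (simp only: act_Cons if_True reflect_linear)
    moreover have "reflect (act (\<lambda>u. f (b # u))) u = 0"
      using Cons.prems 2 bT by (intro Cons.IH) auto
    moreover have "reflect (act (\<lambda>u. f (tg b # u))) u = 0"
      using Cons.prems 2 t bT by (intro Cons.IH) auto
    ultimately show ?thesis using bT by (simp del: expand.simps)
  next
    case 3
    have "reflect (\<lambda>u. act f (b # u)) u = reflect (act (\<lambda>u. f (b # u))) u"
      using bL 3 by (simp only: act_Cons) simp
    moreover have "reflect (act (\<lambda>u. f (b # u))) u = 0"
      using Cons.prems 3 by (intro Cons.IH) auto
    ultimately show ?thesis using 3 by (simp del: expand.simps)
  qed
qed simp

text \<open>
  An invariant of the root element cannot have a weight of the wrong sign.  This is the
  characteristic-free form of the theorem that highest weights are dominant: computing the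
  reflection of \<open>act f = f\<close> in the two ways given by \<open>reflect_lowest\<close> and \<open>reflect_act\<close>, the first
  returns a nonzero multiple of \<open>f u\<close> and the second returns \<open>0\<close>.
\<close>
lemma act_invariant_zero:
  assumes inv: "\<And>w. length w = r \<Longrightarrow> set w \<subseteq> L \<Longrightarrow> act f w = f w"
    and hom: "\<And>w. length w = r \<Longrightarrow> set w \<subseteq> L \<Longrightarrow> f w \<noteq> 0 \<Longrightarrow> bal w = d"
    and d: "0 < d" and u: "length u = r" "set u \<subseteq> L"
  shows "f u = 0"
proof (rule ccontr)
  assume nz: "f u \<noteq> 0"
  then have bu: "bal u = d" using hom u by blast
  have "\<exists>c. c \<noteq> 0 \<and> reflect f u = c * f u"
    using hom u bu by (intro reflect_lowest) fastforce+
  moreover have "reflect f u = reflect (act f) u"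
    using inv u by (intro reflect_cong) auto
  moreover have "reflect (act f) u = 0"
    using hom u bu d by (intro reflect_act) fastforce+
  ultimately show False using nz by auto
qed

definition weakly_below :: "int \<Rightarrow> int \<Rightarrow> bool" where
  "weakly_below a b \<longleftrightarrow> a = b \<or> key a < key b"

lemma act_zero_below:
  "(\<And>p' u'. list_all2 weakly_below p' p \<Longrightarrow> length u' = length u \<Longrightarrow> set (p' @ u') \<subseteq> L \<Longrightarrow> h (p' @ u') = 0)
   \<Longrightarrow> set (p @ u) \<subseteq> L \<Longrightarrow> act h (p @ u) = 0"
proof (induction p arbitrary: h)
  case Nil
  have "act h u = act (\<lambda>_. 0) u"
    using Nil.prems(1)[of "[]"] by (intro expand_cong) auto
  then show ?case by (simp add: expand_zero)
next
  case (Cons a p)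
  have *: "act (\<lambda>w. h (c # w)) (p @ u) = 0" if "weakly_below c a" "c \<in> L" for c
  proof (rule Cons.IH)
    fix p' u' assume "list_all2 weakly_below p' p" "length u' = length u" "set (p' @ u') \<subseteq> L"
    then show "h (c # p' @ u') = 0" using Cons.prems(1)[of "c # p'" u'] that by auto
  qed (use Cons.prems in auto)
  have "act (\<lambda>w. h (a # w)) (p @ u) = 0"
    using Cons.prems(2) by (intro *) (auto simp: weakly_below_def)
  moreover have "act (\<lambda>w. h (tg a # w)) (p @ u) = 0" if "a \<in> S"
    using tg[OF that] key[OF that] T_sub by (intro *) (auto simp: weakly_below_def)
  ultimately show ?case using Cons.prems(2) act_Cons[of a h "p @ u"] by (auto simp del: expand.simps)
qed

text \<open>
  A root element moves a prefix only to prefixes that are pointwise smaller.  If the form vanishes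
  on those, then fixing the prefix commutes with the action, so that the form restricted to the
  remaining positions is again invariant.
\<close>
lemma act_at_minimal_prefix:
  "(\<And>p' u'. list_all2 weakly_below p' p \<Longrightarrow> p' \<noteq> p \<Longrightarrow> length u' = length u \<Longrightarrow> set (p' @ u') \<subseteq> L \<Longrightarrow> h (p' @ u') = 0)
   \<Longrightarrow> set (p @ u) \<subseteq> L \<Longrightarrow> act h (p @ u) = act (\<lambda>u. h (p @ u)) u"
proof (induction p arbitrary: h)
  case (Cons a p)
  have 1: "act (\<lambda>w. h (a # w)) (p @ u) = act (\<lambda>u. h (a # p @ u)) u"
  proof (rule Cons.IH)
    fix p' u' assume "list_all2 weakly_below p' p" "p' \<noteq> p" "length u' = length u" "set (p' @ u') \<subseteq> L"
    then show "h (a # p' @ u') = 0"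
      using Cons.prems(1)[of "a # p'" u'] Cons.prems(2) by (simp add: weakly_below_def[of a a])
  qed (use Cons.prems in auto)
  have 2: "act (\<lambda>w. h (tg a # w)) (p @ u) = 0" if "a \<in> S"
  proof (rule act_zero_below)
    fix p' u' assume "list_all2 weakly_below p' p" "length u' = length u" "set (p' @ u') \<subseteq> L"
    moreover have "weakly_below (tg a) a" "tg a \<noteq> a" "tg a \<in> L"
      using tg[OF that] key[OF that] T_sub by (auto simp: weakly_below_def)
    ultimately show "h (tg a # p' @ u') = 0"
      using Cons.prems(1)[of "tg a # p'" u'] by simp
  qed (use Cons.prems in auto)
  have "act h ((a # p) @ u) = act (\<lambda>w. h (a # w)) (p @ u) + (if a \<in> S then ep a * act (\<lambda>w. h (tg a # w)) (p @ u) else 0)"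
    using Cons.prems(2) act_Cons[of a h "p @ u"] by simp
  then show ?case using 1 2 by (auto simp del: expand.simps)
qed simp

lemma bal_minimal_prefix_nonneg:
  assumes inv: "\<And>w. length w = r \<Longrightarrow> set w \<subseteq> L \<Longrightarrow> act f w = f w"
    and hom: "\<And>w. length w = r \<Longrightarrow> set w \<subseteq> L \<Longrightarrow> f w \<noteq> 0 \<Longrightarrow> bal w = 0"
    and min: "\<And>p' u'. list_all2 weakly_below p' p \<Longrightarrow> p' \<noteq> p \<Longrightarrow> length (p' @ u') = r \<Longrightarrow> set (p' @ u') \<subseteq> L \<Longrightarrow> f (p' @ u') = 0"
    and u: "length (p @ u) = r" "set (p @ u) \<subseteq> L" "f (p @ u) \<noteq> 0"
  shows "0 \<le> bal p"
proof (rule ccontr)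
  assume neg: "\<not> 0 \<le> bal p"
  have "f (p @ u) = 0"
  proof (rule act_invariant_zero[of "length u" "\<lambda>u. f (p @ u)" "- bal p"])
    fix w assume w: "length w = length u" "set w \<subseteq> L"
    have "act f (p @ w) = act (\<lambda>u. f (p @ u)) w"
    proof (rule act_at_minimal_prefix)
      fix p' u' assume a: "list_all2 weakly_below p' p" "p' \<noteq> p" "length u' = length w" "set (p' @ u') \<subseteq> L"
      then show "f (p' @ u') = 0"
        using min[of p' u'] w u(1) list_all2_lengthD[OF a(1)] by simp
    qed (use w u in auto)
    then show "act (\<lambda>u. f (p @ u)) w = f (p @ w)" using inv[of "p @ w"] w u by simp
  next
    fix w assume w: "length w = length u" "set w \<subseteq> L" "f (p @ w) \<noteq> 0"
    then have "bal (p @ w) = 0" using u by (intro hom) auto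
    then show "bal w = - bal p" by simp
  qed (use neg u in auto)
  then show False using u by simp
qed

end

section \<open>Invariant forms and dominant words\<close>

text \<open>
  Reduction modulo \<open>2m + 1\<close> lists the letters in the order \<open>1, ..., m, -m, ..., -1\<close>, for which the
  simple root elements are upper triangular.
\<close>
lemma root_key_facts:
  fixes a m :: int
  assumes "a \<noteq> 0" "\<bar>a\<bar> \<le> m"
  shows "a mod (2 * m + 1) = (if a > 0 then a else a + (2 * m + 1))"
proof (cases "a > 0")
  case True then show ?thesis using assms by simp
next
  case False
  have "a mod (2 * m + 1) = (a + (2 * m + 1)) mod (2 * m + 1)" by simp
  also have "\<dots> = a + (2 * m + 1)" using assms False by (intro mod_pos_pos_trivial) auto
  finally show ?thesis using False by simp
qed

text \<open>
  Expanding the symplectic condition, only the terms with a source letter have to cancel.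
\<close>
lemma symplectic_root:
  fixes ep :: "int \<Rightarrow> 'k::field"
  assumes r: "root_element (alphabet m) S T tg sr ep key"
    and eq: "\<And>a a'. a \<in> alphabet m \<Longrightarrow> a' \<in> alphabet m \<Longrightarrow>
       (if a' \<in> S then ep a' * pairing a (tg a') else 0) +
       (if a \<in> S then ep a * (pairing (tg a) a' + (if a' \<in> S then ep a' * pairing (tg a) (tg a') else 0)) else 0) = (0::'k)"
  shows "symplectic_matrix m (root_element.mat S tg ep)"
  unfolding symplectic_matrix_def
proof (intro ballI)
  interpret root_element "alphabet m" S T tg sr ep key by fact
  fix a a' assume a: "a \<in> alphabet m" "a' \<in> alphabet m"
  have "(\<Sum>b\<in>alphabet m. \<Sum>c\<in>alphabet m. mat a b * mat a' c * pairing b c)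
     = (\<Sum>b\<in>alphabet m. mat a b * (\<Sum>c\<in>alphabet m. mat a' c * pairing b c))"
    by (simp add: sum_distrib_left mult.assoc)
  also have "\<dots> = pairing a a'"
  proof -
    have inner: "(\<Sum>c\<in>alphabet m. mat a' c * pairing x c)
        = pairing x a' + (if a' \<in> S then ep a' * pairing x (tg a') else 0)" for x
      by (rule sum_mat[OF a(2)])
    show ?thesis
      unfolding inner sum_mat[OF a(1)] using eq[OF a] by (simp add: add.assoc distrib_left)
  qed
  finally show "(\<Sum>b\<in>alphabet m. \<Sum>c\<in>alphabet m. mat a b * mat a' c * pairing b c) = pairing a a'" .
qed

lemma short_root_element:
  fixes i m :: nat
  assumes "Suc i < m"
  defines "S \<equiv> {int i + 2, - int i - 1}" and "T \<equiv> {int i + 1, - int i - 2}"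
  defines "tg \<equiv> \<lambda>a. a - 1" and "sr \<equiv> \<lambda>a. a + 1"
  defines "ep \<equiv> \<lambda>a. if a > 0 then 1 else - 1 :: 'k::field"
  shows "root_element (alphabet m) S T tg sr ep (\<lambda>a. a mod (2 * int m + 1))"
    and "symplectic_matrix m (root_element.mat S tg ep)"
proof -
  show r: "root_element (alphabet m) S T tg sr ep (\<lambda>a. a mod (2 * int m + 1))"
    using assms(1) finite_alphabet[of m]
    by unfold_locales (auto simp: S_def T_def tg_def sr_def ep_def alphabet_def root_key_facts)
  show "symplectic_matrix m (root_element.mat S tg ep)"
    by (rule symplectic_root[OF r]) (auto simp: S_def tg_def ep_def pairing_def)
qed

lemma long_root_element:
  fixes m :: nat
  assumes "1 \<le> m"
  defines "S \<equiv> {- int m}" and "T \<equiv> {int m}"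
  defines "tg \<equiv> \<lambda>a. - a" and "sr \<equiv> \<lambda>a. - a"
  defines "ep \<equiv> \<lambda>a. 1 :: 'k::field"
  shows "root_element (alphabet m) S T tg sr ep (\<lambda>a. a mod (2 * int m + 1))"
    and "symplectic_matrix m (root_element.mat S tg ep)"
proof -
  show r: "root_element (alphabet m) S T tg sr ep (\<lambda>a. a mod (2 * int m + 1))"
    using assms(1) finite_alphabet[of m]
    by unfold_locales (auto simp: S_def T_def tg_def sr_def ep_def alphabet_def root_key_facts)
  show "symplectic_matrix m (root_element.mat S tg ep)"
    by (rule symplectic_root[OF r]) (auto simp: S_def tg_def ep_def pairing_def)
qed

fun dominant_prefix :: "int list \<Rightarrow> (nat \<Rightarrow> int) \<Rightarrow> bool" where
  "dominant_prefix [] l \<longleftrightarrow> True"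
| "dominant_prefix (a # w) l \<longleftrightarrow> a \<noteq> 0 \<and> partition_shape (step l a) \<and> dominant_prefix w (step l a)"

lemma dominant_prefix_snoc:
  "dominant_prefix (p @ [a]) l \<longleftrightarrow> dominant_prefix p l \<and> a \<noteq> 0 \<and> partition_shape (step (foldl step l p) a)"
  by (induction p arbitrary: l) auto

lemma dominant_from_iff:
  "dominant_from l w \<longleftrightarrow> dominant_prefix w l \<and> foldl step l w = (\<lambda>_. 0)"
  by (induction w arbitrary: l) auto

lemma weight_outside:
  assumes "set p \<subseteq> alphabet m" "m \<le> i"
  shows "weight p i = 0"
  using assms(1) by (induction p) (use assms(2) in \<open>auto simp: weight_def alphabet_def row_def\<close>)

lemma partition_shape_weight:
  assumes p: "set p \<subseteq> alphabet m" and m: "1 \<le> m"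
    and short: "\<And>i. Suc i < m \<Longrightarrow> weight p (Suc i) \<le> weight p i" and long: "0 \<le> weight p (m - 1)"
  shows "partition_shape (weight p)"
proof -
  have dec: "weight p (Suc i) \<le> weight p i" for i
  proof -
    consider "Suc i < m" | "i = m - 1" "Suc i = m" | "m \<le> i" using m by linarith
    then show ?thesis
      using short long weight_outside[OF p, of i] weight_outside[OF p, of "Suc i"] by cases auto
  qed
  have anti: "weight p (i + k) \<le> weight p i" for i k
  proof (induction k)
    case (Suc k)
    then show ?case using dec[of "i + k"] by simp
  qed simp
  have "0 \<le> weight p i" for i
    using weight_outside[OF p, of "i + m"] anti[of i m] by simp
  moreover have "finite {i. weight p i \<noteq> 0}"
  proof (rule finite_subset)
    show "{i. weight p i \<noteq> 0} \<subseteq> {..<m}" using weight_outside[OF p] not_less by blast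
  qed simp
  ultimately show ?thesis using dec by (auto simp: partition_shape_def)
qed

text \<open>
  An invariant form is determined by its coefficients at the dominant words.  A nonzero form has a
  nonzero coefficient that is found greedily: extend a prefix by the smallest letter for which some
  coefficient remains nonzero.  All pointwise smaller prefixes then have zero coefficients, and the
  simple root elements show that the weight of each such prefix is dominant.  The weight of
  the whole word is zero by the action of the torus.  So the word that is found is dominant.
\<close>
theorem invariant_form_zero:
  fixes f :: "int list \<Rightarrow> 'k::field"
  assumes inf: "infinite (UNIV :: 'k set)" and m: "1 \<le> m" and f: "invariant_form m r f"
    and dom: "\<And>w. w \<in> words m r \<Longrightarrow> dominant_from (\<lambda>_. 0) w \<Longrightarrow> f w = 0"
    and w: "w \<in> words m r"
  shows "f w = 0"
proof (rule ccontr)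
  assume nz: "f w \<noteq> 0"
  define key where "key = (\<lambda>a::int. a mod (2 * int m + 1))"
  define below where "below = (\<lambda>a b. a = b \<or> key a < key b)"
  define minimal where "minimal = (\<lambda>p. \<forall>p' u'. list_all2 below p' p \<longrightarrow> p' \<noteq> p \<longrightarrow> p' @ u' \<in> words m r \<longrightarrow> f (p' @ u') = 0)"

  have part: "partition_shape (weight p)" if p: "minimal p" "p @ u \<in> words m r" "f (p @ u) \<noteq> 0" for p u
  proof (rule partition_shape_weight[OF _ m])
    show "set p \<subseteq> alphabet m" using p by (auto simp: words_def)
    \<comment> \<open>The weight of the whole word is zero, so a negative balance of the prefix would give the
      remaining positions a positive one.\<close>
    have bal: "0 \<le> root_element.bal S T p"
      if r: "root_element (alphabet m) S T tg sr ep key" and s: "symplectic_matrix m (root_element.mat S tg ep)"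
        and b: "\<And>w. set w \<subseteq> alphabet m \<Longrightarrow> weight w = (\<lambda>_. 0) \<Longrightarrow> root_element.bal S T w = 0"
      for S T tg sr and ep :: "int \<Rightarrow> 'k"
    proof -
      interpret root_element "alphabet m" S T tg sr ep key by fact
      have belw: "weakly_below = below" by (simp add: weakly_below_def below_def fun_eq_iff)
      show ?thesis
      proof (rule bal_minimal_prefix_nonneg[of r f p u])
        fix w assume "length w = r" "set w \<subseteq> alphabet m"
        then show "act f w = f w" using f s by (auto simp: invariant_form_def words_def)
      next
        fix w assume "length w = r" "set w \<subseteq> alphabet m" "f w \<noteq> 0"
        then show "bal w = 0" using b invariant_weight_zero[OF inf f] by (auto simp: words_def)
      next
        fix p' u' assume "list_all2 weakly_below p' p" "p' \<noteq> p" "length (p' @ u') = r" "set (p' @ u') \<subseteq> alphabet m"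
        then show "f (p' @ u') = 0"
          using p(1)[unfolded minimal_def, rule_format, of p' u'] belw by (simp add: words_def)
      qed (use p in \<open>auto simp: words_def\<close>)
    qed
    show "weight p (Suc i) \<le> weight p i" if i: "Suc i < m" for i
    proof -
      note R = short_root_element[OF i, where 'k = 'k]
      have eq: "root_element.bal {int i + 2, - int i - 1} {int i + 1, - int i - 2} w = weight w i - weight w (Suc i)"
        if "set w \<subseteq> alphabet m" for w
        using that
      proof (induction w)
        case (Cons a w)
        have "a \<noteq> 0" using Cons.prems by (auto simp: alphabet_def)
        then have "(if a \<in> {int i + 1, - int i - 2} then 1 else if a \<in> {int i + 2, - int i - 1} then - 1 else 0)
            = (if row a = i then sgn a else 0) - (if row a = Suc i then sgn a else 0)"
          by (auto simp: row_def sgn_if)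
        then show ?case
          using Cons by (simp add: root_element.bal_simps(2)[OF R(1)] weight_def)
      qed (simp add: root_element.bal_simps(1)[OF R(1)] weight_def)
      have "0 \<le> root_element.bal {int i + 2, - int i - 1} {int i + 1, - int i - 2} p"
        by (rule bal[OF R[folded key_def]]) (simp add: eq)
      then show ?thesis using eq[of p] p by (auto simp: words_def)
    qed
    show "0 \<le> weight p (m - 1)"
    proof -
      note R = long_root_element[OF m, where 'k = 'k]
      have eq: "root_element.bal {- int m} {int m} w = weight w (m - 1)"
        if "set w \<subseteq> alphabet m" for w
        using that
      proof (induction w)
        case (Cons a w)
        have "a \<in> alphabet m" using Cons.prems by auto
        then have "(if a \<in> {int m} then 1 else if a \<in> {- int m} then - 1 else 0)
            = (if row a = m - 1 then sgn a else 0)"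
          using m by (auto simp: row_def sgn_if alphabet_def)
        then show ?case
          using Cons by (simp add: root_element.bal_simps(2)[OF R(1)] weight_def)
      qed (simp add: root_element.bal_simps(1)[OF R(1)] weight_def)
      have "0 \<le> root_element.bal {- int m} {int m} p"
        by (rule bal[OF R[folded key_def]]) (simp add: eq)
      then show ?thesis using eq[of p] p by (auto simp: words_def)
    qed
  qed
  have "\<exists>p u. length p = k \<and> p @ u \<in> words m r \<and> f (p @ u) \<noteq> 0 \<and> minimal p \<and> dominant_prefix p (\<lambda>_. 0)"
    if "k \<le> r" for k
    using that
  proof (induction k)
    case 0
    show ?case using w nz by (intro exI[of _ "[]"] exI[of _ w]) (auto simp: minimal_def)
  next
    case (Suc k)
    then obtain p u where p: "length p = k" "p @ u \<in> words m r" "f (p @ u) \<noteq> 0" "minimal p" "dominant_prefix p (\<lambda>_. 0)"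
      by auto
    define X where "X = {a. \<exists>u. p @ a # u \<in> words m r \<and> f (p @ a # u) \<noteq> 0}"
    have XL: "X \<subseteq> alphabet m" by (auto simp: X_def words_def)
    have "u \<noteq> []" using Suc.prems p by (auto simp: words_def)
    then have "X \<noteq> {}" using p by (cases u) (auto simp: X_def)
    moreover have "finite X" using XL finite_subset finite_alphabet by blast
    ultimately obtain a where a: "a \<in> X" "\<And>b. b \<in> X \<Longrightarrow> key a \<le> key b"
      using arg_min_if_finite(1)[of X key] arg_min_least[of X _ key] by blast
    then obtain v where v: "p @ a # v \<in> words m r" "f (p @ a # v) \<noteq> 0" by (auto simp: X_def)
    \<comment> \<open>Prefixes that are smaller in an earlier position are excluded by the minimality of \<open>p\<close>, and
      those that differ only in the last letter by the choice of \<open>a\<close>.\<close>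
    have min: "minimal (p @ [a])"
      unfolding minimal_def
    proof (intro allI impI)
      fix q u' assume q: "list_all2 below q (p @ [a])" "q \<noteq> p @ [a]" "q @ u' \<in> words m r"
      then obtain p' z where z: "q = p' @ z" "list_all2 below p' p" "list_all2 below z [a]"
        unfolding list_all2_append2 by blast
      then obtain b where pb: "q = p' @ [b]" "list_all2 below p' p" "below b a"
        by (cases z) auto
      show "f (q @ u') = 0"
      proof (cases "p' = p")
        case False
        then show ?thesis using p(4) pb q(3) by (auto simp: minimal_def)
      next
        case True
        then have "b \<noteq> a" using q pb by auto
        then have "key b < key a" using pb by (auto simp: below_def)
        then have "b \<notin> X" using a(2)[of b] by auto
        then show ?thesis using pb True q(3) by (auto simp: X_def)
      qed
    qed
    have "partition_shape (weight (p @ [a]))"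
      using part[OF min, of v] v by simp
    moreover have "step (foldl step (\<lambda>_. 0) p) a = weight (p @ [a])"
      using foldl_step[of "\<lambda>_. 0" "p @ [a]"] by simp
    moreover have "a \<noteq> 0" using a(1) XL by (auto simp: alphabet_def)
    ultimately have "dominant_prefix (p @ [a]) (\<lambda>_. 0)"
      using p(5) by (simp add: dominant_prefix_snoc)
    then show ?case using min v p(1) by (intro exI[of _ "p @ [a]"] exI[of _ v]) auto
  qed
  from this[of r] obtain p u where p: "length p = r" "p @ u \<in> words m r" "f (p @ u) \<noteq> 0" "dominant_prefix p (\<lambda>_. 0)"
    by auto
  then have u: "u = []" by (auto simp: words_def)
  have "foldl step (\<lambda>_. 0) p = (\<lambda>_. 0)"
    using invariant_weight_zero[OF inf f p(2,3)] u by (simp add: foldl_step)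
  then have "dominant_from (\<lambda>_. 0) p" using p by (simp add: dominant_from_iff)
  then show False using dom p u by auto
qed

section \<open>Matching forms\<close>

text \<open>
  A perfect matching of \<open>2n\<close> points is coded by the index, in the list of the remaining points, of
  the partner of the first point, and then by a code for the points that are left.  In this form the
  number of matchings is evident, and matching forms can be treated by recursion.
\<close>
fun codes :: "nat \<Rightarrow> nat list set" where
  "codes 0 = {[]}"
| "codes (Suc n) = (\<lambda>(k, ks). k # ks) ` ({..<2 * n + 1} \<times> codes n)"

abbreviation delete_at :: "nat \<Rightarrow> 'a list \<Rightarrow> 'a list" where
  "delete_at k w \<equiv> take k w @ drop (Suc k) w"

fun matching_form :: "nat list \<Rightarrow> int list \<Rightarrow> 'k::field" where
  "matching_form [] w = 1"
| "matching_form (k # ks) [] = 0"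
| "matching_form (k # ks) (a # w) = pairing a (w ! k) * matching_form ks (delete_at k w)"

lemma finite_codes [simp]: "finite (codes n)"
  by (induction n) auto

lemma card_codes: "card (codes n) = num_matchings n"
proof (induction n)
  case (Suc n)
  have "inj_on (\<lambda>(k, ks). k # ks) ({..<2 * n + 1} \<times> codes n)" by (auto simp: inj_on_def)
  then show ?case using Suc by (simp add: card_image card_cartesian_product)
qed simp

text \<open>
  The action factors over the position \<open>k\<close> and the other ones.
\<close>
lemma expand_delete_at:
  "k < length w \<Longrightarrow> finite L \<Longrightarrow>
   expand (*) L A (\<lambda>u. h (u ! k) * f (delete_at k u) :: 'k::field) w
   = (\<Sum>c\<in>L. A (w ! k) c * h c) * expand (*) L A f (delete_at k w)"
proof (induction k arbitrary: w f)
  case 0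
  then show ?case
    by (cases w) (simp_all add: expand_scale sum_distrib_right mult.assoc)
next
  case (Suc k)
  then obtain a w' where w: "w = a # w'" "k < length w'" by (cases w) auto
  have "expand (*) L A (\<lambda>u. h (u ! k) * f (b # delete_at k u)) w'
      = (\<Sum>c\<in>L. A (w' ! k) c * h c) * expand (*) L A (\<lambda>u. f (b # u)) (delete_at k w')" for b
    using Suc.IH[OF w(2) Suc.prems(2), of "\<lambda>u. f (b # u)"] .
  then show ?case using w by (simp add: sum_distrib_left mult_ac)
qed

lemma words_delete_at: "w \<in> words m (Suc r) \<Longrightarrow> k < Suc r \<Longrightarrow> delete_at k w \<in> words m r"
  by (auto simp: words_def dest: in_set_takeD in_set_dropD)

lemma invariant_matching_form:
  "c \<in> codes n \<Longrightarrow> invariant_form m (2 * n) (matching_form c :: int list \<Rightarrow> 'k::field)"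
proof (induction n arbitrary: c)
  case 0
  then show ?case by (auto simp: invariant_form_def words_def)
next
  case (Suc n)
  then obtain k ks where c: "c = k # ks" "k < 2 * n + 1" "ks \<in> codes n" by auto
  show ?case
    unfolding invariant_form_def
  proof (intro allI impI ballI)
    fix A :: "int \<Rightarrow> int \<Rightarrow> 'k" and w assume A: "symplectic_matrix m A" and w: "w \<in> words m (2 * Suc n)"
    let ?L = "alphabet m"
    obtain a w' where aw: "w = a # w'" "a \<in> ?L" "w' \<in> words m (Suc (2 * n))"
      using w by (cases w) (auto simp: words_def)
    have kl: "k < length w'" using aw c by (auto simp: words_def)
    have wk: "w' ! k \<in> ?L" using nth_mem[OF kl] aw by (auto simp: words_def)
    have "expand (*) ?L A (matching_form c) w
        = (\<Sum>b\<in>?L. A a b * ((\<Sum>d\<in>?L. A (w' ! k) d * pairing b d) * expand (*) ?L A (matching_form ks) (delete_at k w')))"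
      using expand_delete_at[OF kl finite_alphabet, of m A "pairing b" "matching_form ks" for b] by (simp add: c aw)
    also have "\<dots> = (\<Sum>b\<in>?L. A a b * (\<Sum>d\<in>?L. A (w' ! k) d * pairing b d)) * expand (*) ?L A (matching_form ks) (delete_at k w')"
      by (simp add: sum_distrib_right mult.assoc)
    also have "(\<Sum>b\<in>?L. A a b * (\<Sum>d\<in>?L. A (w' ! k) d * pairing b d)) = pairing a (w' ! k)"
      using A aw(2) wk by (simp add: symplectic_matrix_def sum_distrib_left mult.assoc)
    also have "expand (*) ?L A (matching_form ks) (delete_at k w') = matching_form ks (delete_at k w')"
      using Suc.IH[OF c(3), of] A words_delete_at[OF aw(3), of k] c(2) by (simp add: invariant_form_def)
    finally show "expand (*) ?L A (matching_form c) w = matching_form c w" by (simp add: c aw)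
  qed
qed

text \<open>
  The largest letter occurs only at the first point, and its negative only at the point \<open>k\<close>, in the
  words on which this is tested; so only the matchings that join these two points contribute.
\<close>
lemma matching_forms_independent:
  fixes a :: "nat list \<Rightarrow> 'k::field"
  assumes "\<And>w. w \<in> words n (2 * n) \<Longrightarrow> (\<Sum>c\<in>codes n. a c * matching_form c w) = 0"
    and "c \<in> codes n"
  shows "a c = 0"
  using assms
proof (induction n arbitrary: a c)
  case 0
  then show ?case by (auto simp: words_def)
next
  case (Suc n)
  obtain k ks where c: "c = k # ks" "k < 2 * n + 1" "ks \<in> codes n" using Suc.prems by auto
  have "a (k # ks) = 0"
  proof (rule Suc.IH[OF _ c(3), of "\<lambda>ks. a (k # ks)"])
    fix w assume w: "w \<in> words n (2 * n)"
    \<comment> \<open>The test word: a new pair of letters, at the first point and at the point coded by \<open>k\<close>.\<close>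
    define u where "u = take k w @ (- int (Suc n)) # drop k w"
    have lw: "length w = 2 * n" and sw: "set w \<subseteq> alphabet n" using w by (auto simp: words_def)
    have lu: "length u = 2 * n + 1" using c by (simp add: u_def lw)
    have uk: "u ! j = - int (Suc n) \<longleftrightarrow> j = k" if "j < 2 * n + 1" for j
    proof
      assume "j = k" then show "u ! j = - int (Suc n)" using c lw by (simp add: u_def nth_append)
    next
      assume e: "u ! j = - int (Suc n)"
      show "j = k"
      proof (rule ccontr)
        assume "j \<noteq> k"
        then have "u ! j \<in> set w"
          using that lw c by (cases "j < k") (auto simp: u_def nth_append nth_Cons' )
        then show False using sw e by (auto simp: alphabet_def)
      qed
    qed
    have del: "delete_at k u = w" using c lw by (simp add: u_def)
    have su: "set u \<subseteq> alphabet (Suc n)"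
      using sw by (auto simp: u_def alphabet_def dest!: in_set_takeD in_set_dropD)
    have mem: "int (Suc n) # u \<in> words (Suc n) (2 * Suc n)"
      using su lu by (auto simp: words_def alphabet_def)
    have "0 = (\<Sum>c\<in>codes (Suc n). a c * matching_form c (int (Suc n) # u))"
      using Suc.prems(1)[OF mem] by simp
    also have "\<dots> = (\<Sum>(j, ks)\<in>{..<2 * n + 1} \<times> codes n. a (j # ks) * matching_form (j # ks) (int (Suc n) # u))"
      by (subst codes.simps, subst sum.reindex) (auto simp: inj_on_def case_prod_unfold)
    also have "\<dots> = (\<Sum>j<2 * n + 1. \<Sum>ks\<in>codes n. a (j # ks) * matching_form (j # ks) (int (Suc n) # u))"
      by (simp add: sum.cartesian_product)
    also have "\<dots> = (\<Sum>j<2 * n + 1. if j = k then (\<Sum>ks\<in>codes n. a (k # ks) * matching_form ks w) else 0)"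
    proof (rule sum.cong[OF refl])
      fix j assume "j \<in> {..<2 * n + 1}"
      then have "pairing (int (Suc n)) (u ! j) = (if j = k then 1 else 0 :: 'k)"
        using uk[of j] by (simp add: pairing_def)
      then show "(\<Sum>ks\<in>codes n. a (j # ks) * matching_form (j # ks) (int (Suc n) # u)) =
          (if j = k then \<Sum>ks\<in>codes n. a (k # ks) * matching_form ks w else 0)"
        using del by simp
    qed
    also have "\<dots> = (\<Sum>ks\<in>codes n. a (k # ks) * matching_form ks w)"
      using c by (simp add: sum.delta)
    finally show "(\<Sum>ks\<in>codes n. a (k # ks) * matching_form ks w) = 0" by simp
  qed
  then show ?case by (simp add: c)
qed

text \<open>
  Independent functions on a set with no more points than there are functions form a basis of all
  functions on that set.
\<close>
lemma independent_functions_span: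
  fixes \<phi> :: "'i \<Rightarrow> 'x \<Rightarrow> 'k::field"
  assumes fin: "finite I" "finite X" and card: "card X \<le> card I"
    and ind: "\<And>a i. (\<And>x. x \<in> X \<Longrightarrow> (\<Sum>i\<in>I. a i * \<phi> i x) = 0) \<Longrightarrow> i \<in> I \<Longrightarrow> a i = 0"
  shows "\<exists>a. \<forall>x\<in>X. (\<Sum>i\<in>I. a i * \<phi> i x) = h x"
proof -
  define sc where "sc = (\<lambda>(c::'k) (f::'x \<Rightarrow> 'k) x. c * f x)"
  interpret V: vector_space sc
    by unfold_locales (auto simp: sc_def fun_eq_iff algebra_simps)
  have sum_app: "sum f J x = (\<Sum>i\<in>J. f i x)" for f :: "'j \<Rightarrow> 'x \<Rightarrow> 'k" and J x
    by (induction J rule: infinite_finite_induct) auto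
  define \<psi> where "\<psi> i x = (if x \<in> X then \<phi> i x else 0)" for i x
  define \<delta> where "\<delta> x y = (if y = x then 1 else 0 :: 'k)" for x y :: 'x
  have inX: "f \<in> V.span (\<delta> ` X)" if "\<And>x. x \<notin> X \<Longrightarrow> f x = 0" for f
  proof -
    have "f = (\<Sum>x\<in>X. sc (f x) (\<delta> x))"
    proof
      fix y show "f y = (\<Sum>x\<in>X. sc (f x) (\<delta> x)) y"
        using that[of y] fin(2) by (auto simp: sum_app sc_def \<delta>_def if_distrib[of "\<lambda>z. _ * z"] sum.delta' cong: if_cong)
    qed
    also have "\<dots> \<in> V.span (\<delta> ` X)" by (intro V.span_sum V.span_scale V.span_base) auto
    finally show ?thesis .
  qed
  have inj: "inj_on \<psi> I"
  proof (rule inj_onI, rule ccontr)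
    fix i j assume ij: "i \<in> I" "j \<in> I" "\<psi> i = \<psi> j" "i \<noteq> j"
    define a where "a k = (if k = i then 1 else if k = j then - 1 else 0 :: 'k)" for k
    have "a i = 0"
    proof (rule ind[OF _ ij(1)])
      fix x assume "x \<in> X"
      then have "\<phi> i x = \<phi> j x" using fun_cong[OF ij(3), of x] by (simp add: \<psi>_def)
      moreover have "(\<Sum>k\<in>I. a k * \<phi> k x) = (\<Sum>k\<in>I. (if k = i then \<phi> i x else 0) - (if k = j then \<phi> j x else 0))"
        by (intro sum.cong) (use ij in \<open>auto simp: a_def\<close>)
      ultimately show "(\<Sum>k\<in>I. a k * \<phi> k x) = 0" using ij fin by (simp add: sum_subtractf sum.delta)
    qed
    then show False by (simp add: a_def)
  qed
  have "V.independent (\<psi> ` I)"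
  proof (rule V.independent_if_scalars_zero)
    show "finite (\<psi> ` I)" using fin by simp
    fix u v assume u: "(\<Sum>v\<in>\<psi> ` I. sc (u v) v) = 0" and v: "v \<in> \<psi> ` I"
    then obtain i where i: "i \<in> I" "v = \<psi> i" by blast
    have "u (\<psi> i) = 0"
    proof (rule ind[of "\<lambda>i. u (\<psi> i)", OF _ i(1)])
      fix x assume x: "x \<in> X"
      have "(\<Sum>i\<in>I. u (\<psi> i) * \<phi> i x) = (\<Sum>v\<in>\<psi> ` I. sc (u v) v) x"
        using x by (simp add: sum.reindex[OF inj] sum_app sc_def \<psi>_def)
      then show "(\<Sum>i\<in>I. u (\<psi> i) * \<phi> i x) = 0" using u by simp
    qed
    then show "u v = 0" using i by simp
  qed
  note independent = this
  define g where "g x = (if x \<in> X then h x else 0)" for x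
  have "g \<in> V.span (\<psi> ` I)"
  proof (rule ccontr)
    assume g: "g \<notin> V.span (\<psi> ` I)"
    then have "V.independent (insert g (\<psi> ` I))" using independent by (simp add: V.independent_insert)
    moreover have "insert g (\<psi> ` I) \<subseteq> V.span (\<delta> ` X)"
      using inX[of g] inX[of "\<psi> i" for i] by (auto simp: g_def \<psi>_def)
    ultimately have "card (insert g (\<psi> ` I)) \<le> card (\<delta> ` X)"
      using V.independent_span_bound fin(2) by blast
    moreover have "g \<notin> \<psi> ` I" using g V.span_base by blast
    ultimately show False
      using card_image_le[OF fin(2), of \<delta>] card card_image[OF inj] fin(1) by simp
  qed
  then obtain u where "g = (\<Sum>v\<in>\<psi> ` I. sc (u v) v)"
    unfolding V.span_finite[OF finite_imageI[OF fin(1)]] by blast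

  then have gx: "g x = (\<Sum>v\<in>\<psi> ` I. sc (u v) v x)" for x by (simp only: sum_app)
  have "h x = (\<Sum>i\<in>I. u (\<psi> i) * \<phi> i x)" if "x \<in> X" for x
    using gx[of x] that by (simp add: g_def sum.reindex[OF inj] sc_def \<psi>_def)
  then show ?thesis by (intro exI[of _ "\<lambda>i. u (\<psi> i)"]) auto
qed

lemma words_mono:
  assumes "m \<le> M"
  shows "words m r \<subseteq> words M r"
proof -
  have "alphabet m \<subseteq> alphabet M" using assms by (auto simp: alphabet_def)
  then show ?thesis by (auto simp: words_def)
qed

text \<open>
  The first fundamental theorem for multilinear invariants of the symplectic group, over every
  infinite field.  For a rank \<open>M \<ge> n\<close> the matching forms are independent.  As they are invariant,
  they stay independent after restriction to the dominant words for \<open>M\<close>, of which there are no more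
  than matchings.  So a combination of matching forms can take prescribed values at all dominant
  words.  The matching forms do not depend on the rank, and the dominant words for \<open>m\<close> are among
  those for \<open>M = max m n\<close>; hence an invariant form \<open>f\<close> for \<open>m\<close> differs from some combination of
  matching forms by an invariant form that vanishes at all dominant words, and this is zero.
\<close>
theorem invariant_forms_spanned_by_matchings:
  fixes f :: "int list \<Rightarrow> 'k::field"
  assumes inf: "infinite (UNIV :: 'k set)" and m: "1 \<le> m" and f: "invariant_form m (2 * n) f"
  shows "\<exists>a. \<forall>w\<in>words m (2 * n). f w = (\<Sum>c\<in>codes n. a c * matching_form c w)"
proof -
  define M where "M = max m n"
  define X where "X = {w \<in> words M (2 * n). dominant_from (\<lambda>_. 0) w}"
  have sub: "X \<subseteq> {w. length w = 2 * n \<and> dominant_from (\<lambda>_. 0) w}" by (auto simp: X_def words_def)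
  have comb: "invariant_form m' (2 * n) (\<lambda>w. c * g w + (\<Sum>c\<in>codes n. a c * matching_form c w))"
    if "invariant_form m' (2 * n) g" for m' and a and g :: "int list \<Rightarrow> 'k" and c
    unfolding invariant_form_def
  proof (intro allI impI ballI)
    fix A :: "int \<Rightarrow> int \<Rightarrow> 'k" and w assume A: "symplectic_matrix m' A" and w: "w \<in> words m' (2 * n)"
    let ?e = "\<lambda>g. expand (*) (alphabet m') A g w"
    have "?e (\<lambda>w. c * g w + (\<Sum>c\<in>codes n. a c * matching_form c w))
       = c * ?e g + (\<Sum>c\<in>codes n. a c * ?e (matching_form c))"
      by (simp only: expand_add expand_sum[OF finite_codes] expand_scale)
    also have "?e g = g w" using that A w by (simp add: invariant_form_def)
    also have "(\<Sum>c\<in>codes n. a c * ?e (matching_form c)) = (\<Sum>c\<in>codes n. a c * matching_form c w)"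
      using invariant_matching_form[of _ n m', where 'k = 'k] A w
      by (intro sum.cong refl) (simp add: invariant_form_def)
    finally show "?e (\<lambda>w. c * g w + (\<Sum>c\<in>codes n. a c * matching_form c w))
       = c * g w + (\<Sum>c\<in>codes n. a c * matching_form c w)" .
  qed
  have zero: "invariant_form m' (2 * n) (\<lambda>_. 0 :: 'k)" for m'
    by (simp add: invariant_form_def expand_zero)
  have "\<exists>a. \<forall>w\<in>X. (\<Sum>c\<in>codes n. a c * matching_form c w) = (if w \<in> words m (2 * n) then f w else 0)"
  proof (rule independent_functions_span)
    show "finite X" using sub card_dominant_closed(1) finite_subset by blast
    show "card X \<le> card (codes n)"
      using card_mono[OF card_dominant_closed(1) sub] card_dominant_closed(2)[of n] by (simp add: card_codes)
    fix a c assume z: "\<And>w. w \<in> X \<Longrightarrow> (\<Sum>c\<in>codes n. a c * (matching_form c w :: 'k)) = 0" and c: "c \<in> codes n"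
    show "a c = 0"
    proof (rule matching_forms_independent[of n a, OF _ c])
      fix w assume "w \<in> words n (2 * n)"
      then have "w \<in> words M (2 * n)" using words_mono[of n M "2 * n"] by (simp add: M_def subset_iff)
      moreover have "invariant_form M (2 * n) (\<lambda>w. (\<Sum>c\<in>codes n. a c * matching_form c w))"
        using comb[OF zero, of M 0] by simp
      moreover have "(\<Sum>c\<in>codes n. a c * (matching_form c u :: 'k)) = 0"
        if "u \<in> words M (2 * n)" "dominant_from (\<lambda>_. 0) u" for u
        using z[of u] that by (simp add: X_def)
      moreover have "1 \<le> M" using m by (simp add: M_def)
      ultimately show "(\<Sum>c\<in>codes n. a c * matching_form c w) = 0"
        by (intro invariant_form_zero[OF inf, of M "2 * n" "\<lambda>w. (\<Sum>c\<in>codes n. a c * matching_form c w)" w])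
    qed
  qed simp
  then obtain a where a: "\<And>w. w \<in> X \<Longrightarrow> (\<Sum>c\<in>codes n. a c * matching_form c w) = (if w \<in> words m (2 * n) then f w else 0)"
    by blast
  have "invariant_form m (2 * n) (\<lambda>w. - 1 * f w + (\<Sum>c\<in>codes n. a c * matching_form c w))"
    by (rule comb[OF f])
  then have "- 1 * f w + (\<Sum>c\<in>codes n. a c * matching_form c w) = 0" if "w \<in> words m (2 * n)" for w
  proof (rule invariant_form_zero[OF inf m, where f = "\<lambda>w. - 1 * f w + (\<Sum>c\<in>codes n. a c * matching_form c w)"])
    fix w assume "w \<in> words m (2 * n)" "dominant_from (\<lambda>_. 0) w"
    moreover from this have "w \<in> X" using words_mono[of m M "2 * n"] by (simp add: X_def M_def subset_iff)
    ultimately show "- 1 * f w + (\<Sum>c\<in>codes n. a c * matching_form c w) = 0" by (simp add: a)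
  qed (rule that)
  then show ?thesis by (intro exI[of _ a]) simp
qed

section \<open>Perfect matchings and permutations\<close>

definition perfect_matchings :: "'x set \<Rightarrow> 'x set set set" where
  "perfect_matchings X = {P. (\<forall>A\<in>P. A \<subseteq> X \<and> card A = 2) \<and> (\<forall>x\<in>X. \<exists>!A. A \<in> P \<and> x \<in> A)}"

lemma card_perfect_matchings:
  "finite X \<Longrightarrow> card X = 2 * n \<Longrightarrow> finite (perfect_matchings X) \<and> card (perfect_matchings X) \<le> num_matchings n"
proof (induction n arbitrary: X)
  case 0
  then have "perfect_matchings X \<subseteq> {{}}" by (auto simp: perfect_matchings_def)
  then show ?case using card_mono[of "{{}}" "perfect_matchings X"] finite_subset by fastforce
next
  case (Suc n)
  then obtain x where x: "x \<in> X" by fastforce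
  let ?U = "\<Union>y\<in>X - {x}. insert {x, y} ` perfect_matchings (X - {x, y})"
  have sub: "perfect_matchings X \<subseteq> ?U"
  proof
    fix P assume P: "P \<in> perfect_matchings X"
    then obtain A where A: "A \<in> P" "x \<in> A" using x by (auto simp: perfect_matchings_def)
    then have "card A = 2" "A \<subseteq> X" using P by (auto simp: perfect_matchings_def)
    then obtain y where y: "A = {x, y}" "y \<in> X - {x}" using A(2) by (auto simp: card_2_iff doubleton_eq_iff)
    have uniq: "B = A" if "B \<in> P" "z \<in> B" "z \<in> A" for B z
      using P that A(1) \<open>A \<subseteq> X\<close> unfolding perfect_matchings_def by blast
    have "P - {A} \<in> perfect_matchings (X - {x, y})"
      unfolding perfect_matchings_def
    proof (intro CollectI conjI ballI)
      fix B assume B: "B \<in> P - {A}"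
      then show "B \<subseteq> X - {x, y}" "card B = 2"
        using uniq[of B x] uniq[of B y] P y by (auto simp: perfect_matchings_def)
    next
      fix w assume w: "w \<in> X - {x, y}"
      then have "\<exists>!B. B \<in> P \<and> w \<in> B" using P by (auto simp: perfect_matchings_def)
      moreover have "w \<notin> A" using w y by auto
      ultimately show "\<exists>!B. B \<in> P - {A} \<and> w \<in> B" by blast
    qed
    moreover have "P = insert {x, y} (P - {A})" using A y by auto
    ultimately show "P \<in> ?U" using y(2) by blast
  qed
  have fc: "finite (perfect_matchings (X - {x, y})) \<and> card (perfect_matchings (X - {x, y})) \<le> num_matchings n"
    if "y \<in> X - {x}" for y
    using that Suc.prems x by (intro Suc.IH) (auto simp: card_Diff_subset)
  have finU: "finite ?U" using fc Suc.prems by auto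
  have "card (perfect_matchings X) \<le> card ?U" using finU sub by (rule card_mono)
  also have "\<dots> \<le> (\<Sum>y\<in>X - {x}. card (insert {x, y} ` perfect_matchings (X - {x, y})))"
    using Suc.prems by (intro card_UN_le) auto
  also have "\<dots> \<le> (\<Sum>y\<in>X - {x}. num_matchings n)"
    using fc by (intro sum_mono order_trans[OF card_image_le]) auto
  also have "\<dots> = num_matchings (Suc n)" using Suc.prems x by simp
  finally show ?case using finU sub finite_subset by blast
qed

text \<open>
  A termination measure for sorting by adjacent transpositions.
\<close>
definition potential :: "nat \<Rightarrow> (nat \<Rightarrow> nat) \<Rightarrow> nat" where
  "potential n \<sigma> = (\<Sum>k\<in>{1..n}. (n - k) * \<sigma> k)"

lemma potential_descent:
  assumes "1 \<le> i" "i < n" "\<sigma> (Suc i) < \<sigma> i"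
  shows "potential n (\<sigma> \<circ> transpose i (Suc i)) < potential n \<sigma>"
proof -
  let ?R = "{1..n} - {i, Suc i}"
  have split: "potential n \<tau> = (n - i) * \<tau> i + ((n - Suc i) * \<tau> (Suc i) + (\<Sum>k\<in>?R. (n - k) * \<tau> k))" for \<tau>
  proof -
    have "{1..n} = insert i (insert (Suc i) ?R)" using assms by auto
    then have "potential n \<tau> = (\<Sum>k\<in>insert i (insert (Suc i) ?R). (n - k) * \<tau> k)"
      unfolding potential_def by (rule arg_cong)
    then show ?thesis by simp
  qed
  have eq: "(\<Sum>k\<in>?R. (n - k) * (\<sigma> \<circ> transpose i (Suc i)) k) = (\<Sum>k\<in>?R. (n - k) * \<sigma> k)"
    by (intro sum.cong) (auto simp: transpose_def)
  have "n - i = Suc (n - Suc i)" using assms by simp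
  then show ?thesis using assms(3) unfolding split eq by simp
qed

lemma permutes_no_descent:
  assumes p: "\<sigma> permutes {1..n}" and nd: "\<And>i. 1 \<le> i \<Longrightarrow> i < n \<Longrightarrow> \<sigma> i \<le> \<sigma> (Suc i)"
  shows "\<sigma> = id"
proof -
  have "k \<le> \<sigma> k" if "1 \<le> k" "k \<le> n" for k
    using that
  proof (induction k)
    case (Suc k)
    show ?case
    proof (cases "k = 0")
      case True
      then show ?thesis using permutes_in_image[OF p, of 1] Suc.prems by auto
    next
      case False
      have "\<sigma> k \<noteq> \<sigma> (Suc k)" by (simp add: inj_eq[OF permutes_inj[OF p]])
      then have "\<sigma> k < \<sigma> (Suc k)" using nd[of k] False Suc.prems by auto
      then show ?thesis using Suc False by auto
    qed
  qed simp
  then show ?thesis by (intro permutes_natset_ge[OF p]) auto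
qed

lemma permutes_adjacent_induct [consumes 1, case_names id step]:
  assumes p: "\<sigma> permutes {1..n}" and id: "P id"
    and step: "\<And>\<sigma> i. \<sigma> permutes {1..n} \<Longrightarrow> 1 \<le> i \<Longrightarrow> i < n \<Longrightarrow> P \<sigma> \<Longrightarrow> P (\<sigma> \<circ> transpose i (Suc i))"
  shows "P \<sigma>"
  using p
proof (induction "potential n \<sigma>" arbitrary: \<sigma> rule: less_induct)
  case less
  show ?case
  proof (cases "\<exists>i. 1 \<le> i \<and> i < n \<and> \<sigma> (Suc i) < \<sigma> i")
    case True
    then obtain i where i: "1 \<le> i" "i < n" "\<sigma> (Suc i) < \<sigma> i" by blast
    have p': "\<sigma> \<circ> transpose i (Suc i) permutes {1..n}"
      using i less.prems by (intro permutes_compose permutes_swap_id) auto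
    have "P (\<sigma> \<circ> transpose i (Suc i) \<circ> transpose i (Suc i))"
      using i p' by (intro step less.hyps potential_descent) auto
    then show ?thesis by (simp add: comp_assoc)
  next
    case False
    then have "\<sigma> = id" using less.prems by (intro permutes_no_descent) (auto simp: not_less)
    then show ?thesis using id by simp
  qed
qed

text \<open>
  Statements about the elements attached to given points can thus be moved to the points \<open>1, 2, ...\<close>
  by conjugation with a permutation.
\<close>
lemma permutation_with_prefix:
  assumes "distinct xs" "set xs \<subseteq> {1..n}"
  shows "\<exists>\<pi>. \<pi> permutes {1..n} \<and> (\<forall>i<length xs. \<pi> (Suc i) = xs ! i)"
  using assms
proof (induction xs rule: rev_induct)
  case Nil
  then show ?case using permutes_id[of "{1..n}"] by (intro exI[of _ "\<lambda>x. x"]) (simp add: id_def)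
next
  case (snoc x xs)
  then obtain \<pi> where p: "\<pi> permutes {1..n}" "\<forall>i<length xs. \<pi> (Suc i) = xs ! i" by auto
  let ?y = "\<pi> (Suc (length xs))"
  have "length xs < n"
    using snoc.prems card_mono[OF _ snoc.prems(2)] distinct_card[OF snoc.prems(1)] by simp
  then have y: "?y \<in> {1..n}" using permutes_in_image[OF p(1)] by simp
  have inj: "?y \<noteq> \<pi> (Suc i)" if "i < length xs" for i
    using that by (simp add: inj_eq[OF permutes_inj[OF p(1)]])
  have "transpose ?y x \<circ> \<pi> permutes {1..n}"
    using p y snoc.prems by (intro permutes_compose permutes_swap_id) auto
  moreover have "(transpose ?y x \<circ> \<pi>) (Suc i) = (xs @ [x]) ! i" if "i < length (xs @ [x])" for i
  proof (cases "i = length xs")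
    case False
    then have "i < length xs" using that by simp
    moreover from this have "xs ! i \<noteq> x" using snoc.prems nth_mem by fastforce
    ultimately show ?thesis using p(2) inj[of i] by (auto simp: nth_append transpose_def)
  qed simp
  ultimately show ?case by blast
qed

section \<open>Normal forms in the Brauer monoid\<close>

text \<open>
  The relations of the Brauer algebra are monomial, if the parameter is replaced by a central
  element \<open>z\<close>.  So the normal forms can be studied in a monoid.
\<close>
locale brauer_monoid =
  fixes mul :: "'a \<Rightarrow> 'a \<Rightarrow> 'a" (infixl "\<bullet>" 70) and one :: 'a
    and s e :: "nat \<Rightarrow> 'a" and z :: 'a and n :: nat
  assumes assoc: "(a \<bullet> b) \<bullet> c = a \<bullet> (b \<bullet> c)" and one_left [simp]: "one \<bullet> a = a" and one_right [simp]: "a \<bullet> one = a"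
    and s_s: "1 \<le> i \<Longrightarrow> i < n \<Longrightarrow> s i \<bullet> s i = one"
    and e_e: "1 \<le> i \<Longrightarrow> i < n \<Longrightarrow> e i \<bullet> e i = z \<bullet> e i"
    and e_s: "1 \<le> i \<Longrightarrow> i < n \<Longrightarrow> e i \<bullet> s i = e i"
    and s_e: "1 \<le> i \<Longrightarrow> i < n \<Longrightarrow> s i \<bullet> e i = e i"
    and s_s_far: "1 \<le> i \<Longrightarrow> i < n \<Longrightarrow> 1 \<le> j \<Longrightarrow> j < n \<Longrightarrow> i + 1 < j \<or> j + 1 < i \<Longrightarrow> s i \<bullet> s j = s j \<bullet> s i"
    and s_e_far: "1 \<le> i \<Longrightarrow> i < n \<Longrightarrow> 1 \<le> j \<Longrightarrow> j < n \<Longrightarrow> i + 1 < j \<or> j + 1 < i \<Longrightarrow> s i \<bullet> e j = e j \<bullet> s i"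
    and e_e_far: "1 \<le> i \<Longrightarrow> i < n \<Longrightarrow> 1 \<le> j \<Longrightarrow> j < n \<Longrightarrow> i + 1 < j \<or> j + 1 < i \<Longrightarrow> e i \<bullet> e j = e j \<bullet> e i"
    and braid: "1 \<le> i \<Longrightarrow> Suc i < n \<Longrightarrow> s i \<bullet> s (Suc i) \<bullet> s i = s (Suc i) \<bullet> s i \<bullet> s (Suc i)"
    and s_e_e: "1 \<le> i \<Longrightarrow> Suc i < n \<Longrightarrow> s i \<bullet> e (Suc i) \<bullet> e i = s (Suc i) \<bullet> e i"
    and e_e_s: "1 \<le> i \<Longrightarrow> Suc i < n \<Longrightarrow> e (Suc i) \<bullet> e i \<bullet> s (Suc i) = e (Suc i) \<bullet> s i"
    and z_s: "1 \<le> i \<Longrightarrow> i < n \<Longrightarrow> z \<bullet> s i = s i \<bullet> z"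
    and z_e: "1 \<le> i \<Longrightarrow> i < n \<Longrightarrow> z \<bullet> e i = e i \<bullet> z"
begin

definition descent :: "(nat \<Rightarrow> nat) \<Rightarrow> nat \<Rightarrow> bool" where
  "descent \<sigma> i \<longleftrightarrow> 1 \<le> i \<and> i < n \<and> \<sigma> (Suc i) < \<sigma> i"

text \<open>
  The element of the monoid that represents a permutation, obtained from the decomposition that
  removes the first descent in each step.
\<close>
function T :: "(nat \<Rightarrow> nat) \<Rightarrow> 'a" where
  "T \<sigma> = (if \<exists>i. descent \<sigma> i then T (\<sigma> \<circ> transpose (LEAST i. descent \<sigma> i) (Suc (LEAST i. descent \<sigma> i))) \<bullet> s (LEAST i. descent \<sigma> i) else one)"
  by auto
termination
proof (relation "measure (potential n)")
  fix \<sigma> assume "\<exists>i. descent \<sigma> i"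
  then have "descent \<sigma> (LEAST i. descent \<sigma> i)" by (rule LeastI_ex)
  then show "(\<sigma> \<circ> transpose (LEAST i. descent \<sigma> i) (Suc (LEAST i. descent \<sigma> i)), \<sigma>) \<in> measure (potential n)"
    using potential_descent by (simp add: descent_def)
qed simp

declare T.simps [simp del]

text \<open>
  Every other choice of a descent leads to the same element, which is the theorem of Matsumoto for
  the symmetric group: two descents that are not adjacent commute, and for adjacent ones three
  steps can be exchanged by the braid relation.
\<close>
lemma T_descent: "descent \<sigma> j \<Longrightarrow> T \<sigma> = T (\<sigma> \<circ> transpose j (Suc j)) \<bullet> s j"
proof (induction "potential n \<sigma>" arbitrary: \<sigma> j rule: less_induct)
  case less
  note IH = less.hyps
  let ?t = "\<lambda>i. transpose i (Suc i)"
  have less: "potential n (\<tau> \<circ> ?t i) < potential n \<tau>" if "descent \<tau> i" for \<tau> i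
    using that potential_descent by (simp add: descent_def)
  have exch: "T (\<sigma> \<circ> ?t i) \<bullet> s i = T (\<sigma> \<circ> ?t j) \<bullet> s j" if d: "descent \<sigma> i" "descent \<sigma> j" and ij: "i < j" for i j
  proof (cases "j = Suc i")
    case False
    have d1: "descent (\<sigma> \<circ> ?t i) j" and d2: "descent (\<sigma> \<circ> ?t j) i"
      using d ij False by (auto simp: descent_def transpose_def)
    have c: "?t i \<circ> ?t j = ?t j \<circ> ?t i" using ij False by (auto simp: transpose_def fun_eq_iff)
    have "T (\<sigma> \<circ> ?t i) = T (\<sigma> \<circ> ?t i \<circ> ?t j) \<bullet> s j" using d d1 less by (intro IH) auto
    moreover have "T (\<sigma> \<circ> ?t j) = T (\<sigma> \<circ> ?t j \<circ> ?t i) \<bullet> s i" using d d2 less by (intro IH) auto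
    moreover have "s j \<bullet> s i = s i \<bullet> s j" using d ij False by (intro s_s_far) (auto simp: descent_def)
    ultimately show ?thesis using c by (simp add: assoc comp_assoc)
  next
    case True
    let ?a = "?t i" and ?b = "?t (Suc i)"
    have d1: "descent (\<sigma> \<circ> ?a) (Suc i)" and d2: "descent (\<sigma> \<circ> ?b) i"
      and d3: "descent (\<sigma> \<circ> ?a \<circ> ?b) i" and d4: "descent (\<sigma> \<circ> ?b \<circ> ?a) (Suc i)"
      using d True by (auto simp: descent_def transpose_def)
    have l1: "potential n (\<sigma> \<circ> ?a) < potential n \<sigma>" "potential n (\<sigma> \<circ> ?b) < potential n \<sigma>"
      using d True less by auto
    have l2: "potential n (\<sigma> \<circ> ?a \<circ> ?b) < potential n \<sigma>" "potential n (\<sigma> \<circ> ?b \<circ> ?a) < potential n \<sigma>"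
      using less[OF d1] less[OF d2] l1 by auto
    have c: "?a \<circ> ?b \<circ> ?a = ?b \<circ> ?a \<circ> ?b" by (auto simp: transpose_def fun_eq_iff)
    have "T (\<sigma> \<circ> ?a) = T (\<sigma> \<circ> ?a \<circ> ?b \<circ> ?a) \<bullet> s i \<bullet> s (Suc i)"
      using IH[OF l1(1) d1] IH[OF l2(1) d3] by simp
    moreover have "T (\<sigma> \<circ> ?b) = T (\<sigma> \<circ> ?b \<circ> ?a \<circ> ?b) \<bullet> s (Suc i) \<bullet> s i"
      using IH[OF l1(2) d2] IH[OF l2(2) d4] by simp
    moreover have "s i \<bullet> s (Suc i) \<bullet> s i = s (Suc i) \<bullet> s i \<bullet> s (Suc i)"
      using d True by (intro braid) (auto simp: descent_def)
    ultimately show ?thesis using c True by (simp add: assoc comp_assoc)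
  qed
  define i where "i = (LEAST i. descent \<sigma> i)"
  have i: "descent \<sigma> i" unfolding i_def using less.prems by (rule LeastI)
  have "T \<sigma> = T (\<sigma> \<circ> ?t i) \<bullet> s i" using less.prems by (subst T.simps) (auto simp: i_def)
  also have "\<dots> = T (\<sigma> \<circ> ?t j) \<bullet> s j"
    using exch[OF i less.prems] exch[OF less.prems i] by (metis linorder_neqE_nat)
  finally show ?case .
qed

lemma T_mul_s:
  assumes p: "\<sigma> permutes {1..n}" and i: "1 \<le> i" "i < n"
  shows "T (\<sigma> \<circ> transpose i (Suc i)) = T \<sigma> \<bullet> s i"
proof (cases "descent \<sigma> i")
  case True
  then show ?thesis using T_descent[OF True] s_s[OF i] by (simp add: assoc)
next
  case False
  have "\<sigma> i \<noteq> \<sigma> (Suc i)" by (simp add: inj_eq[OF permutes_inj[OF p]])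
  then have "descent (\<sigma> \<circ> transpose i (Suc i)) i" using False i by (auto simp: descent_def)
  from T_descent[OF this] show ?thesis by (simp add: comp_assoc)
qed

lemma T_id [simp]: "T id = one"
  by (subst T.simps) (auto simp: descent_def)

lemma T_mul: "\<tau> permutes {1..n} \<Longrightarrow> \<sigma> permutes {1..n} \<Longrightarrow> T (\<sigma> \<circ> \<tau>) = T \<sigma> \<bullet> T \<tau>"
proof (induction \<tau> rule: permutes_adjacent_induct)
  case (step \<tau> i)
  have "T (\<sigma> \<circ> (\<tau> \<circ> transpose i (Suc i))) = T (\<sigma> \<circ> \<tau>) \<bullet> s i"
    using T_mul_s[OF permutes_compose[OF step.hyps(1) step.prems] step.hyps(2,3)] by (simp only: comp_assoc)
  also have "\<dots> = T \<sigma> \<bullet> T (\<tau> \<circ> transpose i (Suc i))"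
    using step.IH[OF step.prems] T_mul_s[OF step.hyps(1-3)] by (simp only: assoc)
  finally show ?case .
qed simp

lemma T_adjacent: "1 \<le> i \<Longrightarrow> i < n \<Longrightarrow> T (transpose i (Suc i)) = s i"
  using T_mul_s[of id i] permutes_id by simp

lemma T_inv: "\<sigma> permutes {1..n} \<Longrightarrow> T \<sigma> \<bullet> T (inv_into UNIV \<sigma>) = one" "\<sigma> permutes {1..n} \<Longrightarrow> T (inv_into UNIV \<sigma>) \<bullet> T \<sigma> = one"
  using T_mul[of "inv_into UNIV \<sigma>" \<sigma>] T_mul[of \<sigma> "inv_into UNIV \<sigma>"] permutes_inv[of \<sigma> "{1..n}"] permutes_inv_o[of \<sigma> "{1..n}"]
  by auto

lemma T_cancel: "\<sigma> permutes {1..n} \<Longrightarrow> x \<bullet> T \<sigma> = y \<bullet> T \<sigma> \<Longrightarrow> x = y"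
  using T_inv(1)[of \<sigma>] by (metis assoc one_right)

lemma z_T: "\<sigma> permutes {1..n} \<Longrightarrow> z \<bullet> T \<sigma> = T \<sigma> \<bullet> z"
proof (induction \<sigma> rule: permutes_adjacent_induct)
  case (step \<sigma> i)
  show ?case
    unfolding T_mul_s[OF step.hyps(1-3)] using z_s[OF step.hyps(2,3)] step.IH
    by (simp only: assoc[symmetric]) (simp only: assoc)
qed (simp only: T_id one_left one_right)

text \<open>
  A permutation that preserves \<open>{1, 2}\<close> has no descent at \<open>2\<close>, and neither has any permutation
  met during its decomposition.  So only generators that commute with \<open>e 1\<close> occur.
\<close>
lemma T_e1_commute:
  "\<sigma> permutes {1..n} \<Longrightarrow> 2 \<le> n \<Longrightarrow> \<sigma> ` {1, 2} = {1, 2} \<Longrightarrow> T \<sigma> \<bullet> e 1 = e 1 \<bullet> T \<sigma>"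
proof (induction "potential n \<sigma>" arbitrary: \<sigma> rule: less_induct)
  case less
  show ?case
  proof (cases "\<exists>i. descent \<sigma> i")
    case False
    then have "\<sigma> = id"
      using less.prems by (intro permutes_no_descent) (auto simp: descent_def not_less)
    then show ?thesis by simp
  next
    case True
    then obtain i where d: "descent \<sigma> i" by blast
    then have i: "1 \<le> i" "i < n" "\<sigma> (Suc i) < \<sigma> i" by (auto simp: descent_def)
    have "i \<noteq> 2"
    proof
      assume i2: "i = 2"
      have "\<sigma> 3 \<in> {1..n}" using permutes_in_image[OF less.prems(1), of 3] i i2 by auto
      moreover have "\<sigma> 3 \<notin> \<sigma> ` {1, 2}" by (simp add: inj_eq[OF permutes_inj[OF less.prems(1)]])
      moreover have "\<sigma> 2 \<in> {1, 2}" using less.prems(3) by blast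
      ultimately show False using i i2 less.prems(3) by (auto simp: numeral_3_eq_3)
    qed
    let ?\<tau> = "\<sigma> \<circ> transpose i (Suc i)"
    have p: "?\<tau> permutes {1..n}"
      using i less.prems by (intro permutes_compose permutes_swap_id) auto
    have im: "?\<tau> ` {1, 2} = {1, 2}"
    proof (cases "i = 1")
      case True
      then have "transpose i (Suc i) ` {1, 2} = {1, 2}" by (auto simp: numeral_2_eq_2)
      then show ?thesis using less.prems(3) by (simp only: image_comp[symmetric])
    next
      case False
      then have "transpose i (Suc i) ` {1, 2} = {1, 2}" using i \<open>i \<noteq> 2\<close> by (auto simp: transpose_def)
      then show ?thesis using less.prems(3) by (simp only: image_comp[symmetric])
    qed
    have IH: "T ?\<tau> \<bullet> e 1 = e 1 \<bullet> T ?\<tau>"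
      using less.hyps[OF potential_descent[OF i]] p less.prems(2) im by blast
    have se: "s i \<bullet> e 1 = e 1 \<bullet> s i"
      using s_e[of 1] e_s[of 1] s_e_far[of i 1] i \<open>i \<noteq> 2\<close> less.prems(2) by (cases "i = 1") auto
    show ?thesis
      unfolding T_descent[OF d] using IH se by (metis assoc)
  qed
qed

text \<open>
  The conjugate of \<open>e 1\<close> by any permutation that moves \<open>1, 2\<close> to \<open>a, b\<close>: the diagram with the cap
  and the cup \<open>{a, b}\<close>.
\<close>
definition ee :: "nat \<Rightarrow> nat \<Rightarrow> 'a" where
  "ee a b = (let \<pi> = (SOME \<pi>. \<pi> permutes {1..n} \<and> \<pi> 1 = a \<and> \<pi> 2 = b) in T \<pi> \<bullet> e 1 \<bullet> T (inv_into UNIV \<pi>))"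

lemma ee_eq:
  assumes p: "\<pi> permutes {1..n}" and n: "2 \<le> n" and ab: "\<pi> 1 = a \<and> \<pi> 2 = b \<or> \<pi> 1 = b \<and> \<pi> 2 = a"
  shows "ee a b = T \<pi> \<bullet> e 1 \<bullet> T (inv_into UNIV \<pi>)"
proof -
  have ab': "a \<in> {1..n}" "b \<in> {1..n}" "a \<noteq> b"
    using ab permutes_in_image[OF p, of 1] permutes_in_image[OF p, of 2] inj_eq[OF permutes_inj[OF p], of 1 2] n by auto
  have "\<exists>\<pi>. \<pi> permutes {1..n} \<and> \<pi> 1 = a \<and> \<pi> 2 = b"
    using permutation_with_prefix[of "[a, b]" n] ab' by (auto simp: less_Suc_eq numeral_2_eq_2)
  then obtain \<rho> where r: "\<rho> permutes {1..n}" "\<rho> 1 = a" "\<rho> 2 = b" "ee a b = T \<rho> \<bullet> e 1 \<bullet> T (inv_into UNIV \<rho>)"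
    unfolding ee_def Let_def using someI_ex[of "\<lambda>\<pi>. \<pi> permutes {1..n} \<and> \<pi> 1 = a \<and> \<pi> 2 = b"] by blast
  let ?h = "inv_into UNIV \<rho> \<circ> \<pi>"
  have ir: "inv_into UNIV \<rho> permutes {1..n}" and ip: "inv_into UNIV \<pi> permutes {1..n}" using r(1) p by (auto intro: permutes_inv)
  have h: "?h permutes {1..n}" using p ir by (rule permutes_compose)
  have "inv_into UNIV \<rho> a = 1" "inv_into UNIV \<rho> b = 2"
    using r permutes_inv_eq[OF r(1)] by auto
  then have him: "?h ` {1, 2} = {1, 2}" using ab by auto
  have rh: "\<rho> \<circ> ?h = \<pi>" using permutes_inv_o(1)[OF r(1)] by (simp add: comp_assoc[symmetric])
  have hp: "?h \<circ> inv_into UNIV \<pi> = inv_into UNIV \<rho>" using permutes_inv_o(1)[OF p] by (simp add: comp_assoc)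
  have "T \<pi> \<bullet> e 1 \<bullet> T (inv_into UNIV \<pi>) = T \<rho> \<bullet> (T ?h \<bullet> e 1) \<bullet> T (inv_into UNIV \<pi>)"
    using T_mul[OF h r(1)] by (simp add: rh assoc)
  also have "\<dots> = T \<rho> \<bullet> e 1 \<bullet> (T ?h \<bullet> T (inv_into UNIV \<pi>))"
    by (simp only: T_e1_commute[OF h n him] assoc)
  also have "T ?h \<bullet> T (inv_into UNIV \<pi>) = T (inv_into UNIV \<rho>)"
    using T_mul[OF ip h] by (simp add: hp)
  finally show ?thesis using r(4) by simp
qed

lemma obtain_permutation:
  assumes "distinct xs" "set xs \<subseteq> {1..n}"
  obtains \<pi> where "\<pi> permutes {1..n}" "\<And>i. i < length xs \<Longrightarrow> \<pi> (Suc i) = xs ! i"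
  using permutation_with_prefix[OF assms] by blast

lemma ee_T:
  assumes s: "\<sigma> permutes {1..n}" and ab: "a \<in> {1..n}" "b \<in> {1..n}" "a \<noteq> b"
  shows "T \<sigma> \<bullet> ee a b = ee (\<sigma> a) (\<sigma> b) \<bullet> T \<sigma>"
proof -
  obtain \<pi> where p: "\<pi> permutes {1..n}" "\<And>i. i < length [a,b] \<Longrightarrow> \<pi> (Suc i) = [a,b] ! i"
    using ab by (rule_tac obtain_permutation[of "[a,b]"]) auto
  have p12: "\<pi> 1 = a" "\<pi> 2 = b" using p(2)[of 0] p(2)[of 1] by (auto simp: numeral_2_eq_2)
  have n: "2 \<le> n" using ab by auto
  have sp: "\<sigma> \<circ> \<pi> permutes {1..n}" using p(1) s by (rule permutes_compose)
  have inv_comp: "inv_into UNIV (\<sigma> \<circ> \<pi>) = inv_into UNIV \<pi> \<circ> inv_into UNIV \<sigma>"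
    using permutes_bij[OF s] permutes_bij[OF p(1)] by (rule o_inv_distrib)
  have "ee (\<sigma> a) (\<sigma> b) \<bullet> T \<sigma> = T (\<sigma> \<circ> \<pi>) \<bullet> e 1 \<bullet> T (inv_into UNIV (\<sigma> \<circ> \<pi>)) \<bullet> T \<sigma>"
    using ee_eq[OF sp n] p12 by simp
  also have "\<dots> = T \<sigma> \<bullet> T \<pi> \<bullet> e 1 \<bullet> (T (inv_into UNIV \<pi>) \<bullet> T (inv_into UNIV \<sigma>)) \<bullet> T \<sigma>"
    using p(1) s by (simp add: inv_comp T_mul permutes_inv)
  also have "\<dots> = T \<sigma> \<bullet> (T \<pi> \<bullet> e 1 \<bullet> T (inv_into UNIV \<pi>))"
    using T_inv(2)[OF s] by (simp add: assoc)
  also have "\<dots> = T \<sigma> \<bullet> ee a b" using ee_eq[OF p(1) n] p12 by simp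
  finally show ?thesis by simp
qed

lemma ee_sym:
  assumes ab: "a \<in> {1..n}" "b \<in> {1..n}" "a \<noteq> b"
  shows "ee a b = ee b a"
proof -
  obtain \<pi> where p: "\<pi> permutes {1..n}" "\<And>i. i < length [a,b] \<Longrightarrow> \<pi> (Suc i) = [a,b] ! i"
    using ab by (rule_tac obtain_permutation[of "[a,b]"]) auto
  have p12: "\<pi> 1 = a" "\<pi> 2 = b" using p(2)[of 0] p(2)[of 1] by (auto simp: numeral_2_eq_2)
  have n: "2 \<le> n" using ab by auto
  show ?thesis using ee_eq[OF p(1) n, of a b] ee_eq[OF p(1) n, of b a] p12 by simp
qed

text \<open>
  The relations give \<open>s_i s_(i+1) e_i = e_(i+1) e_i = e_(i+1) s_i s_(i+1)\<close>, so that \<open>e_(i+1)\<close> is the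
  conjugate of \<open>e_i\<close> by \<open>s_i s_(i+1)\<close>.
\<close>
lemma ee_adjacent: "1 \<le> i \<Longrightarrow> i < n \<Longrightarrow> ee i (Suc i) = e i"
proof (induction i)
  case (Suc i)
  show ?case
  proof (cases "i = 0")
    case True
    then show ?thesis using ee_eq[of id 1 2] permutes_id Suc.prems by (simp add: numeral_2_eq_2)
  next
    case False
    let ?c = "transpose i (Suc i) \<circ> transpose (Suc i) (Suc (Suc i))"
    have t: "transpose i (Suc i) permutes {1..n}" "transpose (Suc i) (Suc (Suc i)) permutes {1..n}"
      using Suc.prems False by (auto intro!: permutes_swap_id)
    have c: "?c permutes {1..n}" using t by (intro permutes_compose)
    have Tc: "T ?c = s i \<bullet> s (Suc i)"
      using T_mul[OF t(2) t(1)] Suc.prems False by (simp add: T_adjacent)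
    have i: "1 \<le> i" "Suc i < n" using Suc.prems False by auto
    have "ee (?c i) (?c (Suc i)) \<bullet> T ?c = T ?c \<bullet> ee i (Suc i)"
      using ee_T[OF c, of i "Suc i"] i by simp
    also have "\<dots> = s i \<bullet> (s (Suc i) \<bullet> e i)" using Tc Suc.IH i by (simp add: assoc)
    also have "\<dots> = e (Suc i) \<bullet> e i"
      using s_e_e[OF i] s_s[of i] i by (metis assoc one_left Suc_lessD)
    also have "\<dots> = e (Suc i) \<bullet> T ?c"
      using e_e_s[OF i] s_s[of "Suc i"] i Tc by (metis assoc one_right le_SucI)
    finally have "ee (?c i) (?c (Suc i)) = e (Suc i)" by (rule T_cancel[OF c])
    moreover have "?c i = Suc i" "?c (Suc i) = Suc (Suc i)" by (auto simp: transpose_def)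
    ultimately show ?thesis by simp
  qed
qed simp

abbreviation tr :: "nat \<Rightarrow> nat \<Rightarrow> 'a" where
  "tr a b \<equiv> T (transpose a b)"

lemma transpose_permutes: "a \<in> {1..n} \<Longrightarrow> b \<in> {1..n} \<Longrightarrow> transpose a b permutes {1..n}"
  by (rule permutes_swap_id)

lemma tr_T:
  assumes "\<sigma> permutes {1..n}" "a \<in> {1..n}" "b \<in> {1..n}"
  shows "tr (\<sigma> a) (\<sigma> b) \<bullet> T \<sigma> = T \<sigma> \<bullet> tr a b"
proof -
  have "transpose (\<sigma> a) (\<sigma> b) \<circ> \<sigma> = \<sigma> \<circ> transpose a b"
    by (simp add: transpose_def fun_eq_iff inj_eq[OF permutes_inj[OF assms(1)]])
  moreover have "\<sigma> a \<in> {1..n}" "\<sigma> b \<in> {1..n}" using assms permutes_in_image[OF assms(1)] by auto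
  ultimately show ?thesis
    using T_mul[OF assms(1) transpose_permutes, of "\<sigma> a" "\<sigma> b"]
      T_mul[OF transpose_permutes[OF assms(2,3)] assms(1)] by simp
qed

lemma ee_tr:
  assumes ab: "a \<in> {1..n}" "b \<in> {1..n}" "a \<noteq> b"
  shows "ee a b \<bullet> tr a b = ee a b" and "ee a b \<bullet> ee a b = z \<bullet> ee a b"
proof -
  obtain \<pi> where p: "\<pi> permutes {1..n}" "\<And>i. i < length [a,b] \<Longrightarrow> \<pi> (Suc i) = [a,b] ! i"
    using ab by (rule_tac obtain_permutation[of "[a,b]"]) auto
  have p12: "\<pi> (Suc 0) = a" "\<pi> (Suc (Suc 0)) = b" using p(2)[of 0] p(2)[of 1] by auto
  have n: "2 \<le> n" using ab by auto
  then have i: "Suc 0 \<in> {1..n}" "Suc (Suc 0) \<in> {1..n}" by auto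
  have E: "ee a b \<bullet> T \<pi> = T \<pi> \<bullet> e 1"
    using ee_T[OF p(1) i] p12 ee_adjacent[of 1] n by simp
  have S: "tr a b \<bullet> T \<pi> = T \<pi> \<bullet> s 1"
    using tr_T[OF p(1) i] p12 T_adjacent[of 1] n by simp
  show "ee a b \<bullet> tr a b = ee a b"
  proof (rule T_cancel[OF p(1)])
    show "ee a b \<bullet> tr a b \<bullet> T \<pi> = ee a b \<bullet> T \<pi>"
      using E S e_s[of 1] n by (metis assoc le_refl less_le_trans one_less_numeral_iff semiring_norm(76))
  qed
  show "ee a b \<bullet> ee a b = z \<bullet> ee a b"
  proof (rule T_cancel[OF p(1)])
    have "ee a b \<bullet> ee a b \<bullet> T \<pi> = T \<pi> \<bullet> (e 1 \<bullet> e 1)" using E by (metis assoc)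
    also have "\<dots> = z \<bullet> (T \<pi> \<bullet> e 1)" using e_e[of 1] z_T[OF p(1)] n by (simp add: assoc[symmetric])
    finally show "ee a b \<bullet> ee a b \<bullet> T \<pi> = z \<bullet> ee a b \<bullet> T \<pi>" using E by (simp add: assoc)
  qed
qed

text \<open>
  After conjugation this is the relation \<open>e_2 e_1 = e_2 s_1 s_2\<close>, together with \<open>e_2 = e_2 s_2\<close>.
\<close>
lemma ee_chain:
  assumes abc: "a \<in> {1..n}" "b \<in> {1..n}" "c \<in> {1..n}" "distinct [a, b, c]"
  shows "ee a b \<bullet> ee b c = ee a b \<bullet> tr a c"
proof -
  obtain \<pi> where p: "\<pi> permutes {1..n}" "\<And>i. i < length [c,b,a] \<Longrightarrow> \<pi> (Suc i) = [c,b,a] ! i"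
    using abc by (rule_tac obtain_permutation[of "[c,b,a]"]) auto
  have p123: "\<pi> 1 = c" "\<pi> 2 = b" "\<pi> 3 = a" using p(2)[of 0] p(2)[of 1] p(2)[of 2] by (auto simp: numeral_eq_Suc)
  have "3 \<le> n" using card_mono[of "{1..n}" "set [a,b,c]"] abc by (simp add: distinct_card)
  then have n: "1 \<in> {1..n}" "2 \<in> {1..n}" "3 \<in> {1..n}" "1 \<noteq> (2::nat)" "2 \<noteq> (3::nat)" "1 < n" "2 < n" by auto
  have E1: "ee b c \<bullet> T \<pi> = T \<pi> \<bullet> e 1"
    using ee_T[OF p(1) n(1,2,4)] p123 ee_adjacent[of 1] ee_sym[of b c] abc n by (simp add: numeral_2_eq_2)
  have E2: "ee a b \<bullet> T \<pi> = T \<pi> \<bullet> e 2"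
    using ee_T[OF p(1) n(2,3,5)] p123 ee_adjacent[of 2] ee_sym[of a b] abc n by (simp add: numeral_3_eq_3)
  have t13: "transpose 1 3 = transpose (Suc 1) (Suc (Suc 1)) \<circ> transpose 1 (Suc 1) \<circ> transpose (Suc 1) (Suc (Suc (1::nat)))"
    by (auto simp: transpose_def fun_eq_iff)
  have T13: "tr 1 3 = s 2 \<bullet> s 1 \<bullet> s 2"
  proof -
    have a: "transpose 1 (Suc 1) permutes {1..n}" "transpose (Suc 1) (Suc (Suc 1)) permutes {1..n}"
      using n by (auto intro!: permutes_swap_id)
    have "T (transpose (Suc 1) (Suc (Suc 1)) \<circ> transpose 1 (Suc 1) \<circ> transpose (Suc 1) (Suc (Suc 1)))
       = T (transpose (Suc 1) (Suc (Suc 1))) \<bullet> T (transpose 1 (Suc 1)) \<bullet> T (transpose (Suc 1) (Suc (Suc 1)))"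
      using T_mul[OF a(2) permutes_compose[OF a(1) a(2)]] T_mul[OF a(1) a(2)] by simp
    then show ?thesis
      unfolding t13 using T_adjacent[of 1] T_adjacent[of 2] n by (simp add: numeral_2_eq_2)
  qed
  have S: "tr a c \<bullet> T \<pi> = T \<pi> \<bullet> (s 2 \<bullet> s 1 \<bullet> s 2)"
    using tr_T[OF p(1) n(1,3)] p123 T13 transpose_commute[of a c] by simp
  have rel: "e 2 \<bullet> e 1 = e 2 \<bullet> (s 2 \<bullet> s 1 \<bullet> s 2)"
  proof -
    have "e 2 \<bullet> (s 2 \<bullet> s 1 \<bullet> s 2) = (e 2 \<bullet> s 2) \<bullet> s 1 \<bullet> s 2" by (simp add: assoc)
    also have "\<dots> = e 2 \<bullet> s 1 \<bullet> s 2" using e_s[of 2] n by simp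
    also have "\<dots> = e 2 \<bullet> e 1 \<bullet> (s 2 \<bullet> s 2)" using e_e_s[of 1] n by (simp add: numeral_2_eq_2 assoc[symmetric])
    also have "\<dots> = e 2 \<bullet> e 1" using s_s[of 2] n by simp
    finally show ?thesis by simp
  qed
  show ?thesis
  proof (rule T_cancel[OF p(1)])
    have "ee a b \<bullet> ee b c \<bullet> T \<pi> = T \<pi> \<bullet> (e 2 \<bullet> e 1)" using E1 E2 by (metis assoc)
    also have "\<dots> = ee a b \<bullet> tr a c \<bullet> T \<pi>" unfolding rel using E2 S by (metis assoc)
    finally show "ee a b \<bullet> ee b c \<bullet> T \<pi> = ee a b \<bullet> tr a c \<bullet> T \<pi>" .
  qed
qed

lemma ee_commute:
  assumes abcd: "a \<in> {1..n}" "b \<in> {1..n}" "c \<in> {1..n}" "d \<in> {1..n}" "distinct [a, b, c, d]"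
  shows "ee a b \<bullet> ee c d = ee c d \<bullet> ee a b"
proof -
  obtain \<pi> where p: "\<pi> permutes {1..n}" "\<And>i. i < length [a,b,c,d] \<Longrightarrow> \<pi> (Suc i) = [a,b,c,d] ! i"
    using abcd by (rule_tac obtain_permutation[of "[a,b,c,d]"]) auto
  have p1234: "\<pi> 1 = a" "\<pi> 2 = b" "\<pi> 3 = c" "\<pi> 4 = d"
    using p(2)[of 0] p(2)[of 1] p(2)[of 2] p(2)[of 3] by (auto simp: numeral_eq_Suc)
  have "4 \<le> n" using card_mono[of "{1..n}" "set [a,b,c,d]"] abcd by (simp add: distinct_card)
  then have n: "1 \<in> {1..n}" "2 \<in> {1..n}" "3 \<in> {1..n}" "4 \<in> {1..n}" "1 \<noteq> (2::nat)" "3 \<noteq> (4::nat)" "1 < n" "3 < n" by auto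
  have E1: "ee a b \<bullet> T \<pi> = T \<pi> \<bullet> e 1"
    using ee_T[OF p(1) n(1,2,5)] p1234 ee_adjacent[of 1] n by (simp add: numeral_2_eq_2)
  have E3: "ee c d \<bullet> T \<pi> = T \<pi> \<bullet> e 3"
    using ee_T[OF p(1) n(3,4,6)] p1234 ee_adjacent[of 3] n by simp
  have "e 1 \<bullet> e 3 = e 3 \<bullet> e 1" using n by (intro e_e_far) auto
  note comm = this
  show ?thesis
  proof (rule T_cancel[OF p(1)])
    have "ee a b \<bullet> ee c d \<bullet> T \<pi> = T \<pi> \<bullet> (e 1 \<bullet> e 3)" using E1 E3 by (metis assoc)
    also have "\<dots> = ee c d \<bullet> ee a b \<bullet> T \<pi>" unfolding comm using E1 E3 by (metis assoc)
    finally show "ee a b \<bullet> ee c d \<bullet> T \<pi> = ee c d \<bullet> ee a b \<bullet> T \<pi>" .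
  qed
qed

text \<open>
  Two arcs can be exchanged.  Multiply \<open>ee a b\<close> and \<open>ee c d\<close> by \<open>ee b c\<close>: the relation \<open>ee_chain\<close> can be
  applied to either arc, and this gives the transposition \<open>(a c)\<close> in one case and \<open>(b d)\<close> in the other.
\<close>
lemma ee_double_swap:
  assumes abcd: "a \<in> {1..n}" "b \<in> {1..n}" "c \<in> {1..n}" "d \<in> {1..n}" "distinct [a, b, c, d]"
  shows "ee a b \<bullet> ee c d \<bullet> tr a c \<bullet> tr b d = ee a b \<bullet> ee c d"
proof -
  have "ee a b \<bullet> ee c d \<bullet> tr a c = ee c d \<bullet> (ee a b \<bullet> tr a c)"
    using ee_commute[OF abcd] by (simp add: assoc[symmetric])
  also have "\<dots> = ee c d \<bullet> (ee a b \<bullet> ee b c)" using ee_chain[of a b c] abcd by simp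
  also have "\<dots> = ee a b \<bullet> (ee d c \<bullet> ee c b)"
    using ee_commute[OF abcd] ee_sym[of c d] ee_sym[of b c] abcd by (simp add: assoc[symmetric])
  also have "\<dots> = ee a b \<bullet> (ee c d \<bullet> tr b d)"
    using ee_chain[of d c b] ee_sym[of c d] abcd transpose_commute[of b d] by simp
  finally have "ee a b \<bullet> ee c d \<bullet> tr a c \<bullet> tr b d = ee a b \<bullet> ee c d \<bullet> (tr b d \<bullet> tr b d)"
    by (simp add: assoc)
  also have "tr b d \<bullet> tr b d = one"
    using T_mul[OF transpose_permutes[OF abcd(2,4)] transpose_permutes[OF abcd(2,4)]] by simp
  finally show ?thesis by simp
qed

end

context brauer_monoid
begin

text \<open>
  A list of pairs describes a partial matching of the points \<open>1, ..., n\<close>, and \<open>E\<close> multiplies the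
  corresponding elements \<open>ee a b\<close>.  The product depends only on the set of arcs, by \<open>E_arcs_cong\<close>.
\<close>
definition arc :: "nat \<times> nat \<Rightarrow> nat set" where
  "arc p = {fst p, snd p}"

definition arcs :: "(nat \<times> nat) list \<Rightarrow> nat set set" where
  "arcs ps = arc ` set ps"

definition cap_list :: "(nat \<times> nat) list \<Rightarrow> bool" where
  "cap_list ps \<longleftrightarrow> distinct ps \<and> (\<forall>p\<in>set ps. fst p \<noteq> snd p \<and> arc p \<subseteq> {1..n}) \<and>
     (\<forall>p\<in>set ps. \<forall>q\<in>set ps. p \<noteq> q \<longrightarrow> arc p \<inter> arc q = {})"

definition E :: "(nat \<times> nat) list \<Rightarrow> 'a" where
  "E ps = foldl (\<lambda>x p. x \<bullet> ee (fst p) (snd p)) one ps"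

lemma E_simps [simp]: "E [] = one" "E (ps @ [p]) = E ps \<bullet> ee (fst p) (snd p)"
  by (simp_all add: E_def)

lemma cap_list_append1: "cap_list (ps @ qs) \<Longrightarrow> cap_list ps"
  by (auto simp: cap_list_def)

lemma cap_list_remove1: "cap_list ps \<Longrightarrow> cap_list (remove1 p ps)"
  by (auto simp: cap_list_def set_remove1_eq)

lemma arcs_remove1:
  assumes "cap_list ps" "p \<in> set ps"
  shows "arcs (remove1 p ps) = arcs ps - {arc p}"
proof -
  have "arc q \<noteq> arc p" if "q \<in> set ps" "q \<noteq> p" for q
  proof -
    have "arc q \<inter> arc p = {}" using assms that by (auto simp: cap_list_def)
    then show ?thesis by (auto simp: arc_def)
  qed
  then show ?thesis using assms by (auto simp: arcs_def cap_list_def set_remove1_eq)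
qed

lemma arcs_disjoint: "cap_list ps \<Longrightarrow> A \<in> arcs ps \<Longrightarrow> B \<in> arcs ps \<Longrightarrow> x \<in> A \<Longrightarrow> x \<in> B \<Longrightarrow> A = B"
proof -
  assume cap: "cap_list ps" and "A \<in> arcs ps" "B \<in> arcs ps" and x: "x \<in> A" "x \<in> B"
  then obtain p q where pq: "p \<in> set ps" "q \<in> set ps" "A = arc p" "B = arc q"
    by (auto simp: arcs_def)
  then have "p \<noteq> q \<Longrightarrow> arc p \<inter> arc q = {}" using cap by (simp add: cap_list_def)
  then show "A = B" using pq x by blast
qed

lemma arcs_pair: "cap_list ps \<Longrightarrow> {a, b} \<in> arcs ps \<Longrightarrow> a \<noteq> b \<and> a \<in> {1..n} \<and> b \<in> {1..n}"
  unfolding arcs_def cap_list_def arc_def by (auto simp: doubleton_eq_iff)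

lemma arcsE:
  assumes "cap_list ps" "A \<in> arcs ps" "x \<in> A"
  obtains y where "A = {x, y}" "x \<noteq> y"
proof -
  obtain p where p: "p \<in> set ps" "A = {fst p, snd p}" "fst p \<noteq> snd p"
    using assms(1,2) unfolding arcs_def cap_list_def arc_def by blast
  show thesis
  proof (cases "x = fst p")
    case True
    then show thesis using p that[of "snd p"] by simp
  next
    case False
    then have "x = snd p" using assms(3) p by simp
    then show thesis using p that[of "fst p"] by auto
  qed
qed

lemma E_remove1:
  "cap_list ps \<Longrightarrow> p \<in> set ps \<Longrightarrow> E ps = E (remove1 p ps) \<bullet> ee (fst p) (snd p)"
proof (induction ps rule: rev_induct)
  case (snoc q ps)
  note cap = snoc.prems(1)
  show ?case
  proof (cases "p = q")
    case True
    then have "p \<notin> set ps" using cap by (auto simp: cap_list_def)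
    then show ?thesis using True by (simp add: remove1_append)
  next
    case False
    then have p: "p \<in> set ps" using snoc.prems by simp
    have comm: "ee (fst p) (snd p) \<bullet> ee (fst q) (snd q) = ee (fst q) (snd q) \<bullet> ee (fst p) (snd p)"
    proof (rule ee_commute)
      have "arc p \<inter> arc q = {}" "fst p \<noteq> snd p" "fst q \<noteq> snd q" "arc p \<subseteq> {1..n}" "arc q \<subseteq> {1..n}"
        using cap p False by (auto simp: cap_list_def)
      then show "fst p \<in> {1..n}" "snd p \<in> {1..n}" "fst q \<in> {1..n}" "snd q \<in> {1..n}"
        "distinct [fst p, snd p, fst q, snd q]" by (auto simp: arc_def)
    qed
    have "E (ps @ [q]) = E (remove1 p ps) \<bullet> ee (fst p) (snd p) \<bullet> ee (fst q) (snd q)"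
      using snoc.IH[OF cap_list_append1[OF cap] p] by simp
    also have "\<dots> = E (remove1 p ps @ [q]) \<bullet> ee (fst p) (snd p)"
      using comm by (simp add: assoc)
    finally show ?thesis using p by (simp add: remove1_append)
  qed
qed simp

lemma E_arc:
  assumes "cap_list ps" "{a, b} \<in> arcs ps"
  shows "\<exists>qs. cap_list qs \<and> arcs qs = arcs ps - {{a, b}} \<and> E ps = E qs \<bullet> ee a b"
proof -
  have ab: "a \<noteq> b" "a \<in> {1..n}" "b \<in> {1..n}" using arcs_pair[OF assms] by auto
  obtain p where p: "p \<in> set ps" "arc p = {a, b}" using assms(2) by (auto simp: arcs_def)
  then have "p = (a, b) \<or> p = (b, a)" using ab by (cases p) (auto simp: arc_def doubleton_eq_iff)
  then have "ee (fst p) (snd p) = ee a b" using ee_sym ab by auto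
  then show ?thesis
    using E_remove1[OF assms(1) p(1)] cap_list_remove1[OF assms(1), of p] arcs_remove1[OF assms(1) p(1)] p(2)
    by (intro exI[of _ "remove1 p ps"]) simp
qed

lemma E_arcs_cong: "cap_list ps \<Longrightarrow> cap_list qs \<Longrightarrow> arcs ps = arcs qs \<Longrightarrow> E ps = E qs"
proof (induction ps arbitrary: qs rule: rev_induct)
  case Nil
  then show ?case by (simp add: arcs_def)
next
  case (snoc p ps)
  have p: "arc p = {fst p, snd p}" by (simp add: arc_def)
  have "{fst p, snd p} \<in> arcs qs" using snoc.prems(3)[symmetric] p by (simp add: arcs_def)
  then obtain rs where rs: "cap_list rs" "arcs rs = arcs qs - {{fst p, snd p}}" "E qs = E rs \<bullet> ee (fst p) (snd p)"
    using E_arc snoc.prems(2) by blast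
  have "p \<notin> set ps" using snoc.prems(1) by (auto simp: cap_list_def)
  then have "remove1 p (ps @ [p]) = ps" by (simp add: remove1_append)
  then have "arcs ps = arcs rs"
    using arcs_remove1[OF snoc.prems(1), of p] rs(2) snoc.prems(3) p by simp
  then show ?case using snoc.IH[OF cap_list_append1[OF snoc.prems(1)] rs(1)] rs(3) by simp
qed

lemma E_two_arcs:
  assumes "cap_list ps" "{a, b} \<in> arcs ps" "{c, d} \<in> arcs ps" "{a, b} \<noteq> {c, d}"
  shows "\<exists>y. E ps = y \<bullet> ee a b \<bullet> ee c d"
  using E_arc[OF assms(1,3)] E_arc[of _ a b] assms(2,4) by (metis Diff_iff singletonD)

text \<open>
  A permutation that permutes the arcs and fixes the other points is absorbed.  Such a permutation
  \<open>h\<close> becomes one with fewer moved points after multiplication by a transposition, or by a double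
  transposition, that returns the arc of a moved point \<open>a\<close> to its place.
\<close>
lemma E_absorb:
  "cap_list ps \<Longrightarrow> h permutes {1..n} \<Longrightarrow> (\<And>A. A \<in> arcs ps \<Longrightarrow> h ` A \<in> arcs ps) \<Longrightarrow>
   (\<And>c. c \<in> {1..n} \<Longrightarrow> c \<notin> \<Union> (arcs ps) \<Longrightarrow> h c = c) \<Longrightarrow> E ps \<bullet> T h = E ps"
proof (induction "card {x \<in> {1..n}. h x \<noteq> x}" arbitrary: h rule: less_induct)
  case less
  note cap = less.prems(1) and h = less.prems(2)
  show ?case
  proof (cases "\<exists>x\<in>{1..n}. h x \<noteq> x")
    case False
    then have "h = id" using h by (auto simp: permutes_def fun_eq_iff)
    then show ?thesis by simp
  next
    case True
    then obtain a where a: "a \<in> {1..n}" "h a \<noteq> a" by blast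
    then obtain A where A: "A \<in> arcs ps" "a \<in> A" using less.prems(4) by blast
    then obtain b where b: "A = {a, b}" "a \<noteq> b" using arcsE[OF cap] by metis
    have bn: "b \<in> {1..n}" using arcs_pair[OF cap, of a b] A b by auto
    have hinj: "h x = h y \<longleftrightarrow> x = y" for x y by (rule inj_eq[OF permutes_inj[OF h]])
    have hA: "{h a, h b} \<in> arcs ps" using less.prems(3)[OF A(1)] b by simp
    have hn: "h a \<in> {1..n}" "h b \<in> {1..n}" using arcs_pair[OF cap hA] by auto
    \<comment> \<open>The involution that returns the arc of the moved point \<open>a\<close> from its image under \<open>h\<close>.\<close>
    define g where "g = (if h a = b then transpose a b else transpose a (h a) \<circ> transpose b (h b))"
    have cases: "h a = b \<and> h b = a \<or> distinct [a, b, h a, h b] \<and> {a, b} \<noteq> {h a, h b}"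
    proof (cases "h a \<in> {a, b} \<or> h b \<in> {a, b}")
      case True
      then have "{h a, h b} = {a, b}" using arcs_disjoint[OF cap hA, of A] A b by blast
      then show ?thesis using a by (auto simp: doubleton_eq_iff)
    next
      case False
      then show ?thesis using b hinj[of a b] by auto
    qed
    have g: "g permutes {1..n}"
      unfolding g_def
      using permutes_compose[OF transpose_permutes[OF bn hn(2)] transpose_permutes[OF a(1) hn(1)]]
        transpose_permutes[OF a(1) bn] by simp
    have Eg: "E ps \<bullet> T g = E ps"
    proof (cases "h a = b")
      case True
      obtain qs where "E ps = E qs \<bullet> ee a b" using E_arc[OF cap, of a b] A b by blast
      then show ?thesis using True ee_tr(1)[OF a(1) bn b(2)] by (simp add: g_def assoc)
    next
      case False
      then have d: "distinct [a, b, h a, h b]" "{a, b} \<noteq> {h a, h b}" using cases by auto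
      obtain y where y: "E ps = y \<bullet> ee a b \<bullet> ee (h a) (h b)"
        using E_two_arcs[OF cap _ hA d(2)] A b by blast
      have "T g = tr a (h a) \<bullet> tr b (h b)"
        using False T_mul[OF transpose_permutes[OF bn hn(2)] transpose_permutes[OF a(1) hn(1)]] by (simp add: g_def)
      then have "E ps \<bullet> T g = y \<bullet> (ee a b \<bullet> ee (h a) (h b) \<bullet> tr a (h a) \<bullet> tr b (h b))"
        using y by (simp add: assoc)
      then show ?thesis using ee_double_swap[OF a(1) bn hn d(1)] y by (simp add: assoc)
    qed
    have gA: "g ` B \<in> arcs ps" if B: "B \<in> arcs ps" for B
    proof (cases "h a = b")
      case True
      have "g ` B = B"
      proof (cases "a \<in> B \<or> b \<in> B")
        case True
        then have "B = {a, b}" using arcs_disjoint[OF cap B A(1)] b by blast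
        then show ?thesis using \<open>h a = b\<close> by (auto simp: g_def)
      next
        case False
        then show ?thesis using True by (auto simp: g_def transpose_def image_iff)
      qed
      then show ?thesis using B by simp
    next
      case False
      then have d: "distinct [a, b, h a, h b]" using cases by auto
      have gv: "g a = h a" "g b = h b" "g (h a) = a" "g (h b) = b"
        using d False by (auto simp: g_def transpose_def)
      have gx: "g x = x" if "x \<notin> {a, b, h a, h b}" for x
        using that False by (auto simp: g_def transpose_def)
      consider "a \<in> B \<or> b \<in> B" | "h a \<in> B \<or> h b \<in> B" | "B \<inter> {a, b, h a, h b} = {}" by blast
      then show ?thesis
      proof cases
        case 1
        then have "B = {a, b}" using arcs_disjoint[OF cap B A(1)] b by blast
        then show ?thesis using gv hA by simp
      next
        case 2
        then have "B = {h a, h b}" using arcs_disjoint[OF cap B hA] by blast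
        then show ?thesis using gv A b by simp
      next
        case 3
        then have "g ` B = B" using gx by (force simp: image_iff)
        then show ?thesis using B by simp
      qed
    qed
    have gfree: "g c = c" if "c \<in> {1..n}" "c \<notin> \<Union> (arcs ps)" for c
    proof -
      have "c \<notin> {a, b, h a, h b}" using that(2) A b hA by blast
      then show ?thesis by (auto simp: g_def transpose_def)
    qed
    have gh: "g \<circ> h permutes {1..n}" using h g by (rule permutes_compose)
    have fix_a: "g (h a) = a"
    proof (cases "h a = b")
      case True
      then show ?thesis by (simp add: g_def)
    next
      case False
      then have "distinct [a, b, h a, h b]" using cases by blast
      then show ?thesis using False by (simp add: g_def transpose_def)
    qed
    have fix_x: "g (h x) = x" if "h x = x" for x
    proof -
      have "x \<noteq> a" using that a by auto
      moreover have "x \<noteq> b"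
        using that cases b by (metis distinct_length_2_or_more)
      moreover have "x \<noteq> h a" using that hinj[of x a] \<open>x \<noteq> a\<close> by auto
      moreover have "x \<noteq> h b" using that hinj[of x b] \<open>x \<noteq> b\<close> by auto
      ultimately show ?thesis using that by (auto simp: g_def transpose_def)
    qed
    have "{x \<in> {1..n}. (g \<circ> h) x \<noteq> x} \<subset> {x \<in> {1..n}. h x \<noteq> x}"
      using fix_a fix_x a by auto
    then have "card {x \<in> {1..n}. (g \<circ> h) x \<noteq> x} < card {x \<in> {1..n}. h x \<noteq> x}"
      by (intro psubset_card_mono) auto
    then have "E ps \<bullet> T (g \<circ> h) = E ps"
    proof (rule less.hyps[OF _ cap gh])
      fix B assume "B \<in> arcs ps"
      then show "(g \<circ> h) ` B \<in> arcs ps" using gA less.prems(3) by (simp only: image_comp[symmetric])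
    next
      fix c assume "c \<in> {1..n}" "c \<notin> \<Union> (arcs ps)"
      then show "(g \<circ> h) c = c" using gfree less.prems(4) by simp
    qed
    then have "E ps \<bullet> T g \<bullet> T h = E ps" using T_mul[OF h g] by (simp add: assoc)
    then show ?thesis using Eg by simp
  qed
qed

lemma z_ee:
  assumes "a \<in> {1..n}" "b \<in> {1..n}" "a \<noteq> b"
  shows "z \<bullet> ee a b = ee a b \<bullet> z"
proof -
  obtain \<pi> where p: "\<pi> permutes {1..n}" "\<And>i. i < length [a,b] \<Longrightarrow> \<pi> (Suc i) = [a,b] ! i"
    using assms by (rule_tac obtain_permutation[of "[a,b]"]) auto
  have p12: "\<pi> 1 = a" "\<pi> 2 = b" using p(2)[of 0] p(2)[of 1] by (auto simp: numeral_2_eq_2)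
  have n: "2 \<le> n" using assms by auto
  have "ee a b = T \<pi> \<bullet> e 1 \<bullet> T (inv_into UNIV \<pi>)" using ee_eq[OF p(1) n] p12 by simp
  moreover have "z \<bullet> e 1 = e 1 \<bullet> z" using n by (intro z_e) auto
  ultimately show ?thesis using z_T[OF p(1)] z_T[OF permutes_inv[OF p(1)]] by (metis assoc)
qed

lemma z_E: "cap_list ps \<Longrightarrow> z \<bullet> E ps = E ps \<bullet> z"
proof (induction ps rule: rev_induct)
  case (snoc p ps)
  have "z \<bullet> ee (fst p) (snd p) = ee (fst p) (snd p) \<bullet> z"
    using snoc.prems by (intro z_ee) (auto simp: cap_list_def arc_def)
  then show ?case using snoc.IH[OF cap_list_append1[OF snoc.prems]] by simp (metis assoc)
qed simp

text \<open>
  If both points are joined to each other, a loop is created; if both are free, a new arc; and if one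
  of them is joined to a third point, then \<open>ee_chain\<close> produces a transposition.
\<close>
lemma E_ee_cases:
  assumes cap: "cap_list ps" and cd: "c \<in> {1..n}" "d \<in> {1..n}" "c \<noteq> d"
  shows "E ps \<bullet> ee c d = z \<bullet> E ps \<or> (\<exists>qs. cap_list qs \<and> E ps \<bullet> ee c d = E qs) \<or>
     (\<exists>a\<in>{1..n}. \<exists>b\<in>{1..n}. E ps \<bullet> ee c d = E ps \<bullet> tr a b)"
proof -
  have paired: "\<exists>a\<in>{1..n}. \<exists>b\<in>{1..n}. E ps \<bullet> ee c d = E ps \<bullet> tr a b"
    if A: "A \<in> arcs ps" "c \<in> A" "d \<notin> A" and cd: "c \<in> {1..n}" "d \<in> {1..n}" "c \<noteq> d" for A c d
  proof -
    obtain c' where c': "A = {c, c'}" "c \<noteq> c'" using arcsE[OF cap A(1,2)] by blast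
    have "{c', c} \<in> arcs ps" using A c' by (simp add: insert_commute)
    then obtain qs where q: "E ps = E qs \<bullet> ee c' c" "c' \<in> {1..n}"
      using E_arc[OF cap] arcs_pair[OF cap] by blast
    have "ee c' c \<bullet> ee c d = ee c' c \<bullet> tr c' d"
      using A(3) c' cd q(2) by (intro ee_chain) auto
    then have "E ps \<bullet> ee c d = E ps \<bullet> tr c' d" using q(1) by (simp add: assoc)
    then show ?thesis using q(2) cd by blast
  qed
  consider "{c, d} \<in> arcs ps" | A where "A \<in> arcs ps" "c \<in> A" "d \<notin> A" | A where "A \<in> arcs ps" "d \<in> A" "c \<notin> A"
    | "c \<notin> \<Union> (arcs ps)" "d \<notin> \<Union> (arcs ps)"
  proof -
    have "A = {c, d}" if "A \<in> arcs ps" "c \<in> A" "d \<in> A" for A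
      using arcsE[OF cap that(1,2)] that(3) cd(3) by auto
    then show ?thesis using that by blast
  qed
  then show ?thesis
  proof cases
    case 1
    then obtain qs where q: "cap_list qs" "E ps = E qs \<bullet> ee c d" using E_arc[OF cap] by blast
    have "E ps \<bullet> ee c d = E qs \<bullet> z \<bullet> ee c d" using q ee_tr(2)[OF cd] by (simp add: assoc)
    also have "\<dots> = z \<bullet> E ps" using q z_E[OF q(1)] by (simp add: assoc[symmetric])
    finally show ?thesis by blast
  next
    case 2
    then show ?thesis using paired cd by blast
  next
    case 3
    then show ?thesis using paired[of A d c] cd ee_sym[OF cd] by auto
  next
    case 4
    then have "cap_list (ps @ [(c, d)])"
      using cap cd by (auto simp: cap_list_def arcs_def arc_def)
    moreover have "E ps \<bullet> ee c d = E (ps @ [(c, d)])" by simp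
    ultimately show ?thesis by blast
  qed
qed

text \<open>
  Every Brauer diagram is a partial matching of the upper points followed by a permutation.  Since
  these elements are closed under multiplication by generators, up to powers of \<open>z\<close>, they contain
  all products of generators.
\<close>
definition normal_forms :: "'a set" where
  "normal_forms = {E ps \<bullet> T \<sigma> | ps \<sigma>. cap_list ps \<and> \<sigma> permutes {1..n}}"

lemma one_normal: "one \<in> normal_forms"
proof -
  have "cap_list []" by (simp add: cap_list_def)
  then show ?thesis using permutes_id unfolding normal_forms_def
    by (intro CollectI exI[of _ "[]"] exI[of _ id]) simp
qed

lemma normal_mul_s:
  assumes "y \<in> normal_forms" "1 \<le> i" "i < n"
  shows "y \<bullet> s i \<in> normal_forms"
proof -
  obtain ps \<sigma> where y: "y = E ps \<bullet> T \<sigma>" "cap_list ps" "\<sigma> permutes {1..n}"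
    using assms(1) by (auto simp: normal_forms_def)
  have "\<sigma> \<circ> transpose i (Suc i) permutes {1..n}"
    using assms y by (intro permutes_compose permutes_swap_id) auto
  moreover have "y \<bullet> s i = E ps \<bullet> T (\<sigma> \<circ> transpose i (Suc i))"
    using y T_mul_s[OF y(3) assms(2,3)] by (simp add: assoc)
  ultimately show ?thesis using y(2) by (auto simp: normal_forms_def)
qed

lemma normal_mul_e:
  assumes "y \<in> normal_forms" "1 \<le> i" "i < n"
  shows "y \<bullet> e i \<in> normal_forms \<or> y \<bullet> e i = z \<bullet> y"
proof -
  obtain ps \<sigma> where y: "y = E ps \<bullet> T \<sigma>" "cap_list ps" "\<sigma> permutes {1..n}"
    using assms(1) by (auto simp: normal_forms_def)
  let ?c = "\<sigma> i" and ?d = "\<sigma> (Suc i)"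
  have cd: "?c \<in> {1..n}" "?d \<in> {1..n}" "?c \<noteq> ?d"
    using assms permutes_in_image[OF y(3)] by (auto simp: inj_eq[OF permutes_inj[OF y(3)]])
  have eq: "y \<bullet> e i = E ps \<bullet> ee ?c ?d \<bullet> T \<sigma>"
    using ee_T[OF y(3), of i "Suc i"] ee_adjacent[OF assms(2,3)] assms y(1) by (simp add: assoc)
  from E_ee_cases[OF y(2) cd] show ?thesis
  proof (elim disjE exE conjE bexE)
    assume "E ps \<bullet> ee ?c ?d = z \<bullet> E ps"
    then show ?thesis using eq y(1) by (simp add: assoc)
  next
    fix qs assume "cap_list qs" "E ps \<bullet> ee ?c ?d = E qs"
    then show ?thesis using eq y(3) by (auto simp: normal_forms_def)
  next
    fix a b assume ab: "a \<in> {1..n}" "b \<in> {1..n}" "E ps \<bullet> ee ?c ?d = E ps \<bullet> tr a b"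
    have t: "transpose a b permutes {1..n}" using ab by (intro transpose_permutes)
    have "y \<bullet> e i = E ps \<bullet> T (transpose a b \<circ> \<sigma>)"
      using eq ab(3) T_mul[OF y(3) t] by (simp add: assoc)
    then show ?thesis using y permutes_compose[OF y(3) t] by (auto simp: normal_forms_def)
  qed
qed

inductive_set products :: "'a set" where
  "one \<in> products"
| "x \<in> products \<Longrightarrow> 1 \<le> i \<Longrightarrow> i < n \<Longrightarrow> x \<bullet> s i \<in> products"
| "x \<in> products \<Longrightarrow> 1 \<le> i \<Longrightarrow> i < n \<Longrightarrow> x \<bullet> e i \<in> products"

theorem products_normal:
  "x \<in> products \<Longrightarrow> \<exists>k. \<exists>y\<in>normal_forms. x = ((\<lambda>u. z \<bullet> u) ^^ k) y"
proof (induction rule: products.induct)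
  case 1
  show ?case using one_normal by (intro exI[of _ 0]) auto
next
  have pow: "((\<lambda>u. z \<bullet> u) ^^ k) y \<bullet> w = ((\<lambda>u. z \<bullet> u) ^^ k) (y \<bullet> w)" for k y w
    by (induction k) (auto simp: assoc)
  {
    case (2 x i)
    then show ?case using normal_mul_s pow by metis
  next
    case (3 x i)
    then obtain k y where y: "y \<in> normal_forms" "x = ((\<lambda>u. z \<bullet> u) ^^ k) y" by blast
    show ?case
    proof (cases "y \<bullet> e i \<in> normal_forms")
      case True
      then show ?thesis using y pow by metis
    next
      case False
      then have "y \<bullet> e i = z \<bullet> y" using normal_mul_e[OF y(1) 3(2,3)] by blast
      then have "x \<bullet> e i = ((\<lambda>u. z \<bullet> u) ^^ Suc k) y" using y(2) pow by (simp add: funpow_swap1)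
      then show ?thesis using y(1) by blast
    qed
  }
qed

text \<open>
  The Brauer diagram of a normal form: caps on the upper points \<open>Inl\<close>, cups on the lower points
  \<open>Inr\<close>, and through-strands.
\<close>
definition diagram :: "(nat \<times> nat) list \<Rightarrow> (nat \<Rightarrow> nat) \<Rightarrow> (nat + nat) set set" where
  "diagram ps \<sigma> = (\<lambda>A. Inl ` A) ` arcs ps \<union> (\<lambda>A. Inr ` inv_into UNIV \<sigma> ` A) ` arcs ps \<union>
     (\<lambda>c. {Inl c, Inr (inv_into UNIV \<sigma> c)}) ` ({1..n} - \<Union> (arcs ps))"

lemma diagram_perfect_matching:
  assumes cap: "cap_list ps" and s: "\<sigma> permutes {1..n}"
  shows "diagram ps \<sigma> \<in> perfect_matchings (Inl ` {1..n} \<union> Inr ` {1..n})"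
proof -
  have isv: "inv_into UNIV \<sigma> permutes {1..n}" using s by (rule permutes_inv)
  have inj: "inv_into UNIV \<sigma> x = inv_into UNIV \<sigma> y \<longleftrightarrow> x = y" for x y by (rule inj_eq[OF permutes_inj[OF isv]])
  have mem: "inv_into UNIV \<sigma> x \<in> {1..n} \<longleftrightarrow> x \<in> {1..n}" for x by (rule permutes_in_image[OF isv])
  have A: "A \<subseteq> {1..n} \<and> card A = 2" if "A \<in> arcs ps" for A
    using that cap by (auto simp: arcs_def cap_list_def arc_def)
  show ?thesis
    unfolding perfect_matchings_def
  proof (intro CollectI conjI ballI)
    fix B assume B: "B \<in> diagram ps \<sigma>"
    show "B \<subseteq> Inl ` {1..n} \<union> Inr ` {1..n}"
      using B A mem unfolding diagram_def by fast
    show "card B = 2"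
      using B unfolding diagram_def
    proof (elim UnE imageE)
      fix A' assume "B = Inl ` A'" "A' \<in> arcs ps"
      then show ?thesis using A by (simp add: card_image)
    next
      fix A' assume "B = Inr ` inv_into UNIV \<sigma> ` A'" "A' \<in> arcs ps"
      then show ?thesis using A permutes_inj[OF isv] by (simp add: card_image inj_on_def inj)
    next
      fix c assume "B = {Inl c, Inr (inv_into UNIV \<sigma> c)}"
      then show ?thesis by simp
    qed
  next
    fix x :: "nat + nat" assume x: "x \<in> Inl ` {1..n} \<union> Inr ` {1..n}"
    define c where "c = (case x of Inl c \<Rightarrow> c | Inr c \<Rightarrow> \<sigma> c)"
    have c: "c \<in> {1..n}"
      using x by (elim UnE imageE) (simp_all only: c_def sum.case permutes_in_image[OF s])
    have xc: "x = Inl c \<or> x = Inr (inv_into UNIV \<sigma> c)"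
      using permutes_inverses(2)[OF s] by (cases x) (auto simp: c_def)
    show "\<exists>!B. B \<in> diagram ps \<sigma> \<and> x \<in> B"
    proof (cases "c \<in> \<Union> (arcs ps)")
      case True
      then obtain A' where A': "A' \<in> arcs ps" "c \<in> A'" by blast
      have uniq: "D = A'" if "D \<in> arcs ps" "c \<in> D" for D
        using arcs_disjoint[OF cap that(1) A'(1) that(2) A'(2)] .
      show ?thesis
        using xc
      proof
        assume x: "x = Inl c"
        show ?thesis
        proof (rule ex1I[of _ "Inl ` A'"])
          show "Inl ` A' \<in> diagram ps \<sigma> \<and> x \<in> Inl ` A'" using A' x by (auto simp: diagram_def)
          fix B assume "B \<in> diagram ps \<sigma> \<and> x \<in> B"
          then show "B = Inl ` A'" using x uniq True unfolding diagram_def by auto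
        qed
      next
        assume x: "x = Inr (inv_into UNIV \<sigma> c)"
        show ?thesis
        proof (rule ex1I[of _ "Inr ` inv_into UNIV \<sigma> ` A'"])
          show "Inr ` inv_into UNIV \<sigma> ` A' \<in> diagram ps \<sigma> \<and> x \<in> Inr ` inv_into UNIV \<sigma> ` A'" using A' x by (auto simp: diagram_def)
          fix B assume "B \<in> diagram ps \<sigma> \<and> x \<in> B"
          then have B: "B \<in> diagram ps \<sigma>" "Inr (inv_into UNIV \<sigma> c) \<in> B" using x by auto
          then obtain D where D: "D \<in> arcs ps" "B = Inr ` inv_into UNIV \<sigma> ` D"
            using True unfolding diagram_def by (auto simp: inj)
          then have "c \<in> D" using B(2) by (auto simp: inj)
          then show "B = Inr ` inv_into UNIV \<sigma> ` A'" using D uniq by simp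
        qed
      qed
    next
      case False
      show ?thesis
      proof (rule ex1I[of _ "{Inl c, Inr (inv_into UNIV \<sigma> c)}"])
        show "{Inl c, Inr (inv_into UNIV \<sigma> c)} \<in> diagram ps \<sigma> \<and> x \<in> {Inl c, Inr (inv_into UNIV \<sigma> c)}"
          using False c xc by (auto simp: diagram_def)
        fix B assume "B \<in> diagram ps \<sigma> \<and> x \<in> B"
        then show "B = {Inl c, Inr (inv_into UNIV \<sigma> c)}" using xc False unfolding diagram_def by (auto simp: inj)
      qed
    qed
  qed
qed

text \<open>
  Two normal forms with the same diagram have the same caps, and their permutations differ by a
  permutation that is absorbed.
\<close>
lemma diagram_determines:
  assumes ps: "cap_list ps" "\<sigma> permutes {1..n}" and qs: "cap_list qs" "\<tau> permutes {1..n}"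
    and eq: "diagram ps \<sigma> = diagram qs \<tau>"
  shows "E ps \<bullet> T \<sigma> = E qs \<bullet> T \<tau>"
proof -
  have nonempty: "A \<noteq> {}" if "cap_list rs" "A \<in> arcs rs" for A rs
    using that by (auto simp: arcs_def arc_def)
  have top: "A \<in> arcs rs'" if "cap_list rs" "A \<in> arcs rs" "diagram rs \<rho> = diagram rs' \<rho>'" for A rs rs' \<rho> \<rho>'
  proof -
    have "Inl ` A \<in> diagram rs \<rho>" using that(2) unfolding diagram_def by blast
    then have "Inl ` A \<in> diagram rs' \<rho>'" by (simp only: that(3))
    then show ?thesis
      unfolding diagram_def
    proof (elim UnE imageE)
      fix B assume "Inl ` A = Inl ` B" "B \<in> arcs rs'"
      then show ?thesis by (metis inj_Inl inj_image_eq_iff)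
    next
      fix B assume "(Inl ` A :: (nat + nat) set) = Inr ` inv_into UNIV \<rho>' ` B"
      then show ?thesis using nonempty[OF that(1,2)] by blast
    next
      fix c assume "(Inl ` A :: (nat + nat) set) = {Inl c, Inr (inv_into UNIV \<rho>' c)}"
      then show ?thesis by blast
    qed
  qed
  have arcs: "arcs ps = arcs qs" using top[OF ps(1) _ eq] top[OF qs(1) _ eq[symmetric]] by blast
  define h where "h = \<tau> \<circ> inv_into UNIV \<sigma>"
  have h: "h permutes {1..n}" using ps qs by (auto simp: h_def intro: permutes_compose permutes_inv)
  have hs: "h \<circ> \<sigma> = \<tau>" using permutes_inv_o(2)[OF ps(2)] by (simp add: h_def comp_assoc)
  have "E ps \<bullet> T h = E ps"
  proof (rule E_absorb[OF ps(1) h])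
    fix A assume A: "A \<in> arcs ps"
    then have "Inr ` inv_into UNIV \<sigma> ` A \<in> diagram ps \<sigma>" unfolding diagram_def by blast
    then have "Inr ` inv_into UNIV \<sigma> ` A \<in> diagram qs \<tau>" by (simp only: eq)
    then show "h ` A \<in> arcs ps"
      unfolding diagram_def
    proof (elim UnE imageE)
      fix B assume "(Inr ` inv_into UNIV \<sigma> ` A :: (nat + nat) set) = Inl ` B"
      then show ?thesis using nonempty[OF ps(1) A] by blast
    next
      fix B assume "(Inr ` inv_into UNIV \<sigma> ` A :: (nat + nat) set) = Inr ` inv_into UNIV \<tau> ` B" and B: "B \<in> arcs qs"
      then have "inv_into UNIV \<sigma> ` A = inv_into UNIV \<tau> ` B" by (metis inj_Inr inj_image_eq_iff)
      then have "h ` A = \<tau> ` inv_into UNIV \<tau> ` B" by (simp only: h_def image_comp[symmetric])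
      also have "\<dots> = B" using permutes_inverses(1)[OF qs(2)] by (simp add: image_image)
      finally show ?thesis using B arcs by simp
    next
      fix c assume "(Inr ` inv_into UNIV \<sigma> ` A :: (nat + nat) set) = {Inl c, Inr (inv_into UNIV \<tau> c)}"
      then show ?thesis by blast
    qed
  next
    fix c assume c: "c \<in> {1..n}" "c \<notin> \<Union> (arcs ps)"
    then have "{Inl c, Inr (inv_into UNIV \<sigma> c)} \<in> diagram ps \<sigma>" unfolding diagram_def by blast
    then have "{Inl c, Inr (inv_into UNIV \<sigma> c)} \<in> diagram qs \<tau>" by (simp only: eq)
    then have "inv_into UNIV \<sigma> c = inv_into UNIV \<tau> c"
      unfolding diagram_def
    proof (elim UnE imageE)
      fix A assume "{Inl c, Inr (inv_into UNIV \<sigma> c)} = Inl ` A"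
      then show ?thesis by blast
    next
      fix A assume "{Inl c, Inr (inv_into UNIV \<sigma> c)} = Inr ` inv_into UNIV \<tau> ` A"
      then show ?thesis by blast
    next
      fix d assume "{Inl c, Inr (inv_into UNIV \<sigma> c)} = {Inl d, Inr (inv_into UNIV \<tau> d)}"
      then show ?thesis by (auto simp: doubleton_eq_iff)
    qed
    then show "h c = c" using permutes_inverses(1)[OF qs(2)] by (simp add: h_def)
  qed
  then have "E ps \<bullet> T \<sigma> = E ps \<bullet> T \<tau>"
    using T_mul[OF ps(2) h] hs by (simp add: assoc[symmetric])
  then show ?thesis using E_arcs_cong[OF ps(1) qs(1) arcs] by simp
qed

theorem card_normal_forms: "finite normal_forms" "card normal_forms \<le> num_matchings n"
proof -
  let ?X = "Inl ` {1..n} \<union> Inr ` {1..n} :: (nat + nat) set"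
  have "card ?X = card (Inl ` {1..n} :: (nat + nat) set) + card (Inr ` {1..n} :: (nat + nat) set)"
    by (intro card_Un_disjoint) auto
  then have X: "finite ?X" "card ?X = 2 * n" by (auto simp: card_image)
  note pm = card_perfect_matchings[OF X]
  have "\<forall>y\<in>normal_forms. \<exists>ps \<sigma>. cap_list ps \<and> \<sigma> permutes {1..n} \<and> y = E ps \<bullet> T \<sigma>"
    by (auto simp: normal_forms_def)
  then obtain p q where pq: "\<And>y. y \<in> normal_forms \<Longrightarrow> cap_list (p y) \<and> q y permutes {1..n} \<and> y = E (p y) \<bullet> T (q y)"
    by metis
  have inj: "inj_on (\<lambda>y. diagram (p y) (q y)) normal_forms"
  proof (rule inj_onI)
    fix y y' assume y: "y \<in> normal_forms" "y' \<in> normal_forms" and eq: "diagram (p y) (q y) = diagram (p y') (q y')"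
    have "E (p y) \<bullet> T (q y) = E (p y') \<bullet> T (q y')"
      using pq[OF y(1)] pq[OF y(2)] by (intro diagram_determines[OF _ _ _ _ eq]) auto
    then show "y = y'" using pq[OF y(1)] pq[OF y(2)] by simp
  qed
  have sub: "(\<lambda>y. diagram (p y) (q y)) ` normal_forms \<subseteq> perfect_matchings ?X"
    using pq diagram_perfect_matching by blast
  show "finite normal_forms" using inj_on_finite[OF inj sub] pm by blast
  show "card normal_forms \<le> num_matchings n" using card_inj_on_le[OF inj sub] pm by linarith
qed

lemma normal_forms_closed:
  assumes P: "P one" "\<And>i. 1 \<le> i \<Longrightarrow> i < n \<Longrightarrow> P (s i)" "\<And>i. 1 \<le> i \<Longrightarrow> i < n \<Longrightarrow> P (e i)"
    "\<And>x y. P x \<Longrightarrow> P y \<Longrightarrow> P (x \<bullet> y)" and y: "y \<in> normal_forms"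
  shows "P y"
proof -
  have PT: "P (T \<sigma>)" if "\<sigma> permutes {1..n}" for \<sigma>
    using that
  proof (induction \<sigma> rule: permutes_adjacent_induct)
    case id
    show ?case using P(1) by (simp only: T_id)
  next
    case (step \<sigma> i)
    then show ?case using P(2,4) by (simp only: T_mul_s)
  qed
  have Pee: "P (ee a b)" if ab: "a \<in> {1..n}" "b \<in> {1..n}" "a \<noteq> b" for a b
  proof -
    obtain \<pi> where p: "\<pi> permutes {1..n}" "\<And>i. i < length [a,b] \<Longrightarrow> \<pi> (Suc i) = [a,b] ! i"
      using ab by (rule_tac obtain_permutation[of "[a,b]"]) auto
    have p12: "\<pi> 1 = a" "\<pi> 2 = b" using p(2)[of 0] p(2)[of 1] by (auto simp: numeral_2_eq_2)
    have n: "2 \<le> n" using ab by auto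
    have "ee a b = T \<pi> \<bullet> e 1 \<bullet> T (inv_into UNIV \<pi>)" using ee_eq[OF p(1) n] p12 by simp
    moreover have "P (e 1)" using n by (intro P(3)) auto
    ultimately show ?thesis using PT[OF p(1)] PT[OF permutes_inv[OF p(1)]] P(4) by simp
  qed
  have PE: "P (E ps)" if "cap_list ps" for ps
    using that
  proof (induction ps rule: rev_induct)
    case Nil
    show ?case using P(1) by simp
  next
    case (snoc p ps)
    have "P (ee (fst p) (snd p))"
      using snoc.prems by (intro Pee) (auto simp: cap_list_def arc_def)
    then show ?case using snoc.IH[OF cap_list_append1[OF snoc.prems]] P(4) by simp
  qed
  show ?thesis using y PE PT P(4) by (auto simp: normal_forms_def)
qed

end

section \<open>The tensor power and its words\<close>

lemma vector_space_field: "vector_space ((*) :: 'k::field \<Rightarrow> 'k \<Rightarrow> 'k)"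
  by unfold_locales (auto simp: algebra_simps)

lemma multilinear_Cons:
  assumes "multilinear sV sW (Suc r) f"
  shows "multilinear sV sW r (\<lambda>us. f (x # us))"
  unfolding multilinear_def
proof (intro allI impI)
  fix vs :: "'b list" and i assume "length vs = r" "i < r"
  then have "Vector_Spaces.linear sV sW (\<lambda>y. f ((x # vs)[Suc i := y]))"
    using assms unfolding multilinear_def by (metis length_Cons Suc_less_eq)
  then show "Vector_Spaces.linear sV sW (\<lambda>y. f (x # vs[i := y]))" by simp
qed

lemma multilinear_head:
  assumes "multilinear sV sW (Suc r) f" "length us = r"
  shows "Vector_Spaces.linear sV sW (\<lambda>x. f (x # us))"
proof -
  have "Vector_Spaces.linear sV sW (\<lambda>y. f ((undefined # us)[0 := y]))"
    using assms unfolding multilinear_def by (metis length_Cons zero_less_Suc)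
  then show ?thesis by simp
qed

text \<open>
  Every multilinear map is determined by its values on basis vectors.
\<close>
lemma multilinear_expand:
  fixes vec :: "'l \<Rightarrow> 'v::ab_group_add"
  assumes "multilinear sV sW r f" "length xs = r" "finite L"
    and "\<And>x. x \<in> set xs \<Longrightarrow> X x = (\<Sum>b\<in>L. sV (A x b) (vec b))"
  shows "f (map X xs) = expand sW L A (\<lambda>w. f (map vec w)) xs"
  using assms
proof (induction xs arbitrary: f r)
  case (Cons x xs)
  then obtain r' where r: "r = Suc r'" "length xs = r'" by (cases r) auto
  have lin: "Vector_Spaces.linear sV sW (\<lambda>y. f (y # map X xs))"
    using Cons.prems(1) r by (intro multilinear_head) auto
  interpret P: vector_space_pair sV sW
    using lin by (simp add: vector_space_pair_def Vector_Spaces.linear_def)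
  have "f (map X (x # xs)) = (\<Sum>b\<in>L. sW (A x b) (f (vec b # map X xs)))"
    using Cons.prems(4)[of x] P.linear_sum[OF lin, of "\<lambda>b. sV (A x b) (vec b)" L] P.linear_scale[OF lin] by simp
  also have "\<dots> = (\<Sum>b\<in>L. sW (A x b) (expand sW L A (\<lambda>w. f (vec b # map vec w)) xs))"
    using Cons.IH[OF multilinear_Cons[OF Cons.prems(1)[unfolded r(1)]] r(2)] Cons.prems(3,4)
    by (intro sum.cong refl arg_cong2[where f = sW]) auto
  finally show ?case by simp
qed simp

lemma linearI:
  assumes "vector_space s1" "vector_space s2" "\<And>x y. f (x + y) = f x + f y" "\<And>c x. f (s1 c x) = s2 c (f x)"
  shows "Vector_Spaces.linear s1 s2 f"
  using assms by (simp add: Vector_Spaces.linear_iff)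

lemma linear_add: "Vector_Spaces.linear s1 s2 f \<Longrightarrow> f (x + y) = f x + f y"
  by (simp add: Vector_Spaces.linear_iff)

lemma linear_scale: "Vector_Spaces.linear s1 s2 f \<Longrightarrow> f (s1 c x) = s2 c (f x)"
  by (simp add: Vector_Spaces.linear_iff)

lemma linear_sum:
  assumes "Vector_Spaces.linear s1 s2 f"
  shows "f (\<Sum>i\<in>I. g i) = (\<Sum>i\<in>I. f (g i))"
proof -
  interpret P: vector_space_pair s1 s2
    using assms by (simp add: vector_space_pair_def Vector_Spaces.linear_def)
  show ?thesis by (rule P.linear_sum[OF assms])
qed

lemma linear_zero: "Vector_Spaces.linear s1 s2 f \<Longrightarrow> f 0 = 0"
  using linear_sum[of s1 s2 f id "{}"] by simp

lemma linear_uminus: "Vector_Spaces.linear s1 s2 f \<Longrightarrow> f (- x) = - f x"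
  using linear_add[of s1 s2 f x "- x"] linear_zero[of s1 s2 f] by (simp add: eq_neg_iff_add_eq_0 add.commute)

lemma linear_diff: "Vector_Spaces.linear s1 s2 f \<Longrightarrow> f (x - y) = f x - f y"
  using linear_add[of s1 s2 f x "- y"] linear_uminus[of s1 s2 f y] by simp

lemma multilinear_expand_coords:
  fixes sV :: "'k::field \<Rightarrow> 'v::ab_group_add \<Rightarrow> 'v"
  assumes V: "vector_space sV" and U: "vector_space sU"
    and A: "\<And>l. Vector_Spaces.linear sV (*) (\<lambda>x. A x l)"
  shows "multilinear sV sU r (expand sU L A g)"
proof -
  interpret U: vector_space sU by fact
  have "Vector_Spaces.linear sV sU (\<lambda>x. expand sU L A g (vs[i := x]))" if "i < length vs" for vs i
    using that
  proof (induction vs arbitrary: g i)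
    case (Cons y vs)
    show ?case
    proof (cases i)
      case 0
      then show ?thesis
        using linear_add[OF A] linear_scale[OF A]
        by (intro linearI V U) (simp_all add: U.scale_left_distrib sum.distrib U.scale_sum_right)
    next
      case (Suc j)
      then have "Vector_Spaces.linear sV sU (\<lambda>x. expand sU L A (\<lambda>w. g (b # w)) (vs[j := x]))" for b
        using Cons by auto
      from linear_add[OF this] linear_scale[OF this] show ?thesis using Suc
        by (intro linearI V U) (simp_all add: U.scale_right_distrib sum.distrib U.scale_sum_right mult.commute)
    qed
  qed simp
  then show ?thesis by (simp add: multilinear_def)
qed

lemma finite_words [simp]: "finite (words m r)"
proof -
  have "words m r = {w. set w \<subseteq> alphabet m \<and> length w = r}" by (auto simp: words_def)
  then show ?thesis using finite_lists_length_eq[OF finite_alphabet] by simp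
qed

lemma pairing_self [simp]: "l \<in> alphabet m \<Longrightarrow> of_int (sgn l) * of_int (sgn l) = (1 :: 'k::field)"
  by (auto simp: alphabet_def sgn_if)

lemma expand_scale_delta:
  fixes sU :: "'k::field \<Rightarrow> 'u::ab_group_add \<Rightarrow> 'u"
  assumes "vector_space sU" "finite L" "set w \<subseteq> L" "\<And>l k. l \<in> L \<Longrightarrow> k \<in> L \<Longrightarrow> A (X k) l = (if l = k then 1 else 0)"
  shows "expand sU L A g (map X w) = g w"
  using assms(3)
proof (induction w arbitrary: g)
  case (Cons k w)
  interpret U: vector_space sU by fact
  have "(\<Sum>b\<in>L. sU (A (X k) b) (expand sU L A (\<lambda>w. g (b # w)) (map X w)))
      = (\<Sum>b\<in>L. if b = k then g (k # w) else 0)"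
    using Cons assms(4) by (intro sum.cong refl) auto
  then show ?case using Cons.prems assms(2) by (simp add: sum.delta)
qed simp

locale symplectic_tensor =
  fixes sV :: "'k::field \<Rightarrow> 'v::ab_group_add \<Rightarrow> 'v"
    and form :: "'v \<Rightarrow> 'v \<Rightarrow> 'k"
    and v :: "nat \<Rightarrow> 'v"
    and sT :: "'k \<Rightarrow> 't::ab_group_add \<Rightarrow> 't"
    and \<tau> :: "'v list \<Rightarrow> 't"
    and m n :: nat
  assumes m_pos: "1 \<le> m" and space: "symplectic_space sV form m"
    and basis: "symplectic_basis sV form m v" and tensor: "tensor_power sV n sT \<tau>"
begin

lemma vsV: "vector_space sV" and vsT: "vector_space sT"
  using tensor by (simp_all add: tensor_power_def)

sublocale V: vector_space sV by (rule vsV)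
sublocale T: vector_space sT by (rule vsT)

lemma form_left: "Vector_Spaces.linear sV (*) (\<lambda>x. form x y)"
  and form_right: "Vector_Spaces.linear sV (*) (\<lambda>y. form x y)"
  and form_skew: "form x y = - form y x"
  and form_nondegenerate: "(\<And>y. form x y = 0) \<Longrightarrow> x = 0"
  using space unfolding symplectic_space_def by blast+

definition index :: "int \<Rightarrow> nat" where
  "index l = nat (l mod (2 * int m + 1))"

definition vec :: "int \<Rightarrow> 'v" where
  "vec l = v (index l)"

definition letter :: "nat \<Rightarrow> int" where
  "letter i = (if i \<le> m then int i else int i - (2 * int m + 1))"

lemma index_eq: "l \<in> alphabet m \<Longrightarrow> index l = (if l > 0 then nat l else nat (l + 2 * int m + 1))"
  by (auto simp: index_def alphabet_def root_key_facts)

lemma index_range: "l \<in> alphabet m \<Longrightarrow> index l \<in> {1..2*m}"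
  by (auto simp: index_eq) (auto simp: alphabet_def)

lemma letter_range: "i \<in> {1..2*m} \<Longrightarrow> letter i \<in> alphabet m"
  by (auto simp: letter_def alphabet_def)

lemma index_letter: "i \<in> {1..2*m} \<Longrightarrow> index (letter i) = i"
  using letter_range[of i] by (auto simp: index_eq letter_def)

lemma letter_index: "l \<in> alphabet m \<Longrightarrow> letter (index l) = l"
  by (auto simp: index_eq letter_def alphabet_def)

lemma prime_index: "l \<in> alphabet m \<Longrightarrow> prime_index m (index l) = index (- l)"
  using uminus_alphabet[of l m] by (auto simp: index_eq prime_index_def alphabet_def)

lemma form_vec:
  assumes "l \<in> alphabet m" "k \<in> alphabet m"
  shows "form (vec l) (vec k) = pairing l k"
proof -
  have B: "form (v i) (v j) = 0" "form (v (prime_index m i)) (v (prime_index m j)) = 0"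
      "form (v i) (v (prime_index m j)) = (if i = j then 1 else 0)"
      "form (v (prime_index m j)) (v i) = - (if i = j then 1 else 0)"
    if "i \<in> {1..m}" "j \<in> {1..m}" for i j
    using basis that unfolding symplectic_basis_def by auto
  have pos: "vec l = v (nat l) \<and> nat l \<in> {1..m}" if "l \<in> alphabet m" "l > 0" for l
    using that by (auto simp: vec_def index_eq) (auto simp: alphabet_def)
  have neg: "vec l = v (prime_index m (nat (- l))) \<and> nat (- l) \<in> {1..m}" if "l \<in> alphabet m" "\<not> l > 0" for l
    using that by (auto simp: vec_def index_eq prime_index_def alphabet_def intro!: arg_cong[where f = v])
  show ?thesis
  proof (cases "l > 0"; cases "k > 0")
    assume "l > 0" "k > 0"
    then show ?thesis using B(1) pos assms by (simp add: pairing_def)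
  next
    assume a: "l > 0" "\<not> k > 0"
    then have "form (vec l) (vec k) = (if nat l = nat (- k) then 1 else 0)"
      using B(3) pos neg assms by simp
    then show ?thesis using a by (auto simp: pairing_def)
  next
    assume a: "\<not> l > 0" "k > 0"
    then have "form (vec l) (vec k) = - (if nat k = nat (- l) then 1 else 0)"
      using B(4) pos neg assms by simp
    then show ?thesis using a assms by (auto simp: pairing_def alphabet_def)
  next
    assume a: "\<not> l > 0" "\<not> k > 0"
    then show ?thesis using B(2) neg assms by (simp add: pairing_def alphabet_def)
  qed
qed

lemma span_vec: "V.span (vec ` alphabet m) = UNIV"
proof -
  have "v ` {1..2*m} \<subseteq> vec ` alphabet m"
    using index_letter letter_range by (force simp: vec_def)
  then have "V.span (v ` {1..2*m}) \<subseteq> V.span (vec ` alphabet m)" by (rule V.span_mono)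
  then show ?thesis using basis by (auto simp: symplectic_basis_def)
qed

definition coord :: "'v \<Rightarrow> int \<Rightarrow> 'k" where
  "coord x l = of_int (sgn l) * form x (vec (- l))"

lemma coord_linear: "Vector_Spaces.linear sV (*) (\<lambda>x. coord x l)"
  using linear_add[OF form_left] linear_scale[OF form_left]
  by (intro linearI vsV vector_space_field) (simp_all add: coord_def distrib_left)

lemma coord_vec: "l \<in> alphabet m \<Longrightarrow> k \<in> alphabet m \<Longrightarrow> coord (vec k) l = (if l = k then 1 else 0)"
  by (auto simp: coord_def form_vec pairing_def)

lemma vec_expand: "x = (\<Sum>l\<in>alphabet m. sV (coord x l) (vec l))"
proof -
  let ?S = "{x. x = (\<Sum>l\<in>alphabet m. sV (coord x l) (vec l))}"
  define R where "R x = (\<Sum>l\<in>alphabet m. sV (coord x l) (vec l))" for x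
  have "R 0 = 0" "R (x + y) = R x + R y" "R (sV c x) = sV c (R x)" for x y c
    using linear_add[OF coord_linear] linear_scale[OF coord_linear] linear_zero[OF coord_linear]
    by (simp_all add: R_def V.scale_left_distrib sum.distrib V.scale_sum_right)
  then have "V.subspace {x. x = R x}" by (auto simp: V.subspace_def)
  then have "V.subspace ?S" by (simp only: R_def)
  moreover have "vec ` alphabet m \<subseteq> ?S"
  proof safe
    fix k assume k: "k \<in> alphabet m"
    have "(\<Sum>l\<in>alphabet m. sV (coord (vec k) l) (vec l)) = (\<Sum>l\<in>alphabet m. if l = k then vec k else 0)"
      by (intro sum.cong refl) (auto simp: coord_vec k)
    then show "vec k = (\<Sum>l\<in>alphabet m. sV (coord (vec k) l) (vec l))" using k by (simp add: sum.delta)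
  qed
  ultimately have "V.span (vec ` alphabet m) \<subseteq> ?S" by (rule V.span_minimal[rotated])
  then show ?thesis using span_vec by blast
qed

definition basis_tensor :: "int list \<Rightarrow> 't" where
  "basis_tensor w = \<tau> (map vec w)"

lemma multilinear_expand_basis:
  assumes "multilinear sV sW r f" "length xs = r"
  shows "f xs = expand sW (alphabet m) coord (\<lambda>w. f (map vec w)) xs"
  using multilinear_expand[OF assms finite_alphabet, of id coord vec m] vec_expand by simp

lemma multilinear_tau: "multilinear sV sT n \<tau>"
  using tensor by (simp add: tensor_power_def)

lemma linear_eq_pure:
  assumes "Vector_Spaces.linear sT sU F" "Vector_Spaces.linear sT sU G"
    and "\<And>xs. length xs = n \<Longrightarrow> F (\<tau> xs) = G (\<tau> xs)"
  shows "F = G"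
proof -
  have U: "vector_space sU" using assms(1) by (simp add: Vector_Spaces.linear_iff)
  have "multilinear sV sU n (\<lambda>xs. F (\<tau> xs))" by (rule multilinear_compose[OF multilinear_tau assms(1)])
  from tensor_power_universal[OF tensor U this] show ?thesis using assms by auto
qed

lemma linear_eq_words:
  assumes F: "Vector_Spaces.linear sT sU F" and G: "Vector_Spaces.linear sT sU G"
    and eq: "\<And>w. w \<in> words m n \<Longrightarrow> F (basis_tensor w) = G (basis_tensor w)"
  shows "F = G"
proof (rule linear_eq_pure[OF F G])
  fix xs :: "'v list" assume xs: "length xs = n"
  have "F (\<tau> xs) = expand sU (alphabet m) coord (\<lambda>w. F (\<tau> (map vec w))) xs"
    by (rule multilinear_expand_basis[OF multilinear_compose[OF multilinear_tau F] xs])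
  also have "\<dots> = expand sU (alphabet m) coord (\<lambda>w. G (\<tau> (map vec w))) xs"
    using eq xs by (intro expand_cong) (auto simp: basis_tensor_def words_def)
  also have "\<dots> = G (\<tau> xs)"
    by (rule multilinear_expand_basis[OF multilinear_compose[OF multilinear_tau G] xs, symmetric])
  finally show "F (\<tau> xs) = G (\<tau> xs)" .
qed

lemma linear_extension:
  assumes U: "vector_space sU"
  shows "\<exists>F. Vector_Spaces.linear sT sU F \<and> (\<forall>w\<in>words m n. F (basis_tensor w) = g w)"
proof -
  have "multilinear sV sU n (expand sU (alphabet m) coord g)"
    by (rule multilinear_expand_coords[where A = coord, OF vsV U coord_linear])
  from ex1_implies_ex[OF tensor_power_universal[OF tensor U this]]
  obtain F where F: "Vector_Spaces.linear sT sU F" "\<And>xs. length xs = n \<Longrightarrow> F (\<tau> xs) = expand sU (alphabet m) coord g xs"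
    by blast
  have "F (basis_tensor w) = g w" if "w \<in> words m n" for w
    using that F(2)[of "map vec w"] expand_scale_delta[OF U finite_alphabet, of w m coord vec g] coord_vec
    by (simp add: words_def basis_tensor_def)
  then show ?thesis using F(1) by blast
qed

lemma tensor_action:
  assumes g: "Vector_Spaces.linear sV sV g"
  shows "Vector_Spaces.linear sT sT (tensor_action n sT \<tau> g)"
    and "length xs = n \<Longrightarrow> tensor_action n sT \<tau> g (\<tau> xs) = \<tau> (map g xs)"
proof -
  have "multilinear sV sT n (\<lambda>xs. \<tau> (map g xs))"
    unfolding multilinear_def
  proof (intro allI impI)
    fix vs :: "'v list" and i assume i: "length vs = n" "i < n"
    have "Vector_Spaces.linear sV sT (\<lambda>x. \<tau> ((map g vs)[i := x]))"
      using multilinear_tau i by (simp add: multilinear_def)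
    from Vector_Spaces.linear_compose[OF g this]
    show "Vector_Spaces.linear sV sT (\<lambda>x. \<tau> (map g (vs[i := x])))" by (simp add: o_def map_update)
  qed
  from theI'[OF tensor_power_universal[OF tensor vsT this]]
  show "Vector_Spaces.linear sT sT (tensor_action n sT \<tau> g)"
    and "length xs = n \<Longrightarrow> tensor_action n sT \<tau> g (\<tau> xs) = \<tau> (map g xs)"
    unfolding tensor_action_def by auto
qed

text \<open>
  Pairing with the pure tensor of the vectors \<open>ys\<close>, for the form that the symplectic form induces on the
  tensor power.
\<close>
definition dual :: "'v list \<Rightarrow> 't \<Rightarrow> 'k" where
  "dual ys = (THE F. Vector_Spaces.linear sT (*) F \<and> (\<forall>xs. length xs = n \<longrightarrow> F (\<tau> xs) = (\<Prod>i<n. form (xs ! i) (ys ! i))))"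

lemma prod_update:
  fixes h :: "'v \<Rightarrow> nat \<Rightarrow> 'k"
  assumes "length xs = n" "i < n"
  shows "(\<Prod>j<n. h (xs[i := x] ! j) j) = h x i * (\<Prod>j\<in>{..<n} - {i}. h (xs ! j) j)"
proof -
  have "(\<Prod>j<n. h (xs[i := x] ! j) j) = h (xs[i := x] ! i) i * (\<Prod>j\<in>{..<n} - {i}. h (xs[i := x] ! j) j)"
    using assms by (intro prod.remove) auto
  also have "(\<Prod>j\<in>{..<n} - {i}. h (xs[i := x] ! j) j) = (\<Prod>j\<in>{..<n} - {i}. h (xs ! j) j)"
    by (intro prod.cong) auto
  finally show ?thesis using assms by simp
qed

lemma dual_linear: "Vector_Spaces.linear sT (*) (dual ys)"
  and dual_pure: "length xs = n \<Longrightarrow> dual ys (\<tau> xs) = (\<Prod>i<n. form (xs ! i) (ys ! i))"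
proof -
  have "multilinear sV (*) n (\<lambda>xs. \<Prod>i<n. form (xs ! i) (ys ! i))"
    unfolding multilinear_def
  proof (intro allI impI)
    fix vs :: "'v list" and i assume i: "length vs = n" "i < n"
    show "Vector_Spaces.linear sV (*) (\<lambda>x. \<Prod>j<n. form (vs[i := x] ! j) (ys ! j))"
      unfolding prod_update[OF i, of "\<lambda>x j. form x (ys ! j)"]
      using linear_add[OF form_left] linear_scale[OF form_left]
      by (intro linearI vsV vector_space_field) (simp_all add: distrib_right mult.assoc)
  qed
  from theI'[OF tensor_power_universal[OF tensor vector_space_field this]]
  show "Vector_Spaces.linear sT (*) (dual ys)"
    and "length xs = n \<Longrightarrow> dual ys (\<tau> xs) = (\<Prod>i<n. form (xs ! i) (ys ! i))"
    unfolding dual_def by auto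
qed

lemma dual_multilinear: "multilinear sV (*) n (\<lambda>ys. dual ys t)"
  unfolding multilinear_def
proof (intro allI impI)
  fix ys :: "'v list" and i assume i: "length ys = n" "i < n"
  have eq: "(\<Prod>j<n. form (xs ! j) (ys[i := y] ! j)) = form (xs ! i) y * (\<Prod>j\<in>{..<n} - {i}. form (xs ! j) (ys ! j))" for xs y
    by (rule prod_update[OF i, of "\<lambda>y j. form (xs ! j) y"])
  have add: "dual (ys[i := x + y]) = (\<lambda>t. dual (ys[i := x]) t + dual (ys[i := y]) t)" for x y
    using linear_add[OF dual_linear] linear_scale[OF dual_linear] linear_add[OF form_right]
    by (intro linear_eq_pure[OF dual_linear] linearI vsT vector_space_field)
      (simp_all add: distrib_left distrib_right dual_pure eq)
  have scale: "dual (ys[i := sV c x]) = (\<lambda>t. c * dual (ys[i := x]) t)" for c x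
    using linear_add[OF dual_linear] linear_scale[OF dual_linear] linear_scale[OF form_right]
    by (intro linear_eq_pure[OF dual_linear] linearI vsT vector_space_field)
      (simp_all add: distrib_left dual_pure eq)
  show "Vector_Spaces.linear sV (*) (\<lambda>y. dual (ys[i := y]) t)"
    by (intro linearI vsV vector_space_field) (simp_all add: add scale)
qed

lemma dual_basis:
  assumes "u \<in> words m n" "w \<in> words m n"
  shows "dual (map vec w) (basis_tensor u) = (\<Prod>i<n. pairing (u ! i) (w ! i))"
proof -
  have "u ! i \<in> alphabet m" "w ! i \<in> alphabet m" if "i < n" for i
    using assms that by (auto simp: words_def dest!: subsetD[OF _ nth_mem])
  then show ?thesis
    using assms by (auto simp: basis_tensor_def dual_pure words_def form_vec intro!: prod.cong)
qed

text \<open>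
  The functional \<open>dual (map vec (map uminus w))\<close> is, up to sign, the coordinate functional of the
  word \<open>w\<close>.
\<close>
lemma dual_separates:
  assumes "\<And>w. w \<in> words m n \<Longrightarrow> dual (map vec w) t = 0"
  shows "t = 0"
proof -
  let ?c = "\<lambda>w. (\<Prod>i<n. of_int (sgn (w ! i))) :: 'k"
  let ?R = "\<lambda>t. \<Sum>w\<in>words m n. sT (?c w * dual (map vec (map uminus w)) t) (basis_tensor w)"
  have "?R = id"
  proof (rule linear_eq_words)
    show "Vector_Spaces.linear sT sT ?R"
      using linear_add[OF dual_linear] linear_scale[OF dual_linear]
      by (intro linearI vsT) (simp_all add: distrib_left T.scale_left_distrib sum.distrib T.scale_sum_right mult.left_commute)
    show "Vector_Spaces.linear sT sT id" by (intro linearI vsT) auto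
    fix u assume u: "u \<in> words m n"
    have "?R (basis_tensor u) = (\<Sum>w\<in>words m n. if w = u then basis_tensor u else 0)"
    proof (rule sum.cong[OF refl])
      fix w assume w: "w \<in> words m n"
      then have mw: "map uminus w \<in> words m n" by (auto simp: words_def)
      have d: "dual (map vec (map uminus w)) (basis_tensor u) = (\<Prod>i<n. pairing (u ! i) (- (w ! i)))"
        using dual_basis[OF u mw] w by (auto simp: words_def intro!: prod.cong)
      show "sT (?c w * dual (map vec (map uminus w)) (basis_tensor u)) (basis_tensor w) = (if w = u then basis_tensor u else 0)"
      proof (cases "w = u")
        case True
        have "?c w * (\<Prod>i<n. pairing (u ! i) (- (w ! i))) = (\<Prod>i<n. of_int (sgn (w ! i)) * pairing (u ! i) (- (w ! i)))"
          by (simp add: prod.distrib)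
        also have "\<dots> = (\<Prod>i<n. 1)"
        proof (rule prod.cong[OF refl])
          fix i assume "i \<in> {..<n}"
          then have "w ! i \<in> alphabet m" using w by (auto simp: words_def dest!: subsetD[OF _ nth_mem])
          then show "of_int (sgn (w ! i)) * pairing (u ! i) (- (w ! i)) = (1::'k)"
            using True by (simp add: pairing_def)
        qed
        finally show ?thesis using d True by simp
      next
        case False
        then obtain i where "i < n" "w ! i \<noteq> u ! i"
          using w u by (auto simp: words_def list_eq_iff_nth_eq)
        then have "(\<Prod>i<n. pairing (u ! i) (- (w ! i))) = (0::'k)"
          by (intro prod_zero) (auto simp: pairing_def intro!: bexI[of _ i])
        then show ?thesis using False d by simp
      qed
    qed
    then show "?R (basis_tensor u) = id (basis_tensor u)" using u by (simp add: sum.delta)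
  qed
  moreover have "?R t = 0"
  proof (intro sum.neutral ballI)
    fix w assume "w \<in> words m n"
    then have "map uminus w \<in> words m n" by (auto simp: words_def)
    then have "dual (map vec (map uminus w)) t = 0" by (rule assms)
    then show "sT (?c w * dual (map vec (map uminus w)) t) (basis_tensor w) = 0" by (simp only: mult_zero_right T.scale_zero_left)
  qed
  ultimately show ?thesis using fun_cong[of ?R id t] by simp
qed

text \<open>
  An endomorphism \<open>F\<close> of the \<open>n\<close>-th tensor power is the same as a form in \<open>2n\<close> arguments: apply \<open>F\<close> to
  the first \<open>n\<close> and pair the result with the others.
\<close>
definition functional :: "('t \<Rightarrow> 't) \<Rightarrow> int list \<Rightarrow> 'k" where
  "functional F w = dual (map vec (drop n w)) (F (basis_tensor (take n w)))"

lemma functional_inject: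
  assumes F: "Vector_Spaces.linear sT sT F" and G: "Vector_Spaces.linear sT sT G"
    and eq: "\<And>w. w \<in> words m (2 * n) \<Longrightarrow> functional F w = functional G w"
  shows "F = G"
proof (rule linear_eq_words[OF F G])
  fix u assume u: "u \<in> words m n"
  have "F (basis_tensor u) - G (basis_tensor u) = 0"
  proof (rule dual_separates)
    fix w assume w: "w \<in> words m n"
    have "functional F (u @ w) = functional G (u @ w)" using u w by (intro eq) (auto simp: words_def)
    then have "dual (map vec w) (F (basis_tensor u)) = dual (map vec w) (G (basis_tensor u))"
      using u by (simp add: functional_def words_def)
    then show "dual (map vec w) (F (basis_tensor u) - G (basis_tensor u)) = 0"
      by (simp add: linear_diff[OF dual_linear])
  qed
  then show "F (basis_tensor u) = G (basis_tensor u)" by simp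
qed

definition matrix_map :: "(int \<Rightarrow> int \<Rightarrow> 'k) \<Rightarrow> 'v \<Rightarrow> 'v" where
  "matrix_map A x = (\<Sum>l\<in>alphabet m. sV (coord x l) (\<Sum>b\<in>alphabet m. sV (A l b) (vec b)))"

lemma matrix_map_vec: "l \<in> alphabet m \<Longrightarrow> matrix_map A (vec l) = (\<Sum>b\<in>alphabet m. sV (A l b) (vec b))"
proof -
  assume l: "l \<in> alphabet m"
  have "matrix_map A (vec l) = (\<Sum>k\<in>alphabet m. if k = l then (\<Sum>b\<in>alphabet m. sV (A l b) (vec b)) else 0)"
    unfolding matrix_map_def by (intro sum.cong refl) (auto simp: coord_vec l)
  then show ?thesis using l by (simp add: sum.delta)
qed

lemma coord_combination_linear: "Vector_Spaces.linear sV sV (\<lambda>x. \<Sum>l\<in>alphabet m. sV (coord x l) (Y l))"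
  using linear_add[OF coord_linear] linear_scale[OF coord_linear]
  by (intro linearI vsV) (simp_all add: V.scale_left_distrib sum.distrib V.scale_sum_right)

lemma matrix_map_linear: "Vector_Spaces.linear sV sV (matrix_map A)"
  unfolding matrix_map_def[abs_def] by (rule coord_combination_linear)

lemma form_sum:
  "form (\<Sum>l\<in>alphabet m. sV (a l) (X l)) (\<Sum>k\<in>alphabet m. sV (b k) (Y k))
   = (\<Sum>l\<in>alphabet m. \<Sum>k\<in>alphabet m. a l * b k * form (X l) (Y k))"
proof -
  have L: "form (\<Sum>l\<in>alphabet m. sV (a l) (X l)) y = (\<Sum>l\<in>alphabet m. a l * form (X l) y)" for y
    using linear_sum[OF form_left, of "\<lambda>l. sV (a l) (X l)"] linear_scale[OF form_left] by simp
  have R: "form x (\<Sum>k\<in>alphabet m. sV (b k) (Y k)) = (\<Sum>k\<in>alphabet m. b k * form x (Y k))" for x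
    using linear_sum[OF form_right, of x "\<lambda>k. sV (b k) (Y k)"] linear_scale[OF form_right] by simp
  show ?thesis unfolding L by (simp only: R sum_distrib_left mult.assoc)
qed

lemma symplectic_matrix_map_Sp:
  assumes A: "symplectic_matrix m A"
  shows "matrix_map A \<in> Sp sV form"
proof -
  have basis_case: "form (\<Sum>b\<in>alphabet m. sV (A l b) (vec b)) (\<Sum>b\<in>alphabet m. sV (A k b) (vec b)) = form (vec l) (vec k)"
    if "l \<in> alphabet m" "k \<in> alphabet m" for l k
    using A that by (simp add: form_sum form_vec symplectic_matrix_def)
  have pres: "form (matrix_map A x) (matrix_map A y) = form x y" for x y
  proof -
    have "form (matrix_map A x) (matrix_map A y) = (\<Sum>l\<in>alphabet m. \<Sum>k\<in>alphabet m. coord x l * coord y k * form (vec l) (vec k))"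
      unfolding matrix_map_def form_sum
      by (intro sum.cong refl) (simp only: basis_case[unfolded form_sum])
    also have "\<dots> = form (\<Sum>l\<in>alphabet m. sV (coord x l) (vec l)) (\<Sum>k\<in>alphabet m. sV (coord y k) (vec k))"
      by (simp add: form_sum)
    also have "\<dots> = form x y" using vec_expand[of x] vec_expand[of y] by simp
    finally show ?thesis .
  qed
  have inj: "inj (matrix_map A)"
  proof (rule injI)
    fix x y assume "matrix_map A x = matrix_map A y"
    then have "matrix_map A (x - y) = 0" by (simp add: linear_diff[OF matrix_map_linear])
    then have "form (x - y) u = 0" for u
      using pres[of "x - y" u] linear_zero[OF form_left] by simp
    then show "x = y" using form_nondegenerate[of "x - y"] by simp
  qed
  interpret F: finite_dimensional_vector_space sV "v ` {1..2*m}"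
    using basis by unfold_locales (auto simp: symplectic_basis_def)
  have "surj (matrix_map A)" by (rule F.linear_inj_imp_surj[OF matrix_map_linear inj])
  then show ?thesis using inj pres matrix_map_linear by (simp add: Sp_def GL_def bij_def)
qed

text \<open>
  The pairing is invariant under the symplectic group, so endomorphisms that commute with the group
  correspond to invariant forms.
\<close>
lemma functional_invariant:
  assumes F: "Vector_Spaces.linear sT sT F"
    and comm: "\<And>g t. g \<in> Sp sV form \<Longrightarrow> F (tensor_action n sT \<tau> g t) = tensor_action n sT \<tau> g (F t)"
  shows "invariant_form m (2 * n) (functional F)"
  unfolding invariant_form_def
proof (intro allI impI ballI)
  fix A :: "int \<Rightarrow> int \<Rightarrow> 'k" and w assume A: "symplectic_matrix m A" and w: "w \<in> words m (2 * n)"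
  let ?g = "matrix_map A"
  have g: "?g \<in> Sp sV form" by (rule symplectic_matrix_map_Sp[OF A])
  define \<Phi> where "\<Phi> xs = dual (drop n xs) (F (\<tau> (take n xs)))" for xs
  have multi: "multilinear sV (*) (2 * n) \<Phi>"
    unfolding multilinear_def
  proof (intro allI impI)
    fix xs :: "'v list" and i assume i: "length xs = 2 * n" "i < 2 * n"
    show "Vector_Spaces.linear sV (*) (\<lambda>x. \<Phi> (xs[i := x]))"
    proof (cases "i < n")
      case True
      have "Vector_Spaces.linear sV sT (\<lambda>x. \<tau> ((take n xs)[i := x]))"
        using multilinear_tau i True by (simp add: multilinear_def)
      from Vector_Spaces.linear_compose[OF this Vector_Spaces.linear_compose[OF F dual_linear[of "drop n xs"]]]
      show ?thesis using True by (simp add: \<Phi>_def o_def take_update_swap drop_update_cancel)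
    next
      case False
      have "Vector_Spaces.linear sV (*) (\<lambda>x. dual ((drop n xs)[i - n := x]) (F (\<tau> (take n xs))))"
        using dual_multilinear i False by (simp add: multilinear_def)
      then show ?thesis using False by (simp add: \<Phi>_def drop_update_swap)
    qed
  qed
  have func: "functional F = (\<lambda>w. \<Phi> (map vec w))"
    by (simp add: functional_def \<Phi>_def basis_tensor_def take_map drop_map fun_eq_iff)
  have pres: "dual (map ?g ys) (tensor_action n sT \<tau> ?g t) = dual ys t" if "length ys = n" for ys t
  proof -
    have "(dual (map ?g ys) \<circ> tensor_action n sT \<tau> ?g) = dual ys"
    proof (rule linear_eq_pure[OF _ dual_linear])
      show "Vector_Spaces.linear sT (*) (dual (map ?g ys) \<circ> tensor_action n sT \<tau> ?g)"
        by (rule Vector_Spaces.linear_compose[OF tensor_action(1)[OF matrix_map_linear] dual_linear])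
      fix xs :: "'v list" assume "length xs = n"
      then show "(dual (map ?g ys) \<circ> tensor_action n sT \<tau> ?g) (\<tau> xs) = dual ys (\<tau> xs)"
        using g that by (simp add: tensor_action(2)[OF matrix_map_linear] dual_pure Sp_def)
    qed
    then show ?thesis by (metis comp_apply)
  qed
  have lw: "length w = 2 * n" using w by (simp add: words_def)
  have "expand (*) (alphabet m) A (functional F) w = \<Phi> (map (\<lambda>l. ?g (vec l)) w)"
    unfolding func
    by (rule multilinear_expand[OF multi lw finite_alphabet, symmetric]) (use w in \<open>auto simp: matrix_map_vec words_def\<close>)
  also have "\<dots> = dual (map ?g (map vec (drop n w))) (F (\<tau> (map ?g (map vec (take n w)))))"
    by (simp add: \<Phi>_def take_map drop_map o_def)
  also have "\<tau> (map ?g (map vec (take n w))) = tensor_action n sT \<tau> ?g (basis_tensor (take n w))"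
    using tensor_action(2)[OF matrix_map_linear, of "map vec (take n w)"] lw by (simp add: basis_tensor_def)
  also have "F \<dots> = tensor_action n sT \<tau> ?g (F (basis_tensor (take n w)))" by (rule comm[OF g])
  also have "dual (map ?g (map vec (drop n w))) \<dots> = functional F w"
    using lw by (subst pres) (simp_all add: functional_def)
  finally show "expand (*) (alphabet m) A (functional F) w = functional F w" .
qed

end

section \<open>The generators in coordinates\<close>

text \<open>
  The action of a generator, carried over from tensors to families of vectors indexed by words.  The
  target space is arbitrary: with tensors as values these are the operators themselves, with
  scalars as values the transposed operators on forms.  As operators on tensors act from the right
  and a family is transformed contravariantly, the letters of a generator word appear in the
  same order in both.
\<close>
definition s_family :: "nat \<Rightarrow> (int list \<Rightarrow> 'u::ab_group_add) \<Rightarrow> int list \<Rightarrow> 'u" where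
  "s_family j b w = - b (w[j - 1 := w ! j, j := w ! (j - 1)])"

definition e_family :: "nat \<Rightarrow> ('k::field \<Rightarrow> 'u::ab_group_add \<Rightarrow> 'u) \<Rightarrow> nat \<Rightarrow> (int list \<Rightarrow> 'u) \<Rightarrow> int list \<Rightarrow> 'u" where
  "e_family m sU j b w = sU (pairing (w ! (j - 1)) (w ! j))
     (\<Sum>l\<in>alphabet m. sU (- of_int (sgn l)) (b (w[j - 1 := l, j := - l])))"

fun gen_family :: "nat \<Rightarrow> ('k::field \<Rightarrow> 'u::ab_group_add \<Rightarrow> 'u) \<Rightarrow> brauer_gen \<Rightarrow> (int list \<Rightarrow> 'u) \<Rightarrow> int list \<Rightarrow> 'u" where
  "gen_family m sU (GenS j) b w = s_family j b w"
| "gen_family m sU (GenE j) b w = e_family m sU j b w"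

definition word_family :: "nat \<Rightarrow> ('k::field \<Rightarrow> 'u::ab_group_add \<Rightarrow> 'u) \<Rightarrow> brauer_gen list \<Rightarrow> (int list \<Rightarrow> 'u) \<Rightarrow> int list \<Rightarrow> 'u" where
  "word_family m sU gs b = foldr (gen_family m sU) gs b"

lemma word_family_simps [simp]:
  "word_family m sU [] b = b"
  "word_family m sU (g # gs) b = gen_family m sU g (word_family m sU gs b)"
  by (simp_all add: word_family_def)

lemma sum_alphabet:
  "(\<Sum>l\<in>alphabet m. g l) = (\<Sum>k=1..m. g (int k) + g (- int k))"
proof -
  have L: "alphabet m = int ` {1..m} \<union> (\<lambda>k. - int k) ` {1..m}"
  proof (rule Set.set_eqI)
    fix l show "l \<in> alphabet m \<longleftrightarrow> l \<in> int ` {1..m} \<union> (\<lambda>k. - int k) ` {1..m}"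
    proof
      assume l: "l \<in> alphabet m"
      then have "nat \<bar>l\<bar> \<in> {1..m}" "l = int (nat \<bar>l\<bar>) \<or> l = - int (nat \<bar>l\<bar>)" by (auto simp: alphabet_def)
      then show "l \<in> int ` {1..m} \<union> (\<lambda>k. - int k) ` {1..m}" by blast
    qed (auto simp: alphabet_def)
  qed
  have "int ` {1..m} \<inter> (\<lambda>k. - int k) ` {1..m} = {}" by auto
  then have "(\<Sum>l\<in>alphabet m. g l) = (\<Sum>l\<in>int ` {1..m}. g l) + (\<Sum>l\<in>(\<lambda>k. - int k) ` {1..m}. g l)"
    unfolding L by (intro sum.union_disjoint) auto
  then show ?thesis by (simp add: sum.reindex inj_on_def sum.distrib)
qed

lemma sum_alphabet_uminus: "(\<Sum>l\<in>alphabet m. g (- l)) = (\<Sum>l\<in>alphabet m. g l)"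
  by (rule sum.reindex_bij_witness[of _ uminus uminus]) auto

lemma card_alphabet: "card (alphabet m) = 2 * m"
  using sum_alphabet[of "\<lambda>_. 1 :: nat" m] by simp

lemma words_update: "w \<in> words m r \<Longrightarrow> x \<in> alphabet m \<Longrightarrow> w[i := x] \<in> words m r"
  using set_update_subset_insert[of w i x] by (auto simp: words_def)

lemma words_nth: "w \<in> words m r \<Longrightarrow> i < r \<Longrightarrow> w ! i \<in> alphabet m"
  using nth_mem[of i w] by (auto simp: words_def)

lemma gen_family_cong:
  assumes "g \<in> brauer_gens n" "w \<in> words m r" "n \<le> r" "\<And>w. w \<in> words m r \<Longrightarrow> b w = b' w"
  shows "gen_family m sU g b w = gen_family m sU g b' w"
proof (cases g)
  case (GenS j)
  then have j: "1 \<le> j" "j < n" using assms(1) by (auto simp: brauer_gens_def)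
  show ?thesis
    using j assms(2,3) GenS by (auto simp: s_family_def intro!: assms(4) words_update words_nth[where r = r])
next
  case (GenE j)
  show ?thesis
    using assms(2,3) GenE
    by (auto simp: e_family_def intro!: sum.cong assms(4) words_update arg_cong[where f = "sU x" for x])
qed

lemma gen_family_linear:
  assumes "Vector_Spaces.linear sU sW F"
  shows "F (gen_family m sU g b w) = gen_family m sW g (\<lambda>w. F (b w)) w"
  by (cases g) (simp_all add: s_family_def e_family_def linear_uminus[OF assms] linear_scale[OF assms] linear_sum[OF assms])

definition put3 :: "nat \<Rightarrow> int list \<Rightarrow> int \<Rightarrow> int \<Rightarrow> int \<Rightarrow> int list" where
  "put3 p w x y z = w[p := x, Suc p := y, Suc (Suc p) := z]"

lemma put3_same: "Suc (Suc p) < length w \<Longrightarrow> w = put3 p w (w ! p) (w ! Suc p) (w ! Suc (Suc p))"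
  by (simp add: put3_def)

text \<open>
  The defining relations for families.  Those between neighbouring generators involve only three
  positions of a word, which \<open>put3\<close> makes explicit.
\<close>
locale family_relations = U: vector_space sU for sU :: "'k::field \<Rightarrow> 'u::ab_group_add \<Rightarrow> 'u" +
  fixes m :: nat
begin

abbreviation "Sf \<equiv> s_family :: nat \<Rightarrow> (int list \<Rightarrow> 'u) \<Rightarrow> int list \<Rightarrow> 'u"
abbreviation "Ef \<equiv> e_family m sU"

abbreviation turn :: "(int \<Rightarrow> 'u) \<Rightarrow> 'u" where
  "turn h \<equiv> (\<Sum>l\<in>alphabet m. sU (- of_int (sgn l)) (h l))"

text \<open>
  A cap followed by a cup with one strand in common straightens to a single strand.
\<close>
lemma turn_contract_left:
  assumes "z \<in> alphabet m"
  shows "turn (\<lambda>l. sU (pairing (- l) z) (h l)) = h z"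
proof -
  have "turn (\<lambda>l. sU (pairing (- l) z) (h l)) = (\<Sum>l\<in>alphabet m. if l = z then h z else 0)"
  proof (rule sum.cong[OF refl])
    fix l assume l: "l \<in> alphabet m"
    show "sU (- of_int (sgn l)) (sU (pairing (- l) z) (h l)) = (if l = z then h z else 0)"
    proof (cases "l = z")
      case True
      then show ?thesis using pairing_self[OF l, where 'k = 'k] by (simp add: pairing_def sgn_minus)
    qed (auto simp: pairing_def)
  qed
  then show ?thesis using assms by (simp add: sum.delta)
qed

lemma turn_contract_right:
  assumes "z \<in> alphabet m"
  shows "turn (\<lambda>l. sU (pairing z l) (h l)) = h (- z)"
proof -
  have "turn (\<lambda>l. sU (pairing z l) (h l)) = (\<Sum>l\<in>alphabet m. if l = - z then h (- z) else 0)"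
  proof (rule sum.cong[OF refl])
    fix l assume l: "l \<in> alphabet m"
    show "sU (- of_int (sgn l)) (sU (pairing z l) (h l)) = (if l = - z then h (- z) else 0)"
    proof (cases "l = - z")
      case True
      then show ?thesis using pairing_self[OF assms, where 'k = 'k] by (simp add: pairing_def sgn_minus)
    qed (auto simp: pairing_def)
  qed
  then show ?thesis using assms by (simp add: sum.delta)
qed

lemma turn_flip: "turn (\<lambda>l. - h (- l)) = turn h"
proof -
  have "turn h = (\<Sum>l\<in>alphabet m. sU (- of_int (sgn (- l))) (h (- l)))"
    by (rule sum_alphabet_uminus[symmetric])
  also have "\<dots> = turn (\<lambda>l. - h (- l))"
    by (intro sum.cong refl) (simp add: sgn_minus)
  finally show ?thesis by simp
qed

text \<open>
  A closed loop contributes \<open>- 2m\<close>: each of the \<open>2m\<close> letters counts \<open>-1\<close>.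
\<close>
lemma turn_loop: "turn (\<lambda>l. sU (pairing l (- l)) x) = sU (- of_nat (2 * m)) x"
proof -
  have "turn (\<lambda>l. sU (pairing l (- l)) x) = (\<Sum>l\<in>alphabet m. sU (- 1) x)"
  proof (rule sum.cong[OF refl])
    fix l assume l: "l \<in> alphabet m"
    then show "sU (- of_int (sgn l)) (sU (pairing l (- l)) x) = sU (- 1) x"
      using pairing_self[OF l, where 'k = 'k] by (simp add: pairing_def)
  qed
  also have "\<dots> = sU (- of_nat (2 * m)) x"
    by (simp add: card_alphabet U.sum_constant_scale)
  finally show ?thesis .
qed

lemma S_put3:
  assumes "Suc (Suc p) < length w"
  shows "Sf (Suc p) f (put3 p w x y z) = - f (put3 p w y x z)"
    and "Sf (Suc (Suc p)) f (put3 p w x y z) = - f (put3 p w x z y)"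
proof -
  have "(put3 p w x y z)[p := y, Suc p := x] = put3 p w y x z"
    "(put3 p w x y z)[Suc p := z, Suc (Suc p) := y] = put3 p w x z y"
    using assms by (auto intro!: nth_equalityI simp: put3_def nth_list_update)
  then show "Sf (Suc p) f (put3 p w x y z) = - f (put3 p w y x z)"
    and "Sf (Suc (Suc p)) f (put3 p w x y z) = - f (put3 p w x z y)"
    using assms by (simp_all add: s_family_def put3_def)
qed

lemma E_put3:
  assumes "Suc (Suc p) < length w"
  shows "Ef (Suc p) f (put3 p w x y z) = sU (pairing x y) (turn (\<lambda>l. f (put3 p w l (- l) z)))"
    and "Ef (Suc (Suc p)) f (put3 p w x y z) = sU (pairing y z) (turn (\<lambda>l. f (put3 p w x l (- l))))"
proof -
  have "(put3 p w x y z)[p := l, Suc p := - l] = put3 p w l (- l) z"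
    "(put3 p w x y z)[Suc p := l, Suc (Suc p) := - l] = put3 p w x l (- l)" for l
    using assms by (auto intro!: nth_equalityI simp: put3_def nth_list_update)
  then show "Ef (Suc p) f (put3 p w x y z) = sU (pairing x y) (turn (\<lambda>l. f (put3 p w l (- l) z)))"
    and "Ef (Suc (Suc p)) f (put3 p w x y z) = sU (pairing y z) (turn (\<lambda>l. f (put3 p w x l (- l))))"
    using assms by (simp_all add: e_family_def put3_def nth_list_update)
qed

lemma S_S:
  assumes "1 \<le> j" "j < length w"
  shows "Sf j (Sf j f) w = f w"
proof -
  have "w[j - 1 := w ! j, j := w ! (j - 1), j - 1 := w ! (j - 1), j := w ! j] = w"
    using assms by (intro nth_equalityI) (auto simp: nth_list_update)
  then show ?thesis using assms by (simp add: s_family_def nth_list_update del: One_nat_def)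
qed

lemma E_E:
  assumes "1 \<le> j" "j < length w"
  shows "Ef j (Ef j f) w = sU (- of_nat (2 * m)) (Ef j f w)"
proof -
  have upd: "w[j - 1 := l, j := - l, j - 1 := k, j := - k] = w[j - 1 := k, j := - k]" for l k
    using assms by (intro nth_equalityI) (auto simp: nth_list_update)
  have "Ef j (Ef j f) w = sU (pairing (w ! (j - 1)) (w ! j)) (turn (\<lambda>l. sU (pairing l (- l)) (turn (\<lambda>k. f (w[j - 1 := k, j := - k])))))"
    using assms by (simp add: e_family_def nth_list_update upd del: One_nat_def)
  then show ?thesis
    unfolding turn_loop by (simp add: e_family_def mult.commute)
qed

lemma E_S:
  assumes "1 \<le> j" "j < length w"
  shows "Ef j (Sf j f) w = Ef j f w"
proof -
  have upd: "w[j - 1 := l, j := - l, j - 1 := - l, j := l] = w[j - 1 := - l, j := - (- l)]" for l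
    using assms by (intro nth_equalityI) (auto simp: nth_list_update)
  have "Ef j (Sf j f) w = sU (pairing (w ! (j - 1)) (w ! j)) (turn (\<lambda>l. - f (w[j - 1 := - l, j := - (- l)])))"
    using assms by (simp only: e_family_def s_family_def) (simp add: nth_list_update upd del: One_nat_def)
  also have "\<dots> = Ef j f w"
    unfolding turn_flip[of "\<lambda>l. f (w[j - 1 := l, j := - l])"] by (simp add: e_family_def)
  finally show ?thesis .
qed

lemma S_E:
  assumes "1 \<le> j" "j < length w"
  shows "Sf j (Ef j f) w = Ef j f w"
proof -
  have upd: "w[j - 1 := w ! j, j := w ! (j - 1), j - 1 := l, j := - l] = w[j - 1 := l, j := - l]" for l
    using assms by (intro nth_equalityI) (auto simp: nth_list_update)
  have p: "pairing (w ! j) (w ! (j - 1)) = (- pairing (w ! (j - 1)) (w ! j) :: 'k)"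
    by (auto simp: pairing_def sgn_minus)
  show ?thesis using assms by (simp add: e_family_def s_family_def nth_list_update upd p del: One_nat_def)
qed

lemma S_S_far:
  assumes "1 \<le> i" "1 \<le> j" "i < length w" "j < length w" "i + 1 < j \<or> j + 1 < i"
  shows "Sf i (Sf j f) w = Sf j (Sf i f) w"
proof -
  have upd: "w[i - 1 := a, i := b, j - 1 := c, j := d] = w[j - 1 := c, j := d, i - 1 := a, i := b]" for a b c d
    using assms by (intro nth_equalityI) (auto simp: nth_list_update)
  show ?thesis using assms by (auto simp: s_family_def nth_list_update upd simp del: One_nat_def)
qed

lemma S_E_far:
  assumes "1 \<le> i" "1 \<le> j" "i < length w" "j < length w" "i + 1 < j \<or> j + 1 < i"
  shows "Sf i (Ef j f) w = Ef j (Sf i f) w"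
proof -
  have upd: "w[i - 1 := a, i := b, j - 1 := c, j := d] = w[j - 1 := c, j := d, i - 1 := a, i := b]" for a b c d
    using assms by (intro nth_equalityI) (auto simp: nth_list_update)
  have n1: "w[i - 1 := a, i := b] ! (j - 1) = w ! (j - 1)" "w[i - 1 := a, i := b] ! j = w ! j"
     "w[j - 1 := a, j := b] ! (i - 1) = w ! (i - 1)" "w[j - 1 := a, j := b] ! i = w ! i" for a b
    using assms by (auto simp: nth_list_update)
  show ?thesis
    unfolding s_family_def e_family_def n1 upd by (simp add: sum_negf)
qed

lemma E_E_far:
  assumes "1 \<le> i" "1 \<le> j" "i < length w" "j < length w" "i + 1 < j \<or> j + 1 < i"
  shows "Ef i (Ef j f) w = Ef j (Ef i f) w"
proof -
  have upd: "w[i - 1 := a, i := b, j - 1 := c, j := d] = w[j - 1 := c, j := d, i - 1 := a, i := b]" for a b c d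
    using assms by (intro nth_equalityI) (auto simp: nth_list_update)
  have n1: "w[i - 1 := a, i := b] ! (j - 1) = w ! (j - 1)" "w[i - 1 := a, i := b] ! j = w ! j"
     "w[j - 1 := a, j := b] ! (i - 1) = w ! (i - 1)" "w[j - 1 := a, j := b] ! i = w ! i" for a b
    using assms by (auto simp: nth_list_update)
  let ?x = "pairing (w ! (i - 1)) (w ! i) :: 'k" and ?y = "pairing (w ! (j - 1)) (w ! j) :: 'k"
  let ?h = "\<lambda>l k. f (w[j - 1 := k, j := - k, i - 1 := l, i := - l])"
  have "Ef i (Ef j f) w = (\<Sum>l\<in>alphabet m. \<Sum>k\<in>alphabet m. sU (?x * (?y * (of_int (sgn l) * of_int (sgn k)))) (?h l k))"
    unfolding e_family_def n1 upd by (simp add: U.scale_sum_right mult_ac)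
  also have "\<dots> = (\<Sum>k\<in>alphabet m. \<Sum>l\<in>alphabet m. sU (?x * (?y * (of_int (sgn l) * of_int (sgn k)))) (?h l k))"
    by (rule sum.swap)
  also have "\<dots> = Ef j (Ef i f) w"
    unfolding e_family_def n1 by (simp add: U.scale_sum_right mult_ac)
  finally show ?thesis .
qed

context
  fixes p :: nat and w :: "int list"
  assumes p: "Suc (Suc p) < length w"
begin

lemma braid_put3:
  "Sf (Suc p) (Sf (Suc (Suc p)) (Sf (Suc p) f)) (put3 p w x y z)
   = Sf (Suc (Suc p)) (Sf (Suc p) (Sf (Suc (Suc p)) f)) (put3 p w x y z)"
  by (simp add: S_put3[OF p])

lemma E_E_E_put3:
  assumes "x \<in> alphabet m" "z \<in> alphabet m"
  shows "Ef (Suc p) (Ef (Suc (Suc p)) (Ef (Suc p) f)) (put3 p w x y z) = Ef (Suc p) f (put3 p w x y z)"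
    and "Ef (Suc (Suc p)) (Ef (Suc p) (Ef (Suc (Suc p)) f)) (put3 p w x y z) = Ef (Suc (Suc p)) f (put3 p w x y z)"
  using assms by (simp_all only: E_put3[OF p] turn_contract_left turn_contract_right uminus_alphabet minus_minus)

lemma S_E_E_put3:
  assumes "x \<in> alphabet m" "y \<in> alphabet m" "z \<in> alphabet m"
  shows "Sf (Suc p) (Ef (Suc (Suc p)) (Ef (Suc p) f)) (put3 p w x y z) = Sf (Suc (Suc p)) (Ef (Suc p) f) (put3 p w x y z)"
  using assms by (simp only: S_put3[OF p] E_put3[OF p] turn_contract_left turn_contract_right uminus_alphabet minus_minus)

lemma E_E_S_put3:
  assumes "x \<in> alphabet m" "y \<in> alphabet m" "z \<in> alphabet m"
  shows "Ef (Suc (Suc p)) (Ef (Suc p) (Sf (Suc (Suc p)) f)) (put3 p w x y z) = Ef (Suc (Suc p)) (Sf (Suc p) f) (put3 p w x y z)"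
  using assms by (simp only: S_put3[OF p] E_put3[OF p] turn_contract_left turn_contract_right uminus_alphabet minus_minus)

end

end

context symplectic_tensor
begin

lemma index_words:
  assumes "set is \<subseteq> {1..2*m}" "length is = n"
  shows "map index (map letter is) = is" "map letter is \<in> words m n"
  using assms index_letter letter_range by (auto simp: words_def intro!: map_idI)

lemma words_index: "w \<in> words m n \<Longrightarrow> length (map index w) = n \<and> set (map index w) \<subseteq> {1..2*m}"
  using index_range by (auto simp: words_def)

lemma basis_tensor_index: "\<tau> (map v (map index w)) = basis_tensor w"
  by (simp add: basis_tensor_def vec_def[abs_def] o_def)

lemma unique_basis_map:
  "\<exists>!F. Vector_Spaces.linear sT sT F \<and> (\<forall>w\<in>words m n. F (basis_tensor w) = g w)"
proof -
  obtain F where F: "Vector_Spaces.linear sT sT F" "\<forall>w\<in>words m n. F (basis_tensor w) = g w"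
    using linear_extension[OF vsT, of g] by blast
  show ?thesis
  proof (rule ex1I[of _ F])
    fix G assume G: "Vector_Spaces.linear sT sT G \<and> (\<forall>w\<in>words m n. G (basis_tensor w) = g w)"
    show "G = F" using F G by (intro linear_eq_words[of sT G F]) auto
  qed (use F in blast)
qed

lemma ball_index_words:
  "(\<forall>is. length is = n \<and> set is \<subseteq> {1..2*m} \<longrightarrow> P is) \<longleftrightarrow> (\<forall>w\<in>words m n. P (map index w))"
  using index_words words_index by metis

lemma s_op:
  assumes j: "1 \<le> j" "j < n"
  shows "Vector_Spaces.linear sT sT (s_op m n v sT \<tau> j)"
    and "w \<in> words m n \<Longrightarrow> s_op m n v sT \<tau> j (basis_tensor w) = s_family j basis_tensor w"
proof -
  have eq: "- \<tau> (map v (put2 j (map index w ! j) (map index w ! (j - 1)) (map index w))) = s_family j basis_tensor w"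
    if "w \<in> words m n" for w
  proof -
    have "put2 j (map index w ! j) (map index w ! (j - 1)) (map index w) = map index (w[j - 1 := w ! j, j := w ! (j - 1)])"
      using that j by (simp add: put2_def map_update words_def)
    then show ?thesis using basis_tensor_index by (simp add: s_family_def)
  qed
  have "s_op m n v sT \<tau> j = (THE F. Vector_Spaces.linear sT sT F \<and> (\<forall>w\<in>words m n. F (basis_tensor w) = s_family j basis_tensor w))"
    unfolding s_op_def ball_index_words basis_tensor_index using eq by (simp cong: ball_cong)
  with theI'[OF unique_basis_map, of "s_family j basis_tensor"]
  show "Vector_Spaces.linear sT sT (s_op m n v sT \<tau> j)"
    and "w \<in> words m n \<Longrightarrow> s_op m n v sT \<tau> j (basis_tensor w) = s_family j basis_tensor w"
    by simp_all
qed

lemma eps_index: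
  assumes "a \<in> alphabet m" "b \<in> alphabet m"
  shows "eps m (index a) (index b) = (pairing a b :: 'k)"
proof (cases "b = - a")
  case True
  then show ?thesis
  proof -
    have a: "a \<noteq> 0" "\<bar>a\<bar> \<le> int m" using assms(1) by (auto simp: alphabet_def)
    have i: "index a = (if a > 0 then nat a else nat (a + 2 * int m + 1))"
      "index (- a) = (if - a > 0 then nat (- a) else nat (- a + 2 * int m + 1))"
      using assms(1) by (simp_all add: index_eq)
    have "index a < index (- a) \<longleftrightarrow> a > 0" "index (- a) < index a \<longleftrightarrow> \<not> a > 0"
      unfolding i using a by auto
    then show ?thesis using True a prime_index[OF assms(1)] by (simp add: eps_def pairing_def sgn_if)
  qed
next
  case False
  then have "index b \<noteq> index (- a)"
    using assms letter_index[of b] letter_index[of "- a"] by auto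
  then show ?thesis using assms False by (simp add: eps_def prime_index pairing_def)
qed

lemma e_op:
  assumes j: "1 \<le> j" "j < n"
  shows "Vector_Spaces.linear sT sT (e_op m n v sT \<tau> j)"
    and "w \<in> words m n \<Longrightarrow> e_op m n v sT \<tau> j (basis_tensor w) = e_family m sT j basis_tensor w"
proof -
  have eq: "sT (eps m (map index w ! (j - 1)) (map index w ! j))
               (\<Sum>k=1..m. \<tau> (map v (put2 j (prime_index m k) k (map index w)))
                        - \<tau> (map v (put2 j k (prime_index m k) (map index w))))
      = e_family m sT j basis_tensor w"
    if w: "w \<in> words m n" for w
  proof -
    have k: "put2 j (prime_index m k) k (map index w) = map index (w[j - 1 := - int k, j := int k])"
      "put2 j k (prime_index m k) (map index w) = map index (w[j - 1 := int k, j := - int k])" if "k \<in> {1..m}" for k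
    proof -
      have "int k \<in> alphabet m" using that by (auto simp: alphabet_def)
      then have "index (int k) = k" "index (- int k) = prime_index m k"
        using prime_index[of "int k"] that by (auto simp: index_eq)
      then show "put2 j (prime_index m k) k (map index w) = map index (w[j - 1 := - int k, j := int k])"
        "put2 j k (prime_index m k) (map index w) = map index (w[j - 1 := int k, j := - int k])"
        by (simp_all add: put2_def map_update)
    qed
    have "(\<Sum>k=1..m. \<tau> (map v (put2 j (prime_index m k) k (map index w)))
                        - \<tau> (map v (put2 j k (prime_index m k) (map index w))))
        = (\<Sum>k=1..m. basis_tensor (w[j - 1 := - int k, j := int k]) - basis_tensor (w[j - 1 := int k, j := - int k]))"
      by (intro sum.cong refl) (simp only: k basis_tensor_index)
    also have "\<dots> = (\<Sum>l\<in>alphabet m. sT (- of_int (sgn l)) (basis_tensor (w[j - 1 := l, j := - l])))"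
      unfolding sum_alphabet by (intro sum.cong refl) auto
    finally show ?thesis
      using w j words_nth[OF w, of j] words_nth[OF w, of "j - 1"]
      by (simp add: e_family_def eps_index words_def)
  qed
  have "e_op m n v sT \<tau> j = (THE F. Vector_Spaces.linear sT sT F \<and> (\<forall>w\<in>words m n. F (basis_tensor w) = e_family m sT j basis_tensor w))"
    unfolding e_op_def ball_index_words basis_tensor_index using eq by (simp cong: ball_cong)
  with theI'[OF unique_basis_map, of "e_family m sT j basis_tensor"]
  show "Vector_Spaces.linear sT sT (e_op m n v sT \<tau> j)"
    and "w \<in> words m n \<Longrightarrow> e_op m n v sT \<tau> j (basis_tensor w) = e_family m sT j basis_tensor w"
    by simp_all
qed

abbreviation "gop \<equiv> gen_op m n v sT \<tau>"

lemma gen_op_linear: "g \<in> brauer_gens n \<Longrightarrow> Vector_Spaces.linear sT sT (gop g)"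
  using s_op(1) e_op(1) by (cases g) (auto simp: brauer_gens_def)

lemma gen_op_basis: "g \<in> brauer_gens n \<Longrightarrow> w \<in> words m n \<Longrightarrow> gop g (basis_tensor w) = gen_family m sT g basis_tensor w"
  using s_op(2) e_op(2) by (cases g) (auto simp: brauer_gens_def)

lemma fold_gen_op_linear:
  "set gs \<subseteq> brauer_gens n \<Longrightarrow> Vector_Spaces.linear sT sT (fold gop gs)"
proof (induction gs)
  case Nil
  show ?case by (simp add: id_def linearI vsT)
next
  case (Cons g gs)
  then show ?case
    unfolding fold.simps(2) by (intro Vector_Spaces.linear_compose[OF gen_op_linear]) auto
qed

lemma fold_gen_op_basis:
  "set gs \<subseteq> brauer_gens n \<Longrightarrow> w \<in> words m n \<Longrightarrow> fold gop gs (basis_tensor w) = word_family m sT gs basis_tensor w"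
proof (induction gs arbitrary: w)
  case (Cons g gs)
  have "fold gop (g # gs) (basis_tensor w) = gen_family m sT g (\<lambda>w. fold gop gs (basis_tensor w)) w"
    using Cons.prems gen_family_linear[OF fold_gen_op_linear[of gs]] by (simp add: gen_op_basis)
  also have "\<dots> = gen_family m sT g (word_family m sT gs basis_tensor) w"
    using Cons by (intro gen_family_cong[of g n w m n]) auto
  finally show ?case by simp
qed simp

end

section \<open>The presented algebra\<close>

lemma letters_plus [simp]: "letters (u + w) = letters u @ letters w" "letters 0 = []"
  by (simp_all add: plus_word_def zero_word_def)

lemma monomial_mult: "monomial c u * monomial d w = monomial (c * d) (u @ w)"
  by (simp add: monomial_def mult_single plus_word_def)

lemma monomial_one: "monomial 1 [] = 1"
  by (simp add: monomial_def single_one flip: zero_word_def)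

lemma monomial_add: "monomial (c + d) u = monomial c u + monomial d u"
  by (simp add: monomial_def single_add)

lemma monomial_zero [simp]: "monomial 0 u = 0"
  by (simp add: monomial_def)

lemma sum_monomials: "p = (\<Sum>w\<in>Poly_Mapping.keys p. monomial (Poly_Mapping.lookup p w) (letters w))"
proof (rule poly_mapping_eqI)
  fix u
  have "Poly_Mapping.lookup (\<Sum>w\<in>Poly_Mapping.keys p. monomial (Poly_Mapping.lookup p w) (letters w)) u
      = (\<Sum>w\<in>Poly_Mapping.keys p. if w = u then Poly_Mapping.lookup p u else 0)"
    by (auto simp: lookup_sum monomial_def lookup_single when_def intro!: sum.cong)
  then show "Poly_Mapping.lookup p u = Poly_Mapping.lookup (\<Sum>w\<in>Poly_Mapping.keys p. monomial (Poly_Mapping.lookup p w) (letters w)) u"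
    by (simp add: sum.delta in_keys_iff)
qed

definition free_carrier :: "'g set \<Rightarrow> ('g word \<Rightarrow>\<^sub>0 'k::field) set" where
  "free_carrier X = carrier (free_alg X)"

lemma free_carrier_iff: "p \<in> free_carrier X \<longleftrightarrow> (\<forall>w\<in>Poly_Mapping.keys p. set (letters w) \<subseteq> X)"
  by (simp add: free_carrier_def free_alg_def)

lemma free_carrier_closed [simp]:
  shows "0 \<in> free_carrier X" "1 \<in> free_carrier X"
    and "p \<in> free_carrier X \<Longrightarrow> q \<in> free_carrier X \<Longrightarrow> p + q \<in> free_carrier X"
    and "p \<in> free_carrier X \<Longrightarrow> q \<in> free_carrier X \<Longrightarrow> p * q \<in> free_carrier X"
    and "p \<in> free_carrier X \<Longrightarrow> - p \<in> free_carrier X"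
    and "set u \<subseteq> X \<Longrightarrow> monomial c u \<in> free_carrier X"
proof -
  show "0 \<in> free_carrier X" by (simp add: free_carrier_iff)
  show "1 \<in> free_carrier X"
    unfolding free_carrier_iff monomial_one[symmetric] by (auto simp: monomial_def)
  show "p + q \<in> free_carrier X" if "p \<in> free_carrier X" "q \<in> free_carrier X"
    using that Poly_Mapping.keys_add[of p q] unfolding free_carrier_iff by blast
  show "p * q \<in> free_carrier X" if "p \<in> free_carrier X" "q \<in> free_carrier X"
    unfolding free_carrier_iff
  proof
    fix w assume "w \<in> Poly_Mapping.keys (p * q)"
    then obtain a b where "w = a + b" "a \<in> Poly_Mapping.keys p" "b \<in> Poly_Mapping.keys q"
      using keys_mult[of p q] by blast
    then show "set (letters w) \<subseteq> X" using that by (simp add: free_carrier_iff)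
  qed
  show "- p \<in> free_carrier X" if "p \<in> free_carrier X"
    using that by (simp add: free_carrier_iff)
  show "monomial c u \<in> free_carrier X" if "set u \<subseteq> X"
    using that by (simp add: free_carrier_iff monomial_def)
qed

lemma free_carrier_diff [simp]: "p \<in> free_carrier X \<Longrightarrow> q \<in> free_carrier X \<Longrightarrow> p - q \<in> free_carrier X"
  using free_carrier_closed(3)[of p X "- q"] by simp

lemma free_carrier_sum: "(\<And>i. i \<in> I \<Longrightarrow> p i \<in> free_carrier X) \<Longrightarrow> sum p I \<in> free_carrier X"
  by (induction I rule: infinite_finite_induct) auto

lemma free_alg_simps [simp]:
  "carrier (free_alg X) = free_carrier X" "p \<otimes>\<^bsub>free_alg X\<^esub> q = p * q" "p \<oplus>\<^bsub>free_alg X\<^esub> q = p + q"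
  "\<one>\<^bsub>free_alg X\<^esub> = 1" "\<zero>\<^bsub>free_alg X\<^esub> = 0"
  by (simp_all add: free_carrier_def) (simp_all add: free_alg_def)

lemma ring_free_alg: "ring (free_alg X :: ('g word \<Rightarrow>\<^sub>0 'k::field) ring)"
proof (rule ringI)
  show "abelian_group (free_alg X :: ('g word \<Rightarrow>\<^sub>0 'k) ring)"
  proof (rule abelian_groupI)
    fix p :: "'g word \<Rightarrow>\<^sub>0 'k" assume "p \<in> carrier (free_alg X)"
    then show "\<exists>y\<in>carrier (free_alg X). y \<oplus>\<^bsub>free_alg X\<^esub> p = \<zero>\<^bsub>free_alg X\<^esub>"
      by (intro bexI[of _ "- p"]) auto
  qed (auto simp: ac_simps)
  show "Group.monoid (free_alg X :: ('g word \<Rightarrow>\<^sub>0 'k) ring)"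
    by (rule Group.monoidI) (auto simp: mult.assoc)
qed (auto simp: algebra_simps)

locale brauer_presentation =
  fixes n :: nat and x :: "'k::field"
begin

abbreviation "F \<equiv> free_alg (brauer_gens n) :: (brauer_gen word \<Rightarrow>\<^sub>0 'k) ring"
abbreviation "C \<equiv> free_carrier (brauer_gens n) :: (brauer_gen word \<Rightarrow>\<^sub>0 'k) set"
abbreviation "I \<equiv> brauer_ideal n x"
abbreviation "Q \<equiv> F Quot I"
abbreviation M :: "brauer_gen list \<Rightarrow> brauer_gen word \<Rightarrow>\<^sub>0 'k" where "M \<equiv> monomial 1"
abbreviation "coset p \<equiv> I +>\<^bsub>F\<^esub> p"

lemma gens [simp]: "GenS i \<in> brauer_gens n \<longleftrightarrow> 1 \<le> i \<and> i < n" "GenE i \<in> brauer_gens n \<longleftrightarrow> 1 \<le> i \<and> i < n"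
  by (auto simp: brauer_gens_def)

lemma relators_carrier: "brauer_relators n x \<subseteq> C"
  unfolding brauer_relators_def Let_def by auto

interpretation F: ring F by (rule ring_free_alg)

lemma ideal: "ideal I F"
  unfolding brauer_ideal_def by (rule F.genideal_ideal) (simp add: relators_carrier)

interpretation I: ideal I F by (rule ideal)

lemma relators_ideal: "brauer_relators n x \<subseteq> I"
  unfolding brauer_ideal_def by (rule F.genideal_self) (simp add: relators_carrier)

lemma ideal_zero: "0 \<in> I"
  using I.zero_closed by simp

lemma ideal_add: "p \<in> I \<Longrightarrow> q \<in> I \<Longrightarrow> p + q \<in> I"
  using I.a_closed[of p q] by simp

lemma ideal_mult: "p \<in> I \<Longrightarrow> q \<in> C \<Longrightarrow> q * p \<in> I" "p \<in> I \<Longrightarrow> q \<in> C \<Longrightarrow> p * q \<in> I"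
  using I.I_l_closed[of p q] I.I_r_closed[of p q] by auto

lemma ideal_uminus: "p \<in> I \<Longrightarrow> - p \<in> I"
  using ideal_mult(1)[of p "- 1"] by simp

lemma ideal_diff: "p \<in> I \<Longrightarrow> q \<in> I \<Longrightarrow> p - q \<in> I"
  using ideal_add[of p "- q"] ideal_uminus[of q] by simp

lemma coset_eq: "coset p = {i + p | i. i \<in> I}"
  by (auto simp: a_r_coset_def')

lemma coset_eq_iff: "coset p = coset q \<longleftrightarrow> p - q \<in> I"
proof
  assume "coset p = coset q"
  then have "p \<in> {i + q | i. i \<in> I}" using ideal_zero unfolding coset_eq by force
  then show "p - q \<in> I" by auto
next
  assume pq: "p - q \<in> I"
  have "\<exists>j. i + p = j + q \<and> j \<in> I" if "i \<in> I" for i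
    using ideal_add[OF that pq] by (intro exI[of _ "i + (p - q)"]) simp
  moreover have "\<exists>j. i + q = j + p \<and> j \<in> I" if "i \<in> I" for i
    using ideal_diff[OF that pq] by (intro exI[of _ "i - (p - q)"]) simp
  ultimately
  show "coset p = coset q" unfolding coset_eq by auto
qed

lemma carrier_Q: "carrier Q = coset ` C"
  unfolding FactRing_def A_RCOSETS_def' by auto

lemma coset_mult: "p \<in> C \<Longrightarrow> q \<in> C \<Longrightarrow> coset p \<otimes>\<^bsub>Q\<^esub> coset q = coset (p * q)"
  using ring_hom_mult[OF I.rcos_ring_hom, of p q] by simp

lemma coset_add: "p \<in> C \<Longrightarrow> q \<in> C \<Longrightarrow> coset p \<oplus>\<^bsub>Q\<^esub> coset q = coset (p + q)"
  using ring_hom_add[OF I.rcos_ring_hom, of p q] by simp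

lemma coset_one: "\<one>\<^bsub>Q\<^esub> = coset 1"
  using ring_hom_one[OF I.rcos_ring_hom] by simp

text \<open>
  Right multiplication by the class of \<open>p\<close>.  It is extended by the identity outside of the quotient,
  so that the multiplications form a monoid of functions on a whole type.
\<close>
definition rmul :: "(brauer_gen word \<Rightarrow>\<^sub>0 'k) \<Rightarrow> (brauer_gen word \<Rightarrow>\<^sub>0 'k) set \<Rightarrow> (brauer_gen word \<Rightarrow>\<^sub>0 'k) set" where
  "rmul p X = (if X \<in> carrier Q then X \<otimes>\<^bsub>Q\<^esub> coset p else X)"

lemma rmul_coset: "q \<in> C \<Longrightarrow> p \<in> C \<Longrightarrow> rmul p (coset q) = coset (q * p)"
  by (simp add: rmul_def carrier_Q coset_mult)

lemma rmul_comp: "p \<in> C \<Longrightarrow> q \<in> C \<Longrightarrow> rmul q \<circ> rmul p = rmul (p * q)"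
proof
  fix X assume pq: "p \<in> C" "q \<in> C"
  show "(rmul q \<circ> rmul p) X = rmul (p * q) X"
  proof (cases "X \<in> carrier Q")
    case True
    then obtain r where "X = coset r" "r \<in> C" by (auto simp: carrier_Q)
    then show ?thesis using pq by (simp add: rmul_coset mult.assoc)
  qed (simp add: rmul_def)
qed

lemma rmul_one: "rmul 1 = id"
proof
  fix X show "rmul 1 X = id X"
  proof (cases "X \<in> carrier Q")
    case True
    then show ?thesis by (auto simp: carrier_Q rmul_coset)
  qed (simp add: rmul_def)
qed

lemma rmul_eq: "p \<in> C \<Longrightarrow> q \<in> C \<Longrightarrow> p - q \<in> I \<Longrightarrow> rmul p = rmul q"
  unfolding coset_eq_iff[symmetric] by (simp only: rmul_def[abs_def])

lemma rmul_inject: "p \<in> C \<Longrightarrow> q \<in> C \<Longrightarrow> rmul p = rmul q \<Longrightarrow> p - q \<in> I"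
proof -
  assume p: "p \<in> C" and q: "q \<in> C" and eq: "rmul p = rmul q"
  have "coset p = rmul p (coset 1)" using p by (simp add: rmul_coset)
  also have "\<dots> = coset q" unfolding eq using q by (simp add: rmul_coset)
  finally show ?thesis by (simp only: coset_eq_iff)
qed

lemma relator:
  "1 \<le> i \<Longrightarrow> i < n \<Longrightarrow> M [GenS i, GenS i] - 1 \<in> I"
  "1 \<le> i \<Longrightarrow> i < n \<Longrightarrow> M [GenE i, GenE i] - monomial x [GenE i] \<in> I"
  "1 \<le> i \<Longrightarrow> i < n \<Longrightarrow> M [GenE i, GenS i] - M [GenE i] \<in> I"
  "1 \<le> i \<Longrightarrow> i < n \<Longrightarrow> M [GenS i, GenE i] - M [GenE i] \<in> I"
  "1 \<le> i \<Longrightarrow> i < n \<Longrightarrow> 1 \<le> j \<Longrightarrow> j < n \<Longrightarrow> i + 1 < j \<or> j + 1 < i \<Longrightarrow> M [GenS i, GenS j] - M [GenS j, GenS i] \<in> I"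
  "1 \<le> i \<Longrightarrow> i < n \<Longrightarrow> 1 \<le> j \<Longrightarrow> j < n \<Longrightarrow> i + 1 < j \<or> j + 1 < i \<Longrightarrow> M [GenS i, GenE j] - M [GenE j, GenS i] \<in> I"
  "1 \<le> i \<Longrightarrow> i < n \<Longrightarrow> 1 \<le> j \<Longrightarrow> j < n \<Longrightarrow> i + 1 < j \<or> j + 1 < i \<Longrightarrow> M [GenE i, GenE j] - M [GenE j, GenE i] \<in> I"
  "1 \<le> i \<Longrightarrow> Suc i < n \<Longrightarrow> M [GenS i, GenS (Suc i), GenS i] - M [GenS (Suc i), GenS i, GenS (Suc i)] \<in> I"
  "1 \<le> i \<Longrightarrow> Suc i < n \<Longrightarrow> M [GenS i, GenE (Suc i), GenE i] - M [GenS (Suc i), GenE i] \<in> I"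
  "1 \<le> i \<Longrightarrow> Suc i < n \<Longrightarrow> M [GenE (Suc i), GenE i, GenS (Suc i)] - M [GenE (Suc i), GenS i] \<in> I"
proof -
  have one: "r \<in> I" if "1 \<le> i" "i < n"
    "r \<in> {M [GenS i, GenS i] - 1, M [GenE i, GenE i] - monomial x [GenE i],
          M [GenE i, GenS i] - M [GenE i], M [GenS i, GenE i] - M [GenE i]}" for r i
    using that by (intro subsetD[OF relators_ideal], unfold brauer_relators_def Let_def) blast
  have far: "r \<in> I" if "1 \<le> i" "i < n" "1 \<le> j" "j < n" "i + 1 < j \<or> j + 1 < i"
    "r \<in> {M [GenS i, GenS j] - M [GenS j, GenS i], M [GenS i, GenE j] - M [GenE j, GenS i],
          M [GenE i, GenE j] - M [GenE j, GenE i]}" for r i j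
    using that by (intro subsetD[OF relators_ideal], unfold brauer_relators_def Let_def) blast
  have near: "r \<in> I" if "1 \<le> i" "i + 1 < n"
    "r \<in> {M [GenS i, GenS (i+1), GenS i] - M [GenS (i+1), GenS i, GenS (i+1)],
          M [GenE i, GenE (i+1), GenE i] - M [GenE i],
          M [GenE (i+1), GenE i, GenE (i+1)] - M [GenE (i+1)],
          M [GenS i, GenE (i+1), GenE i] - M [GenS (i+1), GenE i],
          M [GenE (i+1), GenE i, GenS (i+1)] - M [GenE (i+1), GenS i]}" for r i
    using that by (intro subsetD[OF relators_ideal], unfold brauer_relators_def Let_def) blast
  show "1 \<le> i \<Longrightarrow> i < n \<Longrightarrow> M [GenS i, GenS i] - 1 \<in> I"
    "1 \<le> i \<Longrightarrow> i < n \<Longrightarrow> M [GenE i, GenE i] - monomial x [GenE i] \<in> I"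
    "1 \<le> i \<Longrightarrow> i < n \<Longrightarrow> M [GenE i, GenS i] - M [GenE i] \<in> I"
    "1 \<le> i \<Longrightarrow> i < n \<Longrightarrow> M [GenS i, GenE i] - M [GenE i] \<in> I"
    by (rule one[of i]; blast)+
  show "1 \<le> i \<Longrightarrow> i < n \<Longrightarrow> 1 \<le> j \<Longrightarrow> j < n \<Longrightarrow> i + 1 < j \<or> j + 1 < i \<Longrightarrow> M [GenS i, GenS j] - M [GenS j, GenS i] \<in> I"
    "1 \<le> i \<Longrightarrow> i < n \<Longrightarrow> 1 \<le> j \<Longrightarrow> j < n \<Longrightarrow> i + 1 < j \<or> j + 1 < i \<Longrightarrow> M [GenS i, GenE j] - M [GenE j, GenS i] \<in> I"
    "1 \<le> i \<Longrightarrow> i < n \<Longrightarrow> 1 \<le> j \<Longrightarrow> j < n \<Longrightarrow> i + 1 < j \<or> j + 1 < i \<Longrightarrow> M [GenE i, GenE j] - M [GenE j, GenE i] \<in> I"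
    by (rule far[of i j]; blast)+
  show "1 \<le> i \<Longrightarrow> Suc i < n \<Longrightarrow> M [GenS i, GenS (Suc i), GenS i] - M [GenS (Suc i), GenS i, GenS (Suc i)] \<in> I"
    "1 \<le> i \<Longrightarrow> Suc i < n \<Longrightarrow> M [GenS i, GenE (Suc i), GenE i] - M [GenS (Suc i), GenE i] \<in> I"
    "1 \<le> i \<Longrightarrow> Suc i < n \<Longrightarrow> M [GenE (Suc i), GenE i, GenS (Suc i)] - M [GenE (Suc i), GenS i] \<in> I"
    using near[of i] by auto
qed

lemma M_mult: "M u * M w = M (u @ w)"
  by (simp add: monomial_mult)

sublocale brauer_monoid "\<lambda>f g. g \<circ> f" id "\<lambda>i. rmul (M [GenS i])" "\<lambda>i. rmul (M [GenE i])" "rmul (monomial x [])" n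
proof
  have two: "rmul (M [h]) \<circ> rmul (M [g]) = rmul (M [g, h])" if "set [g, h] \<subseteq> brauer_gens n" for g h
    using that by (subst rmul_comp) (auto simp: M_mult)
  have scalar: "rmul (M [g]) \<circ> rmul (monomial x []) = rmul (monomial x [g])"
      "rmul (monomial x []) \<circ> rmul (M [g]) = rmul (monomial x [g])" if "g \<in> brauer_gens n" for g
    using that by (simp_all add: rmul_comp monomial_mult)
  fix i assume i: "1 \<le> i" "i < n"
  show "rmul (M [GenS i]) \<circ> rmul (M [GenS i]) = id"
  proof -
    have "rmul (M [GenS i, GenS i]) = rmul 1" using i relator(1)[OF i] by (intro rmul_eq) auto
    then show ?thesis using i by (simp add: two rmul_one)
  qed
  show "rmul (M [GenE i]) \<circ> rmul (M [GenE i]) = rmul (M [GenE i]) \<circ> rmul (monomial x [])"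
    using i by (subst two, simp, subst scalar) (auto intro!: rmul_eq relator(2))
  show "rmul (M [GenS i]) \<circ> rmul (M [GenE i]) = rmul (M [GenE i])"
    using i by (subst two) (auto intro!: rmul_eq relator(3))
  show "rmul (M [GenE i]) \<circ> rmul (M [GenS i]) = rmul (M [GenE i])"
    using i by (subst two) (auto intro!: rmul_eq relator(4))
  show "rmul (M [GenS i]) \<circ> rmul (monomial x []) = rmul (monomial x []) \<circ> rmul (M [GenS i])"
    "rmul (M [GenE i]) \<circ> rmul (monomial x []) = rmul (monomial x []) \<circ> rmul (M [GenE i])"
    using i by (simp_all add: scalar)
  {
    fix j assume j: "1 \<le> j" "j < n" "i + 1 < j \<or> j + 1 < i"
    show "rmul (M [GenS j]) \<circ> rmul (M [GenS i]) = rmul (M [GenS i]) \<circ> rmul (M [GenS j])"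
      "rmul (M [GenE j]) \<circ> rmul (M [GenS i]) = rmul (M [GenS i]) \<circ> rmul (M [GenE j])"
      "rmul (M [GenE j]) \<circ> rmul (M [GenE i]) = rmul (M [GenE i]) \<circ> rmul (M [GenE j])"
      using i j relator(5-7)[OF i j] by (simp_all add: two rmul_eq)
  }
next
  have two: "rmul (M [h]) \<circ> rmul (M [g]) = rmul (M [g, h])" if "set [g, h] \<subseteq> brauer_gens n" for g h
    using that by (subst rmul_comp) (auto simp: M_mult)
  have three: "rmul (M [k]) \<circ> (rmul (M [h]) \<circ> rmul (M [g])) = rmul (M [g, h, k])" if "set [g, h, k] \<subseteq> brauer_gens n" for g h k
    using that by (simp add: rmul_comp M_mult)
  fix i assume i: "1 \<le> i" "Suc i < n"
  have g: "GenS i \<in> brauer_gens n" "GenS (Suc i) \<in> brauer_gens n" "GenE i \<in> brauer_gens n" "GenE (Suc i) \<in> brauer_gens n"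
    using i by auto
  have r: "rmul (M [GenS i, GenS (Suc i), GenS i]) = rmul (M [GenS (Suc i), GenS i, GenS (Suc i)])"
    "rmul (M [GenS i, GenE (Suc i), GenE i]) = rmul (M [GenS (Suc i), GenE i])"
    "rmul (M [GenE (Suc i), GenE i, GenS (Suc i)]) = rmul (M [GenE (Suc i), GenS i])"
    using relator(8-10)[OF i] g by (auto intro!: rmul_eq)
  have "rmul (M [GenS i]) \<circ> (rmul (M [GenS (Suc i)]) \<circ> rmul (M [GenS i])) = rmul (M [GenS i, GenS (Suc i), GenS i])"
    "rmul (M [GenS (Suc i)]) \<circ> (rmul (M [GenS i]) \<circ> rmul (M [GenS (Suc i)])) = rmul (M [GenS (Suc i), GenS i, GenS (Suc i)])"
    "rmul (M [GenE i]) \<circ> (rmul (M [GenE (Suc i)]) \<circ> rmul (M [GenS i])) = rmul (M [GenS i, GenE (Suc i), GenE i])"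
    "rmul (M [GenS (Suc i)]) \<circ> (rmul (M [GenE i]) \<circ> rmul (M [GenE (Suc i)])) = rmul (M [GenE (Suc i), GenE i, GenS (Suc i)])"
    using g by (auto intro!: three)
  moreover have "rmul (M [GenE i]) \<circ> rmul (M [GenS (Suc i)]) = rmul (M [GenS (Suc i), GenE i])"
    "rmul (M [GenS i]) \<circ> rmul (M [GenE (Suc i)]) = rmul (M [GenE (Suc i), GenS i])"
    using g by (auto intro!: two)
  ultimately show "rmul (M [GenS i]) \<circ> (rmul (M [GenS (Suc i)]) \<circ> rmul (M [GenS i]))
      = rmul (M [GenS (Suc i)]) \<circ> (rmul (M [GenS i]) \<circ> rmul (M [GenS (Suc i)]))"
    "rmul (M [GenE i]) \<circ> (rmul (M [GenE (Suc i)]) \<circ> rmul (M [GenS i])) = rmul (M [GenE i]) \<circ> rmul (M [GenS (Suc i)])"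
    "rmul (M [GenS (Suc i)]) \<circ> (rmul (M [GenE i]) \<circ> rmul (M [GenE (Suc i)])) = rmul (M [GenS i]) \<circ> rmul (M [GenE (Suc i)])"
    using r by simp_all
qed (auto simp: o_assoc)

lemma word_products: "set u \<subseteq> brauer_gens n \<Longrightarrow> rmul (M u) \<in> products"
proof (induction u rule: rev_induct)
  case Nil
  show ?case unfolding monomial_one rmul_one by (rule products.intros(1))
next
  case (snoc g u)
  have IH: "rmul (M u) \<in> products" by (rule snoc.IH) (use snoc.prems in simp)
  have "rmul (M [g]) \<circ> rmul (M u) = rmul (M (u @ [g]))"
    using snoc.prems by (subst rmul_comp) (auto simp: M_mult)
  moreover have "rmul (M [g]) \<circ> rmul (M u) \<in> products"
  proof (cases g)
    case (GenS j)
    have j: "1 \<le> j" "j < n" using snoc.prems GenS by auto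
    show ?thesis unfolding GenS by (rule products.intros(2)[OF IH j])
  next
    case (GenE j)
    have j: "1 \<le> j" "j < n" using snoc.prems GenE by auto
    show ?thesis unfolding GenE by (rule products.intros(3)[OF IH j])
  qed
  ultimately show ?case by (simp only:)
qed

text \<open>
  The Brauer algebra is spanned by as many elements as there are perfect matchings of \<open>2n\<close>
  points, namely by representatives of the normal forms; the central element \<open>z\<close> becomes the scalar
  \<open>x\<close>.
\<close>
theorem brauer_spanning_set:
  "\<exists>Y. finite Y \<and> card Y \<le> num_matchings n \<and> Y \<subseteq> C \<and>
     (\<forall>p\<in>C. \<exists>c. p - (\<Sum>q\<in>Y. monomial (c q) [] * q) \<in> I)"
proof -
  have "\<exists>q\<in>C. y = rmul q" if "y \<in> normal_forms" for y
  proof (rule normal_forms_closed[of "\<lambda>y. \<exists>q\<in>C. y = rmul q", OF _ _ _ _ that])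
    show "\<exists>q\<in>C. id = rmul q" using rmul_one by (intro bexI[of _ 1]) auto
    fix i assume "1 \<le> i" "i < n"
    then show "\<exists>q\<in>C. rmul (M [GenS i]) = rmul q" "\<exists>q\<in>C. rmul (M [GenE i]) = rmul q"
      by auto
  next
    fix f g assume "\<exists>q\<in>C. f = rmul q" "\<exists>q\<in>C. g = rmul q"
    then obtain p q where "p \<in> C" "q \<in> C" "f = rmul p" "g = rmul q" by blast
    then show "\<exists>q\<in>C. g \<circ> f = rmul q" by (intro bexI[of _ "p * q"]) (simp_all add: rmul_comp)
  qed
  then have "\<forall>y\<in>normal_forms. \<exists>q. q \<in> C \<and> y = rmul q" by blast
  from bchoice[OF this] obtain r where r: "\<And>y. y \<in> normal_forms \<Longrightarrow> r y \<in> C \<and> y = rmul (r y)" by blast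
  define Y where "Y = r ` normal_forms"
  have Y: "finite Y" "card Y \<le> num_matchings n" "Y \<subseteq> C"
    using card_normal_forms card_image_le[OF card_normal_forms(1), of r] r by (auto simp: Y_def)
  define spanned where "spanned p \<longleftrightarrow> (\<exists>c. p - (\<Sum>q\<in>Y. monomial (c q) [] * q) \<in> I)" for p
  have add: "spanned (p + q)" if "spanned p" "spanned q" for p q
  proof -
    obtain c d where "p - (\<Sum>q\<in>Y. monomial (c q) [] * q) \<in> I" "q - (\<Sum>q\<in>Y. monomial (d q) [] * q) \<in> I"
      using \<open>spanned p\<close> \<open>spanned q\<close> by (auto simp: spanned_def)
    from ideal_add[OF this]
    have "(p + q) - (\<Sum>q\<in>Y. monomial (c q + d q) [] * q) \<in> I"
      by (simp add: monomial_add distrib_right sum.distrib algebra_simps)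
    then show ?thesis unfolding spanned_def by (rule exI[of _ "\<lambda>q. c q + d q"])
  qed
  have scale: "spanned (monomial a [] * p)" if p: "spanned p" for a p
  proof -
    obtain c where "p - (\<Sum>q\<in>Y. monomial (c q) [] * q) \<in> I" using p by (auto simp: spanned_def)
    from ideal_mult(1)[OF this, of "monomial a []"]
    have "monomial a [] * p - (\<Sum>q\<in>Y. monomial (a * c q) [] * q) \<in> I"
      by (simp add: right_diff_distrib sum_distrib_left mult.assoc[symmetric] monomial_mult)
    then show ?thesis unfolding spanned_def by (rule exI[of _ "\<lambda>q. a * c q"])
  qed
  have zero: "spanned 0" unfolding spanned_def using ideal_zero by (intro exI[of _ "\<lambda>_. 0"]) simp
  have base: "spanned (r y)" if "y \<in> normal_forms" for y
  proof -
    have "(\<Sum>q\<in>Y. monomial (if q = r y then 1 else 0) [] * q) = (\<Sum>q\<in>Y. if q = r y then r y else 0)"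
      by (intro sum.cong refl) (simp add: monomial_one)
    also have "\<dots> = r y" using that Y(1) by (simp add: Y_def)
    finally show ?thesis unfolding spanned_def using ideal_zero by (intro exI[of _ "\<lambda>q. if q = r y then 1 else 0"]) simp
  qed
  have word: "spanned (M u)" if u: "set u \<subseteq> brauer_gens n" for u
  proof -
    obtain k y where ky: "y \<in> normal_forms" "rmul (M u) = ((\<lambda>f. f \<circ> rmul (monomial x [])) ^^ k) y"
      using products_normal[OF word_products[OF u]] by blast
    \<comment> \<open>Multiplication by \<open>z\<close> is multiplication by the scalar \<open>x\<close>.\<close>
    have "((\<lambda>f. f \<circ> rmul (monomial x [])) ^^ k) y = rmul (monomial (x ^ k) [] * r y)"
      using r[OF ky(1)]
      by (induction k) (simp_all add: monomial_one rmul_comp mult.assoc[symmetric] monomial_mult)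
    then have "rmul (M u) = rmul (monomial (x ^ k) [] * r y)" using ky by simp
    then have diff: "M u - monomial (x ^ k) [] * r y \<in> I"
      using u r[OF ky(1)] by (intro rmul_inject) auto
    have "spanned (monomial (x ^ k) [] * r y)" by (intro scale base ky)
    then obtain c where "monomial (x ^ k) [] * r y - (\<Sum>q\<in>Y. monomial (c q) [] * q) \<in> I"
      by (auto simp: spanned_def)
    from ideal_add[OF diff this] show ?thesis unfolding spanned_def by (intro exI[of _ c]) simp
  qed
  have "spanned p" if "p \<in> C" for p
  proof -
    have "spanned (\<Sum>w\<in>S. monomial (Poly_Mapping.lookup p w) (letters w))"
      if "finite S" "S \<subseteq> Poly_Mapping.keys p" for S
      using that
    proof (induction S)
      case (insert w S)
      have "spanned (monomial (Poly_Mapping.lookup p w) [] * M (letters w))"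
        using \<open>p \<in> C\<close> insert.prems by (intro scale word) (auto simp: free_carrier_iff)
      then show ?case using insert by (simp add: monomial_mult add)
    qed (simp add: zero)
    from this[of "Poly_Mapping.keys p"] show ?thesis using sum_monomials[of p] by simp
  qed
  then show ?thesis using Y unfolding spanned_def by blast
qed

end

section \<open>The action of the presented algebra\<close>

lemma gen_family_eta: "gen_family m sU (GenS j) = s_family j" "gen_family m sU (GenE j) = e_family m sU j"
  by (simp_all add: fun_eq_iff)

context symplectic_tensor
begin

definition loop_value :: 'k where
  "loop_value = - of_nat (2 * m)"

sublocale BP: brauer_presentation n loop_value .

abbreviation fa :: "(brauer_gen word \<Rightarrow>\<^sub>0 'k) \<Rightarrow> 't \<Rightarrow> 't" where
  "fa \<equiv> free_action m n v sT \<tau>"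

lemma fa_superset:
  assumes "finite S" "Poly_Mapping.keys p \<subseteq> S"
  shows "fa p t = (\<Sum>w\<in>S. sT (Poly_Mapping.lookup p w) (fold gop (letters w) t))"
  unfolding free_action_def
  using assms by (intro sum.mono_neutral_left) (auto simp: in_keys_iff)

lemma fa_add: "fa (p + q) t = fa p t + fa q t"
proof -
  let ?S = "Poly_Mapping.keys p \<union> Poly_Mapping.keys q"
  have "fa (p + q) t = (\<Sum>w\<in>?S. sT (Poly_Mapping.lookup (p + q) w) (fold gop (letters w) t))"
    using Poly_Mapping.keys_add[of p q] by (intro fa_superset) auto
  also have "\<dots> = (\<Sum>w\<in>?S. sT (Poly_Mapping.lookup p w) (fold gop (letters w) t))
      + (\<Sum>w\<in>?S. sT (Poly_Mapping.lookup q w) (fold gop (letters w) t))"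
    by (simp add: lookup_add T.scale_left_distrib sum.distrib)
  also have "\<dots> = fa p t + fa q t"
    using fa_superset[of ?S p t] fa_superset[of ?S q t] by simp
  finally show ?thesis .
qed

lemma fa_zero: "fa 0 t = 0"
  by (simp add: free_action_def)

lemma fa_uminus: "fa (- p) t = - fa p t"
  using fa_add[of p "- p" t] fa_zero by (simp add: eq_neg_iff_add_eq_0 add.commute)

lemma fa_diff: "fa (p - q) t = fa p t - fa q t"
  using fa_add[of p "- q" t] by (simp add: fa_uminus)

lemma fa_sum: "fa (\<Sum>i\<in>J. p i) t = (\<Sum>i\<in>J. fa (p i) t)"
  by (induction J rule: infinite_finite_induct) (auto simp: fa_zero fa_add)

lemma fa_monomial: "fa (monomial c u) t = sT c (fold gop u t)"
  using fa_superset[of "{Word u}" "monomial c u" t] by (auto simp: monomial_def split: if_splits)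

lemma fa_one: "fa 1 t = t"
  unfolding monomial_one[symmetric] by (simp add: fa_monomial)

lemma fa_linear:
  assumes "p \<in> BP.C"
  shows "Vector_Spaces.linear sT sT (fa p)"
proof -
  have "Vector_Spaces.linear sT sT (fold gop (letters w))" if "w \<in> Poly_Mapping.keys p" for w
    using assms that by (intro fold_gen_op_linear) (auto simp: free_carrier_iff)
  then show ?thesis
    by (intro linearI vsT)
      (simp_all add: free_action_def T.scale_right_distrib sum.distrib[symmetric] T.scale_sum_right mult.commute
        linear_add[where ?s1.0 = sT and ?s2.0 = sT] linear_scale[where ?s1.0 = sT and ?s2.0 = sT])
qed

lemma fa_mult:
  assumes p: "p \<in> BP.C" and q: "q \<in> BP.C"
  shows "fa (p * q) t = fa q (fa p t)"
proof -
  let ?P = "Poly_Mapping.keys p" and ?Q = "Poly_Mapping.keys q"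
  let ?lp = "Poly_Mapping.lookup p" and ?lq = "Poly_Mapping.lookup q"
  have "p * q = (\<Sum>w\<in>?P. \<Sum>u\<in>?Q. monomial (?lp w * ?lq u) (letters w @ letters u))"
    by (subst (1) sum_monomials[of p], subst (1) sum_monomials[of q])
      (simp add: sum_product monomial_mult)
  then have "fa (p * q) t = (\<Sum>w\<in>?P. \<Sum>u\<in>?Q. sT (?lp w * ?lq u) (fold gop (letters u) (fold gop (letters w) t)))"
    by (simp add: fa_sum fa_monomial)
  also have "\<dots> = (\<Sum>u\<in>?Q. \<Sum>w\<in>?P. sT (?lp w * ?lq u) (fold gop (letters u) (fold gop (letters w) t)))"
    by (rule sum.swap)
  also have "\<dots> = (\<Sum>u\<in>?Q. sT (?lq u) (fold gop (letters u) (fa p t)))"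
  proof (rule sum.cong[OF refl])
    fix u assume "u \<in> ?Q"
    then have lin: "Vector_Spaces.linear sT sT (fold gop (letters u))"
      using q by (intro fold_gen_op_linear) (auto simp: free_carrier_iff)
    show "(\<Sum>w\<in>?P. sT (?lp w * ?lq u) (fold gop (letters u) (fold gop (letters w) t)))
        = sT (?lq u) (fold gop (letters u) (fa p t))"
      by (simp add: free_action_def linear_sum[OF lin] linear_scale[OF lin] T.scale_sum_right mult.commute)
  qed
  also have "\<dots> = fa q (fa p t)" by (simp add: free_action_def)
  finally show ?thesis .
qed

lemma fa_scale: "p \<in> BP.C \<Longrightarrow> fa (monomial c [] * p) t = sT c (fa p t)"
  using fa_mult[of "monomial c []" p t] linear_scale[OF fa_linear[of p]] by (simp add: fa_monomial)

lemma relation_acts_zero: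
  assumes "set u \<subseteq> brauer_gens n" "set u' \<subseteq> brauer_gens n"
    and "\<And>w. w \<in> words m n \<Longrightarrow> word_family m sT u basis_tensor w = sT c (word_family m sT u' basis_tensor w)"
  shows "fa (monomial 1 u - monomial c u') t = 0"
proof -
  have "fa (monomial 1 u - monomial c u') = (\<lambda>_. 0)"
  proof (rule linear_eq_words)
    show "Vector_Spaces.linear sT sT (fa (monomial 1 u - monomial c u'))"
      using assms by (intro fa_linear) auto
    show "Vector_Spaces.linear sT sT (\<lambda>_. 0)" by (intro linearI vsT) auto
    fix w assume "w \<in> words m n"
    then show "fa (monomial 1 u - monomial c u') (basis_tensor w) = 0"
      using assms by (simp add: fa_diff fa_monomial fold_gen_op_basis)
  qed
  then show ?thesis by simp
qed

text \<open>
  By linearity it suffices to compare the two sides of a relation on words, where they are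
  identities for families.
\<close>
lemma relators_act_zero:
  assumes r: "r \<in> brauer_relators n loop_value"
  shows "fa r t = 0"
proof -
  interpret R: family_relations sT m by unfold_locales
  let ?M = "monomial 1 :: brauer_gen list \<Rightarrow> brauer_gen word \<Rightarrow>\<^sub>0 'k"
  have len: "length w = n" if "w \<in> words m n" for w using that by (simp add: words_def)
  have r1: "fa (?M u - ?M u') t = 0" if "set u \<subseteq> brauer_gens n" "set u' \<subseteq> brauer_gens n"
    "\<And>w. w \<in> words m n \<Longrightarrow> word_family m sT u basis_tensor w = word_family m sT u' basis_tensor w" for u u'
    using that by (intro relation_acts_zero) auto
  consider i where "1 \<le> i" "i < n" "r \<in> {?M [GenS i, GenS i] - ?M [],
          ?M [GenE i, GenE i] - monomial loop_value [GenE i],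
          ?M [GenE i, GenS i] - ?M [GenE i], ?M [GenS i, GenE i] - ?M [GenE i]}"
    | i j where "1 \<le> i" "i < n" "1 \<le> j" "j < n" "i + 1 < j \<or> j + 1 < i" "r \<in> {?M [GenS i, GenS j] - ?M [GenS j, GenS i],
          ?M [GenS i, GenE j] - ?M [GenE j, GenS i], ?M [GenE i, GenE j] - ?M [GenE j, GenE i]}"
    | i where "1 \<le> i" "i + 1 < n" "r \<in> {?M [GenS i, GenS (i+1), GenS i] - ?M [GenS (i+1), GenS i, GenS (i+1)],
          ?M [GenE i, GenE (i+1), GenE i] - ?M [GenE i],
          ?M [GenE (i+1), GenE i, GenE (i+1)] - ?M [GenE (i+1)],
          ?M [GenS i, GenE (i+1), GenE i] - ?M [GenS (i+1), GenE i],
          ?M [GenE (i+1), GenE i, GenS (i+1)] - ?M [GenE (i+1), GenS i]}"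
    using r unfolding brauer_relators_def Let_def monomial_one[symmetric] by blast
  then show ?thesis
  proof cases
    case (1 i)
    note rel = R.S_S R.E_S R.S_E
    show ?thesis
      using 1(3)
    proof (elim insertE emptyE)
      assume "r = ?M [GenS i, GenS i] - ?M []"
      then show ?thesis using 1 by (auto intro!: r1 simp: gen_family_eta rel len)
    next
      assume "r = ?M [GenE i, GenE i] - monomial loop_value [GenE i]"
      then show ?thesis using 1 R.E_E[of i, folded loop_value_def] by (auto intro!: relation_acts_zero simp: gen_family_eta len)
    next
      assume "r = ?M [GenE i, GenS i] - ?M [GenE i]"
      then show ?thesis using 1 by (auto intro!: r1 simp: gen_family_eta rel len)
    next
      assume "r = ?M [GenS i, GenE i] - ?M [GenE i]"
      then show ?thesis using 1 by (auto intro!: r1 simp: gen_family_eta rel len)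
    qed
  next
    case (2 i j)
    show ?thesis
      using 2(6)
    proof (elim insertE emptyE)
      assume r: "r = ?M [GenS i, GenS j] - ?M [GenS j, GenS i]"
      show ?thesis unfolding r using 2 R.S_S_far[of i j] by (intro r1) (auto simp: gen_family_eta len)
    next
      assume r: "r = ?M [GenS i, GenE j] - ?M [GenE j, GenS i]"
      show ?thesis unfolding r using 2 R.S_E_far[of i j] by (intro r1) (auto simp: gen_family_eta len)
    next
      assume r: "r = ?M [GenE i, GenE j] - ?M [GenE j, GenE i]"
      show ?thesis unfolding r using 2 R.E_E_far[of i j] by (intro r1) (auto simp: gen_family_eta len)
    qed
  next
    case (3 i)
    define p where "p = i - 1"
    have ip: "i = Suc p" using 3 by (simp add: p_def)
    have w: "w = put3 p w (w ! p) (w ! Suc p) (w ! Suc (Suc p))" "Suc (Suc p) < length w"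
      "w ! p \<in> alphabet m" "w ! Suc p \<in> alphabet m" "w ! Suc (Suc p) \<in> alphabet m" if "w \<in> words m n" for w
      using put3_same[of p w] 3(2) ip words_nth[OF that] len[OF that] by auto
    have g: "set u \<subseteq> {GenS i, GenS (i + 1), GenE i, GenE (i + 1)} \<Longrightarrow> set u \<subseteq> brauer_gens n" for u
      using 3 by auto
    note eta = word_family_simps gen_family_eta Suc_eq_plus1[symmetric]
    show ?thesis
      using 3(3)
    proof (elim insertE emptyE)
      assume r: "r = ?M [GenS i, GenS (i+1), GenS i] - ?M [GenS (i+1), GenS i, GenS (i+1)]"
      show ?thesis
        unfolding r
      proof (intro r1 g)
        fix u assume "u \<in> words m n"
        note u = w[OF this]
        show "word_family m sT [GenS i, GenS (i+1), GenS i] basis_tensor u = word_family m sT [GenS (i+1), GenS i, GenS (i+1)] basis_tensor u"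
          unfolding eta ip by (subst (1 2) u(1)) (rule R.braid_put3[OF u(2)])
      qed auto
    next
      assume r: "r = ?M [GenE i, GenE (i+1), GenE i] - ?M [GenE i]"
      show ?thesis
        unfolding r
      proof (intro r1 g)
        fix u assume "u \<in> words m n"
        note u = w[OF this]
        show "word_family m sT [GenE i, GenE (i+1), GenE i] basis_tensor u = word_family m sT [GenE i] basis_tensor u"
          unfolding eta ip by (subst (1 2) u(1)) (rule R.E_E_E_put3(1)[OF u(2,3,5)])
      qed auto
    next
      assume r: "r = ?M [GenE (i+1), GenE i, GenE (i+1)] - ?M [GenE (i+1)]"
      show ?thesis
        unfolding r
      proof (intro r1 g)
        fix u assume "u \<in> words m n"
        note u = w[OF this]
        show "word_family m sT [GenE (i+1), GenE i, GenE (i+1)] basis_tensor u = word_family m sT [GenE (i+1)] basis_tensor u"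
          unfolding eta ip by (subst (1 2) u(1)) (rule R.E_E_E_put3(2)[OF u(2,3,5)])
      qed auto
    next
      assume r: "r = ?M [GenS i, GenE (i+1), GenE i] - ?M [GenS (i+1), GenE i]"
      show ?thesis
        unfolding r
      proof (intro r1 g)
        fix u assume "u \<in> words m n"
        note u = w[OF this]
        show "word_family m sT [GenS i, GenE (i+1), GenE i] basis_tensor u = word_family m sT [GenS (i+1), GenE i] basis_tensor u"
          unfolding eta ip by (subst (1 2) u(1)) (rule R.S_E_E_put3[OF u(2-5)])
      qed auto
    next
      assume r: "r = ?M [GenE (i+1), GenE i, GenS (i+1)] - ?M [GenE (i+1), GenS i]"
      show ?thesis
        unfolding r
      proof (intro r1 g)
        fix u assume "u \<in> words m n"
        note u = w[OF this]
        show "word_family m sT [GenE (i+1), GenE i, GenS (i+1)] basis_tensor u = word_family m sT [GenE (i+1), GenS i] basis_tensor u"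
          unfolding eta ip by (subst (1 2) u(1)) (rule R.E_E_S_put3[OF u(2-5)])
      qed auto
    qed
  qed
qed

text \<open>
  The polynomials that act as zero form an ideal, and it contains the relators.
\<close>
lemma ideal_acts_zero:
  assumes "p \<in> BP.I"
  shows "fa p t = 0"
proof -
  let ?F = "BP.F"
  interpret F: ring ?F by (rule ring_free_alg)
  let ?J = "{p \<in> BP.C. \<forall>t. fa p t = 0}"
  have inv: "\<ominus>\<^bsub>?F\<^esub> p = - p" if "p \<in> BP.C" for p
    using that F.minus_equality[of "- p" p] by simp
  have "ideal ?J ?F"
  proof (rule idealI)
    show "ring ?F" by (rule ring_free_alg)
    show "subgroup ?J (add_monoid ?F)"
    proof (rule F.add.subgroupI)
      fix a assume "a \<in> ?J"
      then show "\<ominus>\<^bsub>?F\<^esub> a \<in> ?J" by (simp add: inv fa_uminus)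
    qed (auto simp: fa_zero fa_add intro!: exI[of _ 0])
    fix a q assume a: "a \<in> ?J" and q: "q \<in> carrier ?F"
    then have "fa q 0 = 0" using linear_zero[OF fa_linear[of q]] by simp
    then show "q \<otimes>\<^bsub>?F\<^esub> a \<in> ?J" "a \<otimes>\<^bsub>?F\<^esub> q \<in> ?J"
      using a q by (auto simp: fa_mult)
  qed
  moreover have "brauer_relators n loop_value \<subseteq> ?J"
    using BP.relators_carrier relators_act_zero by blast
  ultimately have "BP.I \<subseteq> ?J"
    unfolding brauer_ideal_def by (rule F.genideal_minimal)
  then show ?thesis using assms by blast
qed

abbreviation "phi \<equiv> brauer_phi m n v sT \<tau>"

lemma phi_coset: "phi (BP.coset p) = fa p"
proof -
  have "fa (i + p) = fa p" if "i \<in> BP.I" for i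
    using ideal_acts_zero[OF that] by (simp add: fun_eq_iff fa_add)
  then have "fa ` BP.coset p = {fa p}"
    using BP.ideal_zero unfolding BP.coset_eq by force
  then show ?thesis by (simp add: brauer_phi_def)
qed

abbreviation "Br \<equiv> brauer_algebra n loop_value"

lemma Br_simps:
  "carrier Br = BP.coset ` BP.C" "monoid.mult Br = monoid.mult BP.Q" "one Br = BP.coset 1" "add Br = add BP.Q"
  "c \<odot>\<^bsub>Br\<^esub> X = BP.coset (monomial c []) \<otimes>\<^bsub>BP.Q\<^esub> X"
  using BP.carrier_Q BP.coset_one by (simp_all add: brauer_algebra_def Let_def)

lemma phi_hom: "phi \<in> alg_hom (opposite Br) (End_alg sT)"
  unfolding alg_hom_def
proof (intro CollectI conjI allI ballI ring_hom_memI)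
  fix X assume "X \<in> carrier (opposite Br)"
  then obtain p where p: "X = BP.coset p" "p \<in> BP.C" by (auto simp: opposite_def Br_simps)
  show "phi X \<in> carrier (End_alg sT)" using p fa_linear by (simp add: phi_coset End_alg_def)
  show "phi (c \<odot>\<^bsub>opposite Br\<^esub> X) = c \<odot>\<^bsub>End_alg sT\<^esub> phi X" for c
    using p by (simp add: opposite_def Br_simps BP.coset_mult phi_coset End_alg_def fa_scale fun_eq_iff)
  fix Y assume "Y \<in> carrier (opposite Br)"
  then obtain q where q: "Y = BP.coset q" "q \<in> BP.C" by (auto simp: opposite_def Br_simps)
  show "phi (X \<otimes>\<^bsub>opposite Br\<^esub> Y) = phi X \<otimes>\<^bsub>End_alg sT\<^esub> phi Y"
    using p q by (simp add: opposite_def Br_simps BP.coset_mult phi_coset End_alg_def fa_mult fun_eq_iff)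
  show "phi (X \<oplus>\<^bsub>opposite Br\<^esub> Y) = phi X \<oplus>\<^bsub>End_alg sT\<^esub> phi Y"
    using p q by (simp add: opposite_def Br_simps BP.coset_add phi_coset End_alg_def fa_add fun_eq_iff)
next
  show "phi \<one>\<^bsub>opposite Br\<^esub> = \<one>\<^bsub>End_alg sT\<^esub>"
    by (simp add: opposite_def Br_simps phi_coset End_alg_def fa_one fun_eq_iff)
qed

lemma phi_image: "phi ` carrier Br = fa ` BP.C"
  by (simp add: Br_simps image_image phi_coset)

lemma phi_inj_on:
  assumes "\<And>p. p \<in> BP.C \<Longrightarrow> (\<And>t. fa p t = 0) \<Longrightarrow> p \<in> BP.I"
  shows "inj_on phi (carrier Br)"
proof (rule inj_onI)
  fix X Y assume "X \<in> carrier Br" "Y \<in> carrier Br" and eq: "phi X = phi Y"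
  then obtain p q where pq: "X = BP.coset p" "Y = BP.coset q" "p \<in> BP.C" "q \<in> BP.C" by (auto simp: Br_simps)
  then have "fa p = fa q" using eq by (simp add: phi_coset)
  then have "p - q \<in> BP.I" using pq by (intro assms) (auto simp: fa_diff)
  then show "X = Y" using pq by (simp only: BP.coset_eq_iff)
qed

end

section \<open>Matching forms come from the Brauer algebra\<close>

lemma pairing_skew: "pairing k l = (- pairing l k :: 'k::field)"
  by (auto simp: pairing_def sgn_minus)

text \<open>
  If independent functions are combinations of a family with no more members, then the
  family is independent too: the coefficient matrix has a right inverse, which expresses the
  family by the functions.
\<close>
lemma independent_spanning_family:
  fixes f :: "'c \<Rightarrow> 'x \<Rightarrow> 'k::field" and u :: "'y \<Rightarrow> 'x \<Rightarrow> 'k"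
  assumes fin: "finite C" "finite Y" and card: "card Y \<le> card C"
    and ind: "\<And>b c. (\<And>x. x \<in> X \<Longrightarrow> (\<Sum>c\<in>C. b c * f c x) = 0) \<Longrightarrow> c \<in> C \<Longrightarrow> b c = 0"
    and span: "\<And>c x. c \<in> C \<Longrightarrow> x \<in> X \<Longrightarrow> f c x = (\<Sum>q\<in>Y. a c q * u q x)"
    and zero: "\<And>x. x \<in> X \<Longrightarrow> (\<Sum>q\<in>Y. d q * u q x) = 0"
    and q: "q \<in> Y"
  shows "d q = 0"
proof -
  have rows: "\<exists>b. \<forall>q\<in>Y. (\<Sum>c\<in>C. b c * a c q) = h q" for h
  proof (rule independent_functions_span[OF fin card])
    fix b c assume b: "\<And>q. q \<in> Y \<Longrightarrow> (\<Sum>c\<in>C. b c * a c q) = 0" and c: "c \<in> C"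
    show "b c = 0"
    proof (rule ind[of b, OF _ c])
      fix x assume x: "x \<in> X"
      have "(\<Sum>c\<in>C. b c * f c x) = (\<Sum>c\<in>C. \<Sum>q\<in>Y. b c * a c q * u q x)"
        using span x by (intro sum.cong refl) (simp add: sum_distrib_left mult.assoc)
      also have "\<dots> = (\<Sum>q\<in>Y. (\<Sum>c\<in>C. b c * a c q) * u q x)"
        by (subst sum.swap) (simp add: sum_distrib_right)
      finally show "(\<Sum>c\<in>C. b c * f c x) = 0" using b by simp
    qed
  qed
  have "\<forall>q. \<exists>b. \<forall>q'\<in>Y. (\<Sum>c\<in>C. b c * a c q') = (if q' = q then 1 else 0)"
    by (rule allI, rule rows)
  from choice[OF this] obtain B where B: "\<And>q q'. q' \<in> Y \<Longrightarrow> (\<Sum>c\<in>C. B q c * a c q') = (if q' = q then 1 else 0)"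
    by blast
  have uB: "u q x = (\<Sum>c\<in>C. B q c * f c x)" if q: "q \<in> Y" and x: "x \<in> X" for q x
  proof -
    have "(\<Sum>c\<in>C. B q c * f c x) = (\<Sum>c\<in>C. \<Sum>q'\<in>Y. B q c * a c q' * u q' x)"
      using span x by (intro sum.cong refl) (simp add: sum_distrib_left mult.assoc)
    also have "\<dots> = (\<Sum>q'\<in>Y. (\<Sum>c\<in>C. B q c * a c q') * u q' x)"
      by (subst sum.swap) (simp add: sum_distrib_right)
    also have "\<dots> = (\<Sum>q'\<in>Y. if q' = q then u q x else 0)"
      using B by (intro sum.cong refl) simp
    finally show ?thesis using q fin(2) by simp
  qed
  have col: "(\<Sum>q\<in>Y. d q * B q c) = 0" if c: "c \<in> C" for c
  proof (rule ind[of "\<lambda>c. \<Sum>q\<in>Y. d q * B q c", OF _ c])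
    fix x assume x: "x \<in> X"
    have "0 = (\<Sum>q\<in>Y. d q * u q x)" using zero[OF x] by simp
    also have "\<dots> = (\<Sum>q\<in>Y. \<Sum>c\<in>C. d q * B q c * f c x)"
      using uB x by (intro sum.cong refl) (simp add: sum_distrib_left mult.assoc)
    also have "\<dots> = (\<Sum>c\<in>C. (\<Sum>q\<in>Y. d q * B q c) * f c x)"
      by (subst sum.swap) (simp add: sum_distrib_right)
    finally show "(\<Sum>c\<in>C. (\<Sum>q\<in>Y. d q * B q c) * f c x) = 0" by simp
  qed
  have "d q = (\<Sum>q'\<in>Y. if q = q' then d q' else 0)" using q fin(2) by simp
  also have "\<dots> = (\<Sum>q'\<in>Y. d q' * (if q = q' then 1 else 0))" by (intro sum.cong refl) simp
  also have "\<dots> = (\<Sum>q'\<in>Y. d q' * (\<Sum>c\<in>C. B q' c * a c q))" using B q by simp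
  also have "\<dots> = (\<Sum>q'\<in>Y. \<Sum>c\<in>C. d q' * B q' c * a c q)" by (simp add: sum_distrib_left mult.assoc)
  also have "\<dots> = (\<Sum>c\<in>C. (\<Sum>q'\<in>Y. d q' * B q' c) * a c q)"
    by (subst sum.swap) (simp add: sum_distrib_right)
  also have "\<dots> = 0" using col by simp
  finally show ?thesis .
qed

text \<open>
  In general position, a matching is a list of pairs of points.  The first \<open>n\<close> points are the arguments
  of an endomorphism, and the last \<open>n\<close> points belong to its values.
\<close>
definition points :: "(nat \<times> nat) list \<Rightarrow> nat list" where
  "points ps = concat (map (\<lambda>(a, b). [a, b]) ps)"

definition perfect :: "nat \<Rightarrow> (nat \<times> nat) list \<Rightarrow> bool" where
  "perfect r ps \<longleftrightarrow> distinct (points ps) \<and> set (points ps) = {..<r}"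

definition pair_product :: "(nat \<times> nat) list \<Rightarrow> int list \<Rightarrow> 'k::field" where
  "pair_product ps w = prod_list (map (\<lambda>(a, b). pairing (w ! a) (w ! b)) ps)"

lemma points_simps [simp]: "points [] = []" "points ((a, b) # ps) = a # b # points ps"
  by (simp_all add: points_def)

lemma pair_product_simps [simp]:
  "pair_product [] w = 1" "pair_product ((a, b) # ps) w = pairing (w ! a) (w ! b) * pair_product ps w"
  by (simp_all add: pair_product_def)

lemma points_map: "points (map (map_prod h h) ps) = map h (points ps)"
  by (induction ps) auto

lemma points_mset: "mset ps = mset qs \<Longrightarrow> mset (points ps) = mset (points qs)"
proof -
  assume "mset ps = mset qs"
  then have "(\<Sum>p\<in>#mset ps. mset [fst p, snd p]) = (\<Sum>p\<in>#mset qs. mset [fst p, snd p])" by simp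
  moreover have "mset (points ps) = (\<Sum>p\<in>#mset ps. mset [fst p, snd p])" for ps
    by (induction ps) auto
  ultimately show ?thesis by simp
qed

lemma perfect_mset: "mset ps = mset qs \<Longrightarrow> perfect r ps \<Longrightarrow> perfect r qs"
  using points_mset[of ps qs] unfolding perfect_def by (metis mset_eq_imp_distinct_iff mset_eq_setD)

lemma pair_product_mset:
  assumes "mset ps = mset qs"
  shows "pair_product ps w = (pair_product qs w :: 'k::field)"
proof -
  have "pair_product ps w = (prod_mset (image_mset (\<lambda>(a, b). pairing (w ! a) (w ! b)) (mset ps)) :: 'k)" for ps
    unfolding pair_product_def by (simp add: prod_mset_prod_list flip: mset_map)
  then show ?thesis using assms by simp
qed

lemma pair_product_cong:
  "(\<And>i. i \<in> set (points ps) \<Longrightarrow> u ! i = w ! h i) \<Longrightarrow> pair_product ps u = pair_product (map (map_prod h h) ps) w"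
  by (induction ps) auto

lemma length_points: "length (points ps) = 2 * length ps"
  by (induction ps) auto

lemma perfect_length: "perfect (2 * r) ps \<Longrightarrow> length ps = r"
  using distinct_card[of "points ps"] by (simp add: perfect_def length_points)

lemma points_memI: "(a, b) \<in> set ps \<Longrightarrow> a \<in> set (points ps) \<and> b \<in> set (points ps)"
  by (force simp: points_def)

lemma points_memE: "i \<in> set (points ps) \<Longrightarrow> \<exists>a b. (a, b) \<in> set ps \<and> (i = a \<or> i = b)"
  by (force simp: points_def)

lemma points_pair_unique:
  "distinct (points ps) \<Longrightarrow> p \<in> set ps \<Longrightarrow> q \<in> set ps \<Longrightarrow> i \<in> {fst p, snd p} \<Longrightarrow> i \<in> {fst q, snd q} \<Longrightarrow> p = q"
proof (induction ps)
  case (Cons r ps)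
  obtain a b where r: "r = (a, b)" by fastforce
  have mem: "i \<in> set (points ps)" if "x \<in> set ps" "i \<in> {fst x, snd x}" for x
    using points_memI[of "fst x" "snd x" ps] that by auto
  have ab: "a \<notin> set (points ps)" "b \<notin> set (points ps)" using Cons.prems(1) r by auto
  show ?case
  proof (cases "p = r \<or> q = r")
    case True
    then have "i \<in> {a, b}" using Cons.prems r by auto
    then have "i \<notin> set (points ps)" using ab by auto
    then have "p \<notin> set ps" "q \<notin> set ps" using mem Cons.prems(4,5) by blast+
    then show ?thesis using Cons.prems(2,3) by auto
  next
    case False
    then have "p \<in> set ps" "q \<in> set ps" "distinct (points ps)" using Cons.prems r by auto
    then show ?thesis using Cons.IH Cons.prems(4,5) by blast
  qed
qed simp

lemma matching_form_pair_product:
  "c \<in> codes r \<Longrightarrow> \<exists>ps. perfect (2 * r) ps \<and> (\<forall>w. length w = 2 * r \<longrightarrow> matching_form c w = (pair_product ps w :: 'k::field))"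
proof (induction r arbitrary: c)
  case 0
  then show ?case by (intro exI[of _ "[]"]) (simp add: perfect_def)
next
  case (Suc r)
  then obtain k ks where c: "c = k # ks" "k < 2 * r + 1" "ks \<in> codes r" by auto
  obtain ps where ps: "perfect (2 * r) ps" "\<And>w. length w = 2 * r \<Longrightarrow> matching_form ks w = (pair_product ps w :: 'k)"
    using Suc.IH[OF c(3)] by blast
  define h where "h j = (if j < k then Suc j else Suc (Suc j))" for j
  let ?qs = "(0, Suc k) # map (map_prod h h) ps"
  have hinj: "inj h" by (auto simp: inj_on_def h_def split: if_splits)
  have him: "insert 0 (insert (Suc k) (h ` {..<2 * r})) = {..<2 * Suc r}"
  proof (rule Set.set_eqI)
    fix i
    have "i \<in> h ` {..<2 * r}" if "i < 2 * Suc r" "i \<noteq> 0" "i \<noteq> Suc k"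
    proof (cases "i \<le> k")
      case True
      then show ?thesis using that c(2) by (intro image_eqI[of _ _ "i - 1"]) (auto simp: h_def)
    next
      case False
      then show ?thesis using that c(2) by (intro image_eqI[of _ _ "i - 2"]) (auto simp: h_def)
    qed
    then show "i \<in> insert 0 (insert (Suc k) (h ` {..<2 * r})) \<longleftrightarrow> i \<in> {..<2 * Suc r}"
      using c(2) by (auto simp: h_def)
  qed
  have "perfect (2 * Suc r) ?qs"
    unfolding perfect_def
  proof
    have "0 \<notin> range h" "Suc k \<notin> range h" by (auto simp: h_def split: if_splits)
    then show "distinct (points ?qs)"
      using ps(1) hinj by (auto simp: perfect_def points_map distinct_map inj_on_def inj_def)
    show "set (points ?qs) = {..<2 * Suc r}"
      using ps(1) unfolding him[symmetric] by (simp add: perfect_def points_map)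
  qed
  moreover have "matching_form c w = (pair_product ?qs w :: 'k)" if w: "length w = 2 * Suc r" for w
  proof -
    obtain a w' where aw: "w = a # w'" "length w' = 2 * r + 1" using w by (cases w) auto
    have "matching_form ks (delete_at k w') = (pair_product ps (delete_at k w') :: 'k)"
      using aw c by (intro ps) auto
    also have "\<dots> = pair_product (map (map_prod h h) ps) w"
    proof (rule pair_product_cong)
      fix i assume "i \<in> set (points ps)"
      then have "i < 2 * r" using ps(1) by (auto simp: perfect_def)
      then show "delete_at k w' ! i = w ! h i"
        using aw c by (auto simp: h_def nth_append)
    qed
    finally show ?thesis using aw c by simp
  qed
  ultimately show ?case by blast
qed

context symplectic_tensor
begin

definition realizable :: "(int list \<Rightarrow> 'k) \<Rightarrow> bool" where
  "realizable f \<longleftrightarrow> (\<exists>p\<in>BP.C. \<forall>w\<in>words m (2 * n). f w = functional (fa p) w)"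

lemma realizable_cong:
  "realizable f \<Longrightarrow> (\<And>w. w \<in> words m (2 * n) \<Longrightarrow> g w = f w) \<Longrightarrow> realizable g"
  unfolding realizable_def by fastforce

lemma functional_scale: "p \<in> BP.C \<Longrightarrow> functional (fa (monomial c [] * p)) w = c * functional (fa p) w"
  by (simp add: functional_def fa_scale linear_scale[OF dual_linear])

lemma functional_sum: "functional (fa (\<Sum>i\<in>J. p i)) w = (\<Sum>i\<in>J. functional (fa (p i)) w)"
  by (simp add: functional_def fa_sum linear_sum[OF dual_linear])

lemma realizable_scale: "realizable f \<Longrightarrow> realizable (\<lambda>w. c * f w)"
  unfolding realizable_def
proof (elim bexE)
  fix p assume "p \<in> BP.C" "\<forall>w\<in>words m (2 * n). f w = functional (fa p) w"
  then show "\<exists>p\<in>BP.C. \<forall>w\<in>words m (2 * n). c * f w = functional (fa p) w"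
    by (intro bexI[of _ "monomial c [] * p"]) (auto simp: functional_scale)
qed

lemma take_words: "w \<in> words m (2 * n) \<Longrightarrow> take n w \<in> words m n"
  by (auto simp: words_def dest: in_set_takeD)

lemma functional_gen:
  assumes g: "g \<in> brauer_gens n" and p: "p \<in> BP.C" and w: "w \<in> words m (2 * n)"
  shows "functional (fa (monomial 1 [g] * p)) w = gen_family m (*) g (functional (fa p)) w"
proof -
  let ?d = "dual (map vec (drop n w))"
  have lin: "Vector_Spaces.linear sT (*) (\<lambda>t. ?d (fa p t))"
    using Vector_Spaces.linear_compose[OF fa_linear[OF p] dual_linear] by (simp add: o_def)
  have "functional (fa (monomial 1 [g] * p)) w = ?d (fa p (gop g (basis_tensor (take n w))))"
    using g p by (simp add: functional_def fa_mult fa_monomial)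
  also have "\<dots> = gen_family m (*) g (\<lambda>u. ?d (fa p (basis_tensor u))) (take n w)"
    using gen_family_linear[OF lin] by (simp add: gen_op_basis[OF g take_words[OF w]])
  also have "\<dots> = gen_family m (*) g (functional (fa p)) w"
  proof (cases g)
    case (GenS j)
    then have "1 \<le> j" "j < n" using g by auto
    then show ?thesis using GenS
      by (simp add: s_family_def functional_def take_update_swap)
  next
    case (GenE j)
    then have "1 \<le> j" "j < n" using g by auto
    then show ?thesis using GenE
      by (simp add: e_family_def functional_def take_update_swap)
  qed
  finally show ?thesis .
qed

lemma realizable_gen:
  assumes g: "g \<in> brauer_gens n" and f: "realizable f"
  shows "realizable (gen_family m (*) g f)"
proof -
  obtain p where p: "p \<in> BP.C" "\<And>w. w \<in> words m (2 * n) \<Longrightarrow> f w = functional (fa p) w"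
    using f by (auto simp: realizable_def)
  have "gen_family m (*) g f w = functional (fa (monomial 1 [g] * p)) w" if "w \<in> words m (2 * n)" for w
    using gen_family_cong[OF g that _ p(2)] functional_gen[OF g p(1) that] by simp
  then show ?thesis
    unfolding realizable_def using g p(1) by (intro bexI[of _ "monomial 1 [g] * p"]) auto
qed

text \<open>
  Positions in a word are counted from \<open>0\<close>, but \<open>\<sigma>\<close> permutes the numbers \<open>1, ..., n\<close> and fixes all others,
  so the last \<open>n\<close> positions stay where they are.
\<close>
definition permute_word :: "(nat \<Rightarrow> nat) \<Rightarrow> int list \<Rightarrow> int list" where
  "permute_word \<sigma> w = map (\<lambda>i. w ! (\<sigma> (Suc i) - 1)) [0..<2 * n]"

lemma permuted_position:
  assumes "\<sigma> permutes {1..n}"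
  shows "i < 2 * n \<Longrightarrow> \<sigma> (Suc i) - 1 < 2 * n" and "i < n \<longleftrightarrow> \<sigma> (Suc i) - 1 < n"
    and "1 \<le> \<sigma> (Suc i)" and "n \<le> i \<Longrightarrow> \<sigma> (Suc i) = Suc i"
proof -
  have "\<sigma> (Suc i) \<in> {1..n} \<longleftrightarrow> Suc i \<in> {1..n}" by (rule permutes_in_image[OF assms])
  moreover have *: "\<sigma> (Suc i) = Suc i" if "Suc i \<notin> {1..n}" using permutes_not_in[OF assms that] .
  ultimately show "i < 2 * n \<Longrightarrow> \<sigma> (Suc i) - 1 < 2 * n" and "i < n \<longleftrightarrow> \<sigma> (Suc i) - 1 < n"
    and "1 \<le> \<sigma> (Suc i)" and "n \<le> i \<Longrightarrow> \<sigma> (Suc i) = Suc i"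
    by (cases "Suc i \<in> {1..n}"; force)+
qed

lemma realizable_permute:
  "\<sigma> permutes {1..n} \<Longrightarrow> realizable f \<Longrightarrow> realizable (\<lambda>w. f (permute_word \<sigma> w))"
proof (induction \<sigma> arbitrary: f rule: permutes_adjacent_induct)
  case id
  have "permute_word id w = w" if "w \<in> words m (2 * n)" for w
    using that by (auto simp: permute_word_def words_def intro: nth_equalityI)
  then show ?case by (intro realizable_cong[OF id]) (simp only:)
next
  case (step \<sigma> i)
  have i: "1 \<le> i" "i < n" using step by auto
  define f' where "f' = gen_family m (*) (GenS i) f"
  have "realizable (\<lambda>w. f' (permute_word \<sigma> w))"
    unfolding f'_def using step.prems i by (intro step.IH realizable_gen) auto
  then have "realizable (\<lambda>w. - 1 * f' (permute_word \<sigma> w))" by (rule realizable_scale)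
  moreover have "f (permute_word (\<sigma> \<circ> transpose i (Suc i)) w) = - 1 * f' (permute_word \<sigma> w)" for w
  proof -
    let ?u = "permute_word \<sigma> w"
    have "permute_word (\<sigma> \<circ> transpose i (Suc i)) w = ?u[i - 1 := ?u ! i, i := ?u ! (i - 1)]"
      using i by (intro nth_equalityI) (auto simp: permute_word_def nth_list_update transpose_def)
    then show ?thesis by (simp add: f'_def s_family_def)
  qed
  ultimately show ?case by (simp only:)
qed

lemma pair_product_permute:
  assumes s: "\<sigma> permutes {1..n}" and ps: "set (points ps) \<subseteq> {..<2 * n}"
  shows "pair_product ps (permute_word \<sigma> w) = pair_product (map (map_prod (\<lambda>i. \<sigma> (Suc i) - 1) (\<lambda>i. \<sigma> (Suc i) - 1)) ps) w"
proof (rule pair_product_cong)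
  fix i assume "i \<in> set (points ps)"
  then have "i < 2 * n" using ps by auto
  then show "permute_word \<sigma> w ! i = w ! (\<sigma> (Suc i) - 1)" by (simp add: permute_word_def)
qed

text \<open>
  The matching that joins each argument to the corresponding value belongs to the identity.
\<close>
lemma realizable_identity: "realizable (\<lambda>w. \<Prod>i<n. pairing (w ! i) (w ! (n + i)))"
  unfolding realizable_def
proof (intro bexI[of _ 1] ballI)
  fix w assume w: "w \<in> words m (2 * n)"
  then have "drop n w \<in> words m n" by (auto simp: words_def dest: in_set_dropD)
  then have "functional (fa 1) w = (\<Prod>i<n. pairing (take n w ! i) (drop n w ! i))"
    using dual_basis[OF take_words[OF w]] by (simp add: functional_def fa_one)
  then show "(\<Prod>i<n. pairing (w ! i) (w ! (n + i))) = functional (fa 1) w"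
    using w by (simp add: words_def)
qed simp

text \<open>
  Matchings in which every arc joins an argument to a value come from permutations.
\<close>
lemma realizable_straight:
  assumes perf: "perfect (2 * n) ps" and st: "\<And>a b. (a, b) \<in> set ps \<Longrightarrow> a < n \<and> n \<le> b"
  shows "realizable (pair_product ps)"
proof -
  have dist: "distinct (points ps)" and pts: "set (points ps) = {..<2 * n}"
    using perf by (auto simp: perfect_def)
  have "\<exists>a. (a, n + i) \<in> set ps" if i: "i < n" for i
  proof -
    have "n + i \<in> set (points ps)" using pts i by auto
    then obtain a b where ab: "(a, b) \<in> set ps" "n + i = a \<or> n + i = b" using points_memE by blast
    then show ?thesis using st[OF ab(1)] by auto
  qed
  then obtain a where a: "\<And>i. i < n \<Longrightarrow> (a i, n + i) \<in> set ps" by metis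
  have inj: "inj_on a {..<n}"
  proof (rule inj_onI)
    fix i j assume "i \<in> {..<n}" "j \<in> {..<n}" "a i = a j"
    then have "(a i, n + i) = (a j, n + j)"
      using points_pair_unique[OF dist a[of i] a[of j], of "a i"] by auto
    then show "i = j" by simp
  qed
  have an: "a i < n" if "i < n" for i using st a[OF that] by blast
  have bij: "bij_betw (\<lambda>i. (a i, n + i)) {..<n} (set ps)"
    unfolding bij_betw_def
  proof (intro conjI Set.equalityI subsetI)
    show "inj_on (\<lambda>i. (a i, n + i)) {..<n}" by (auto simp: inj_on_def)
    fix p assume p: "p \<in> set ps"
    obtain x y where xy: "p = (x, y)" by fastforce
    then have "n \<le> y" "y < 2 * n" using st p points_memI[of x y ps] pts by auto
    moreover from this have "(a (y - n), y) = p"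
      using points_pair_unique[OF dist a[of "y - n"] p, of y] xy by auto
    ultimately show "p \<in> (\<lambda>i. (a i, n + i)) ` {..<n}" by (intro image_eqI[of _ _ "y - n"]) auto
  qed (use a in auto)
  have "distinct ps"
  proof -
    have "distinct ps" if "distinct (points ps)" for ps
      using that
    proof (induction ps)
      case (Cons p ps)
      then show ?case using points_memI[of "fst p" "snd p" ps] by (cases p) auto
    qed simp
    then show ?thesis using dist by blast
  qed
  then have pp: "pair_product ps w = (\<Prod>i<n. pairing (w ! a i) (w ! (n + i)) :: 'k)" for w
  proof -
    have "pair_product ps w = (\<Prod>p\<in>set ps. case p of (x, y) \<Rightarrow> (pairing (w ! x) (w ! y) :: 'k))"
      unfolding pair_product_def using \<open>distinct ps\<close> by (simp add: prod.distinct_set_conv_list)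
    also have "\<dots> = (\<Prod>i<n. pairing (w ! a i) (w ! (n + i)))"
      by (subst prod.reindex_bij_betw[OF bij, symmetric]) simp
    finally show ?thesis .
  qed
  let ?xs = "map (\<lambda>i. Suc (a i)) [0..<n]"
  have "distinct ?xs" "set ?xs \<subseteq> {1..n}"
    using inj an by (auto simp: distinct_map inj_on_def Suc_le_eq)
  from permutation_with_prefix[OF this]
  obtain \<sigma> where s: "\<sigma> permutes {1..n}" "\<And>i. i < n \<Longrightarrow> \<sigma> (Suc i) = Suc (a i)"
    by auto
  have "realizable (\<lambda>w. (\<lambda>w. \<Prod>i<n. pairing (w ! i) (w ! (n + i))) (permute_word \<sigma> w))"
    by (rule realizable_permute[OF s(1) realizable_identity])
  moreover have "(\<Prod>i<n. pairing (permute_word \<sigma> w ! i) (permute_word \<sigma> w ! (n + i))) = (pair_product ps w :: 'k)" for w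
    unfolding pp
  proof (rule prod.cong[OF refl])
    fix i assume "i \<in> {..<n}"
    then show "pairing (permute_word \<sigma> w ! i) (permute_word \<sigma> w ! (n + i)) = pairing (w ! a i) (w ! (n + i))"
      using s(2) permuted_position(4)[OF s(1), of "n + i"] by (simp add: permute_word_def)
  qed
  ultimately show ?thesis by (simp only:)
qed

definition is_cap :: "nat \<times> nat \<Rightarrow> bool" where
  "is_cap p \<longleftrightarrow> fst p < n \<and> snd p < n"

lemma count_top_points:
  assumes "perfect (2 * n) ps"
  shows "(\<Sum>p\<leftarrow>ps. (if fst p < n then 1 else 0) + (if snd p < n then 1 else 0)) = n"
proof -
  have "(\<Sum>p\<leftarrow>ps. (if fst p < n then 1 else 0) + (if snd p < n then 1 else 0)) = length (filter (\<lambda>i. i < n) (points ps))" for ps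
    by (induction ps) auto
  also have "length (filter (\<lambda>i. i < n) (points ps)) = card {i \<in> set (points ps). i < n}"
  proof -
    have "distinct (filter (\<lambda>i. i < n) (points ps))" using assms by (simp only: perfect_def distinct_filter)
    from distinct_card[OF this] show ?thesis by (simp only: set_filter)
  qed
  also have "{i \<in> set (points ps). i < n} = {..<n}"
  proof -
    have s: "set (points ps) = {..<2 * n}" using assms by (simp add: perfect_def)
    show ?thesis unfolding s by auto
  qed
  finally show ?thesis by simp
qed

lemma orient_pairs:
  "\<exists>c. \<forall>w. pair_product ps w = (c * pair_product (map (\<lambda>p. if fst p < n then p else (snd p, fst p)) ps) w :: 'k)"
proof (induction ps)
  case Nil
  show ?case by (intro exI[of _ 1]) simp
next
  case (Cons p ps)
  then obtain c where c: "\<And>w. pair_product ps w = (c * pair_product (map (\<lambda>p. if fst p < n then p else (snd p, fst p)) ps) w :: 'k)"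
    by blast
  obtain a b where p: "p = (a, b)" by fastforce
  show ?case
  proof (cases "a < n")
    case True
    then show ?thesis using c p by (intro exI[of _ c]) (simp add: mult.left_commute)
  next
    case False
    have sk: "pairing (w ! a) (w ! b) = (- pairing (w ! b) (w ! a) :: 'k)" for w by (rule pairing_skew)
    show ?thesis using False p by (intro exI[of _ "- c"] allI) (simp add: c sk mult.left_commute)
  qed
qed

text \<open>
  By induction on the number of caps, that is, of arcs between two arguments.  If there is a cap
  \<open>(a, b)\<close>, then a count of points shows that there is an arc \<open>(c, d)\<close> between two values as well.  A
  permutation of the arguments moves the cap to the first two positions.  Replacing the two arcs by
  \<open>(0, c)\<close> and \<open>(1, d)\<close> gives a matching with fewer caps, and applying the generator \<open>e_1\<close> to its form
  gives back the original one, up to sign.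
\<close>
lemma pair_product_realizable:
  "perfect (2 * n) ps \<Longrightarrow> realizable (pair_product ps)"
proof (induction "length (filter is_cap ps)" arbitrary: ps rule: less_induct)
  case less
  let ?top = "\<lambda>p. (if fst p < n then 1 else 0) + (if snd p < n then 1 else 0 :: nat)"
  have len: "length ps = n" by (rule perfect_length[OF less.prems])
  have total: "sum_list (map ?top ps) = n" by (rule count_top_points[OF less.prems])
  show ?case
  proof (cases "\<exists>p\<in>set ps. is_cap p")
    case False
    have le: "\<And>p. p \<in> set ps \<Longrightarrow> ?top p \<le> 1" using False by (auto simp: is_cap_def)
    have one: "?top p = 1" if p: "p \<in> set ps" for p
    proof (rule ccontr)
      assume "?top p \<noteq> 1"
      then have "?top p < 1" using le[OF p] by simp
      have "sum_list (map ?top ps) < sum_list (map (\<lambda>_. 1) ps)"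
        using p le \<open>?top p < 1\<close>
      proof (induction ps)
        case (Cons q ps)
        have "sum_list (map ?top ps) \<le> sum_list (map (\<lambda>_. 1) ps)"
          using Cons.prems by (intro sum_list_mono) auto
        then show ?case using Cons by (cases "q = p") (fastforce)+
      qed simp
      then show False using total len by (simp add: sum_list_triv)
    qed
    let ?qs = "map (\<lambda>p. if fst p < n then p else (snd p, fst p)) ps"
    have swap: "mset (points (map (\<lambda>p. if fst p < n then p else (snd p, fst p)) qs)) = mset (points qs)" for qs
      by (induction qs) auto
    have perf: "perfect (2 * n) ?qs"
      using less.prems mset_eq_imp_distinct_iff[OF swap[of ps]] mset_eq_setD[OF swap[of ps]]
      by (simp add: perfect_def)
    have "realizable (pair_product ?qs)"
    proof (rule realizable_straight[OF perf])
      fix a b assume "(a, b) \<in> set ?qs"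
      then obtain p where "p \<in> set ps" "(a, b) = (if fst p < n then p else (snd p, fst p))" by auto
      then show "a < n \<and> n \<le> b" using one[of p] by (auto split: if_splits)
    qed
    moreover obtain c where c: "\<And>w. pair_product ps w = (c * pair_product ?qs w :: 'k)"
      using orient_pairs[of ps] by blast
    ultimately show ?thesis
      using realizable_cong[OF realizable_scale[of "pair_product ?qs" c], of "pair_product ps"] by simp
  next
    case True
    then obtain a b where ab: "(a, b) \<in> set ps" "a < n" "b < n" by (auto simp: is_cap_def)
    \<comment> \<open>Each of the \<open>n\<close> arcs has one argument on average, and the cap has two.\<close>
    have "\<exists>p\<in>set ps. ?top p = 0"
    proof (rule ccontr)
      assume "\<not> ?thesis"
      then have ge: "\<And>p. p \<in> set ps \<Longrightarrow> 1 \<le> ?top p" by (auto split: if_splits)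
      have "sum_list (map (\<lambda>_. 1) ps) < sum_list (map ?top ps)"
        using ab(1) ge
      proof (induction ps)
        case (Cons q ps)
        have "sum_list (map (\<lambda>_. 1) ps) \<le> sum_list (map ?top ps)"
          using Cons.prems by (intro sum_list_mono) auto
        then show ?case using Cons ab by (cases "q = (a, b)") fastforce+
      qed simp
      then show False using total len by (simp add: sum_list_triv)
    qed
    then obtain c d where cd: "(c, d) \<in> set ps" "n \<le> c" "n \<le> d" by (auto split: if_splits)
    define rs where "rs = remove1 (c, d) (remove1 (a, b) ps)"
    have mset: "mset ps = mset ((a, b) # (c, d) # rs)"
    proof -
      have "(c, d) \<in> set (remove1 (a, b) ps)" using ab cd by (simp add: in_set_remove1)
      moreover have move: "mset xs = mset (x # remove1 x xs)" if "x \<in> set xs" for x and xs :: "(nat \<times> nat) list"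
        using that by simp
      ultimately have eq: "mset (remove1 (a, b) ps) = mset ((c, d) # rs)" unfolding rs_def by blast
      have "mset ps = add_mset (a, b) (mset (remove1 (a, b) ps))"
        using move[OF ab(1)] by (simp only: mset.simps)
      then show ?thesis by (simp only: eq mset.simps)
    qed
    have perf: "perfect (2 * n) ((a, b) # (c, d) # rs)" by (rule perfect_mset[OF mset less.prems])
    have abn: "distinct [Suc a, Suc b]" "set [Suc a, Suc b] \<subseteq> {1..n}"
      using ab perf by (auto simp: perfect_def)
    obtain \<sigma> where s: "\<sigma> permutes {1..n}" "\<And>i. i < 2 \<Longrightarrow> \<sigma> (Suc i) = [Suc a, Suc b] ! i"
      using permutation_with_prefix[OF abn] by auto
    have s12: "\<sigma> (Suc 0) = Suc a" "\<sigma> (Suc (Suc 0)) = Suc b" using s(2)[of 0] s(2)[of 1] by auto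
    \<comment> \<open>The relabelling of points by the permutation, and its inverse.\<close>
    define h where "h i = \<sigma> (Suc i) - 1" for i
    define k where "k i = inv_into UNIV \<sigma> (Suc i) - 1" for i
    have si: "inv_into UNIV \<sigma> permutes {1..n}" using s(1) by (rule permutes_inv)
    have hk: "h (k i) = i" "k (h i) = i" for i
      using permuted_position(3)[OF si, of i] permuted_position(3)[OF s(1), of i] permutes_inverses[OF s(1)]
      by (simp_all add: h_def k_def)
    have klt: "k i < n \<longleftrightarrow> i < n" "i < 2 * n \<Longrightarrow> k i < 2 * n" for i
      using permuted_position(1,2)[OF si, of i] by (auto simp: k_def)
    have kinj: "inj k" using hk(1) by (metis injI)
    have kim: "k ` {..<2 * n} = {..<2 * n}"
    proof (intro Set.equalityI subsetI)
      fix i assume "i \<in> {..<2 * n}"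
      then have "h i \<in> {..<2 * n}" using permuted_position(1)[OF s(1), of i] by (simp add: h_def)
      then show "i \<in> k ` {..<2 * n}" using hk(2)[of i] by (intro image_eqI[of i k "h i"]) simp_all
    qed (use klt(2) in auto)
    have kv: "k a = 0" "k b = 1" "k c = c" "k d = d"
      using hk(2)[of 0] hk(2)[of 1] s12 permuted_position(4)[OF si] cd by (auto simp: h_def k_def)
    define rs' where "rs' = map (map_prod k k) rs"
    have map_k: "map (map_prod k k) ((a, b) # (c, d) # rs) = (0, 1) # (c, d) # rs'"
      by (simp add: rs'_def kv)
    have perf': "perfect (2 * n) ((0, 1) # (c, d) # rs')"
      using perf kim inj_on_subset[OF kinj subset_UNIV] unfolding map_k[symmetric] perfect_def points_map
      by (simp only: distinct_map set_map)
    have dist': "distinct (points ((0, 1) # (c, d) # rs'))" and pts': "set (points ((0, 1) # (c, d) # rs')) \<subseteq> {..<2 * n}"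
      using perf' unfolding perfect_def by blast+
    have restore: "map (map_prod h h) ((0, 1) # (c, d) # rs') = (a, b) # (c, d) # rs"
      unfolding map_k[symmetric] by (simp add: hk o_def map_prod_def case_prod_unfold)
    let ?qs = "(0, c) # (1, d) # rs'"
    have "mset (points ?qs) = mset (points ((0, 1) # (c, d) # rs'))" by simp
    from mset_eq_imp_distinct_iff[OF this] mset_eq_setD[OF this]
    have perfq: "perfect (2 * n) ?qs" using perf' by (simp only: perfect_def)
    have caps: "length (filter is_cap rs') = length (filter is_cap rs)"
      unfolding rs'_def by (induction rs) (auto simp: is_cap_def klt)
    have "length (filter is_cap ps) = length (filter is_cap ((a, b) # (c, d) # rs))"
      using mset by (metis mset_filter size_mset)
    then have "length (filter is_cap ?qs) < length (filter is_cap ps)"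
      using caps ab cd by (simp add: is_cap_def)
    then have "realizable (pair_product ?qs)" using perfq by (intro less.hyps) auto
    moreover have n2: "2 \<le> n" using ab perf by (auto simp: perfect_def)
    ultimately have "realizable (gen_family m (*) (GenE 1) (pair_product ?qs))"
      by (intro realizable_gen) auto
    then have "realizable (\<lambda>w. - 1 * gen_family m (*) (GenE 1) (pair_product ?qs) w)" by (rule realizable_scale)
    then have "realizable (pair_product ((0, 1) # (c, d) # rs'))"
    proof (rule realizable_cong)
      fix w assume w: "w \<in> words m (2 * n)"
      interpret R: family_relations "(*) :: 'k \<Rightarrow> 'k \<Rightarrow> 'k" m
        unfolding family_relations_def by (rule vector_space_field)
      have cdn: "c < 2 * n" "d < 2 * n" "c \<noteq> d" using perf by (auto simp: perfect_def)
      have len: "length w = 2 * n" using w by (simp add: words_def)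
      have upd: "pair_product ?qs (w[0 := l, 1 := - l]) = (pairing (- l) (w ! d) * (pairing l (w ! c) * pair_product rs' w) :: 'k)" for l
      proof -
        have "pair_product rs' (w[0 := l, 1 := - l]) = (pair_product (map (map_prod id id) rs') w :: 'k)"
        proof (rule pair_product_cong)
          fix i assume "i \<in> set (points rs')"
          moreover have "0 \<notin> set (points rs')" "1 \<notin> set (points rs')" using dist' by auto
          ultimately have "i \<noteq> 0" "i \<noteq> 1" by metis+
          then show "w[0 := l, 1 := - l] ! i = w ! id i" by simp
        qed
        also have "\<dots> = pair_product rs' w" by (simp add: map_prod.id)
        finally show ?thesis using cd n2 len by (simp add: nth_list_update)
      qed
      have "gen_family m (*) (GenE 1) (pair_product ?qs) w
         = pairing (w ! 0) (w ! 1) * R.turn (\<lambda>l. pairing (- l) (w ! d) * (pairing l (w ! c) * pair_product rs' w))"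
        by (simp only: gen_family.simps e_family_def upd diff_self_eq_0)
      also have "\<dots> = pairing (w ! 0) (w ! 1) * (pairing (w ! d) (w ! c) * pair_product rs' w)"
        by (simp only: R.turn_contract_left[OF words_nth[OF w cdn(2)]])
      finally show "pair_product ((0, 1) # (c, d) # rs') w = (- 1 * gen_family m (*) (GenE 1) (pair_product ?qs) w :: 'k)"
        using pairing_skew[of "w ! c" "w ! d", where 'k = 'k] by simp
    qed
    then have "realizable (\<lambda>w. pair_product ((0, 1) # (c, d) # rs') (permute_word \<sigma> w))"
      by (rule realizable_permute[OF s(1)])
    moreover have "pair_product ((0, 1) # (c, d) # rs') (permute_word \<sigma> w) = (pair_product ps w :: 'k)" for w
    proof -
      have "pair_product ((0, 1) # (c, d) # rs') (permute_word \<sigma> w) = (pair_product (map (map_prod h h) ((0, 1) # (c, d) # rs')) w :: 'k)"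
        unfolding h_def[abs_def] by (rule pair_product_permute[OF s(1) pts'])
      also have "\<dots> = pair_product ps w"
        unfolding restore by (rule pair_product_mset[OF mset, symmetric])
      finally show ?thesis .
    qed
    ultimately show ?thesis by (simp only:)
  qed
qed

lemma matching_form_realizable: "c \<in> codes n \<Longrightarrow> realizable (matching_form c)"
proof -
  assume "c \<in> codes n"
  then obtain ps where ps: "perfect (2 * n) ps" "\<And>w. length w = 2 * n \<Longrightarrow> matching_form c w = (pair_product ps w :: 'k)"
    using matching_form_pair_product by blast
  show ?thesis
    by (rule realizable_cong[OF pair_product_realizable[OF ps(1)]]) (simp add: ps(2) words_def)
qed

end

section \<open>Commutation with the group, and the duality theorem\<close>

context symplectic_tensor
begin

lemma multilinear_eq_basis:
  assumes f: "multilinear sV sW n f" and g: "multilinear sV sW n g" and xs: "length xs = n"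
    and eq: "\<And>w. w \<in> words m n \<Longrightarrow> f (map vec w) = g (map vec w)"
  shows "f xs = g xs"
proof -
  have "expand sW (alphabet m) coord (\<lambda>w. f (map vec w)) xs = expand sW (alphabet m) coord (\<lambda>w. g (map vec w)) xs"
    using eq xs by (intro expand_cong) (auto simp: words_def)
  then show ?thesis
    using multilinear_expand_basis[OF f xs] multilinear_expand_basis[OF g xs] by simp
qed

lemma tau_update_linear: "length xs = n \<Longrightarrow> i < n \<Longrightarrow> Vector_Spaces.linear sV sT (\<lambda>x. \<tau> (xs[i := x]))"
  using multilinear_tau by (simp add: multilinear_def)

lemma linear_scaled_sum:
  assumes "\<And>l. l \<in> L \<Longrightarrow> Vector_Spaces.linear sV sT (h l)"
  shows "Vector_Spaces.linear sV sT (\<lambda>x. sT c (\<Sum>l\<in>L. sT (d l) (h l x)))"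
proof (intro linearI vsV vsT)
  fix x y
  have "(\<Sum>l\<in>L. sT (d l) (h l (x + y))) = (\<Sum>l\<in>L. sT (d l) (h l x)) + (\<Sum>l\<in>L. sT (d l) (h l y))"
    using linear_add[OF assms] by (simp add: T.scale_right_distrib sum.distrib)
  then show "sT c (\<Sum>l\<in>L. sT (d l) (h l (x + y))) = sT c (\<Sum>l\<in>L. sT (d l) (h l x)) + sT c (\<Sum>l\<in>L. sT (d l) (h l y))"
    by (simp add: T.scale_right_distrib)
next
  fix a x
  have "(\<Sum>l\<in>L. sT (d l) (h l (sV a x))) = sT a (\<Sum>l\<in>L. sT (d l) (h l x))"
    using linear_scale[OF assms] by (simp add: T.scale_sum_right mult.commute)
  then show "sT c (\<Sum>l\<in>L. sT (d l) (h l (sV a x))) = sT a (sT c (\<Sum>l\<in>L. sT (d l) (h l x)))"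
    by (simp add: mult.commute)
qed

lemma s_op_pure:
  assumes j: "1 \<le> j" "j < n" and xs: "length xs = n"
  shows "s_op m n v sT \<tau> j (\<tau> xs) = - \<tau> (xs[j - 1 := xs ! j, j := xs ! (j - 1)])"
proof (rule multilinear_eq_basis[of sT "\<lambda>xs. s_op m n v sT \<tau> j (\<tau> xs)" "\<lambda>xs. - \<tau> (xs[j - 1 := xs ! j, j := xs ! (j - 1)])", OF _ _ xs])
  show "multilinear sV sT n (\<lambda>xs. s_op m n v sT \<tau> j (\<tau> xs))"
    by (rule multilinear_compose[OF multilinear_tau s_op(1)[OF j]])
  show "multilinear sV sT n (\<lambda>xs. - \<tau> (xs[j - 1 := xs ! j, j := xs ! (j - 1)]))"
    unfolding multilinear_def
  proof (intro allI impI)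
    fix xs :: "'v list" and i assume i: "length xs = n" "i < n"
    let ?ys = "xs[j - 1 := xs ! j, j := xs ! (j - 1)]"
    let ?i = "transpose (j - 1) j i"
    have "(xs[i := x])[j - 1 := xs[i := x] ! j, j := xs[i := x] ! (j - 1)] = ?ys[?i := x]" for x
      using i j by (intro nth_equalityI) (auto simp: nth_list_update transpose_def)
    then have upd: "\<tau> ((xs[i := x])[j - 1 := xs[i := x] ! j, j := xs[i := x] ! (j - 1)]) = \<tau> (?ys[?i := x])" for x
      by (simp only:)
    have lin: "Vector_Spaces.linear sV sT (\<lambda>x. \<tau> (?ys[?i := x]))"
      using i j by (intro tau_update_linear) (auto simp: transpose_def)
    show "Vector_Spaces.linear sV sT (\<lambda>x. - \<tau> ((xs[i := x])[j - 1 := xs[i := x] ! j, j := xs[i := x] ! (j - 1)]))"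
      unfolding upd
      by (intro linearI vsV vsT) (simp_all only: linear_add[OF lin] linear_scale[OF lin] minus_add_distrib T.scale_minus_right)
  qed
  fix w assume w: "w \<in> words m n"
  then show "s_op m n v sT \<tau> j (\<tau> (map vec w)) = - \<tau> ((map vec w)[j - 1 := map vec w ! j, j := map vec w ! (j - 1)])"
    using s_op(2)[OF j w] j by (simp add: s_family_def basis_tensor_def map_update words_def)
qed

lemma e_op_pure:
  assumes j: "1 \<le> j" "j < n" and xs: "length xs = n"
  shows "e_op m n v sT \<tau> j (\<tau> xs) = sT (form (xs ! (j - 1)) (xs ! j))
     (\<Sum>l\<in>alphabet m. sT (- of_int (sgn l)) (\<tau> (xs[j - 1 := vec l, j := vec (- l)])))"
proof (rule multilinear_eq_basis[of sT "\<lambda>xs. e_op m n v sT \<tau> j (\<tau> xs)" "\<lambda>xs. sT (form (xs ! (j - 1)) (xs ! j))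
     (\<Sum>l\<in>alphabet m. sT (- of_int (sgn l)) (\<tau> (xs[j - 1 := vec l, j := vec (- l)])))", OF _ _ xs])
  show "multilinear sV sT n (\<lambda>xs. e_op m n v sT \<tau> j (\<tau> xs))"
    by (rule multilinear_compose[OF multilinear_tau e_op(1)[OF j]])
  show "multilinear sV sT n (\<lambda>xs. sT (form (xs ! (j - 1)) (xs ! j))
     (\<Sum>l\<in>alphabet m. sT (- of_int (sgn l)) (\<tau> (xs[j - 1 := vec l, j := vec (- l)]))))"
    unfolding multilinear_def
  proof (intro allI impI)
    fix xs :: "'v list" and i assume i: "length xs = n" "i < n"
    let ?W = "\<lambda>xs. (\<Sum>l\<in>alphabet m. sT (- of_int (sgn l)) (\<tau> (xs[j - 1 := vec l, j := vec (- l)])))"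
    show "Vector_Spaces.linear sV sT (\<lambda>x. sT (form (xs[i := x] ! (j - 1)) (xs[i := x] ! j)) (?W (xs[i := x])))"
    proof (cases "i = j - 1 \<or> i = j")
      case True
      have upd: "(xs[i := x])[j - 1 := a, j := b] = xs[j - 1 := a, j := b]" for x a b
        using True i j by (intro nth_equalityI) (auto simp: nth_list_update)
      have W: "?W (xs[i := x]) = ?W xs" for x by (simp only: upd)
      have "Vector_Spaces.linear sV (*) (\<lambda>x. form (xs[i := x] ! (j - 1)) (xs[i := x] ! j))"
        using True
      proof
        assume "i = j - 1"
        then show ?thesis using i j form_left[of "xs ! j"] by simp
      next
        assume "i = j"
        then show ?thesis using i j form_right[of "xs ! (j - 1)"] by simp
      qed
      from linear_add[OF this] linear_scale[OF this] show ?thesis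
        unfolding W by (intro linearI vsV vsT) (simp_all add: T.scale_left_distrib)
    next
      case False
      have upd: "(xs[i := x])[j - 1 := a, j := b] = (xs[j - 1 := a, j := b])[i := x]" for x a b
        using False i j by (intro nth_equalityI) (auto simp: nth_list_update)
      have nth: "xs[i := x] ! (j - 1) = xs ! (j - 1)" "xs[i := x] ! j = xs ! j" for x
        using False by auto
      show ?thesis
        unfolding upd nth using i by (intro linear_scaled_sum tau_update_linear) auto
    qed
  qed
  fix w assume w: "w \<in> words m n"
  have "form (vec (w ! (j - 1))) (vec (w ! j)) = pairing (w ! (j - 1)) (w ! j)"
    using j words_nth[OF w] by (intro form_vec) auto
  then show "e_op m n v sT \<tau> j (\<tau> (map vec w)) = sT (form (map vec w ! (j - 1)) (map vec w ! j))
     (\<Sum>l\<in>alphabet m. sT (- of_int (sgn l)) (\<tau> ((map vec w)[j - 1 := vec l, j := vec (- l)])))"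
    using e_op(2)[OF j w] w j by (simp add: e_family_def basis_tensor_def map_update words_def)
qed

lemma GSpD:
  assumes "g \<in> GSp sV form"
  obtains d where "Vector_Spaces.linear sV sV g" "bij g" "d \<noteq> 0" "\<And>x y. form (g x) (g y) = d * form x y"
  using assms by (auto simp: GSp_def GL_def)

text \<open>
  The canonical tensor of the form is multiplied by \<open>d\<close> under a similitude \<open>g\<close> with factor \<open>d\<close>.  The
  basis dual to the vectors \<open>g v\<close> consists of the images of the dual basis, divided by \<open>d\<close>, and the
  canonical tensor does not depend on the chosen pair of dual bases.
\<close>
lemma canonical_tensor_invariant:
  assumes left: "\<And>y. Vector_Spaces.linear sV sT (\<lambda>x. \<beta> x y)" and right: "\<And>x. Vector_Spaces.linear sV sT (\<lambda>y. \<beta> x y)"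
    and g: "Vector_Spaces.linear sV sV g" "bij g" "d \<noteq> 0" "\<And>x y. form (g x) (g y) = d * form x y"
  shows "(\<Sum>l\<in>alphabet m. sT (of_int (sgn l)) (\<beta> (g (vec l)) (g (vec (- l)))))
       = sT d (\<Sum>l\<in>alphabet m. sT (of_int (sgn l)) (\<beta> (vec l) (vec (- l))))"
proof -
  let ?L = "alphabet m" and ?s = "\<lambda>l. of_int (sgn l) :: 'k"
  have expand1: "x = (\<Sum>l\<in>?L. sV (inverse d * (?s l * form x (g (vec (- l))))) (g (vec l)))" for x
  proof -
    obtain y where y: "x = g y" using g(2) by (metis bij_pointE)
    have "g y = g (\<Sum>l\<in>?L. sV (coord y l) (vec l))" using vec_expand[of y] by simp
    also have "\<dots> = (\<Sum>l\<in>?L. sV (coord y l) (g (vec l)))"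
      by (simp add: linear_sum[OF g(1)] linear_scale[OF g(1)])
    also have "\<dots> = (\<Sum>l\<in>?L. sV (inverse d * (?s l * form x (g (vec (- l))))) (g (vec l)))"
      using g(3) by (intro sum.cong refl) (simp add: y g(4) coord_def)
    finally show ?thesis using y by simp
  qed
  have expand2: "(\<Sum>k\<in>?L. sV (?s k * form (vec k) y) (vec (- k))) = y" for y
  proof -
    have "(\<Sum>k\<in>?L. sV (?s k * form (vec k) y) (vec (- k))) = (\<Sum>k\<in>?L. sV (?s (- k) * form (vec (- k)) y) (vec (- (- k))))"
      by (rule sum_alphabet_uminus[symmetric])
    also have "\<dots> = (\<Sum>k\<in>?L. sV (coord y k) (vec k))"
    proof (rule sum.cong[OF refl])
      fix k
      show "sV (?s (- k) * form (vec (- k)) y) (vec (- (- k))) = sV (coord y k) (vec k)"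
        using form_skew[of "vec (- k)" y] by (simp add: coord_def sgn_minus)
    qed
    finally show ?thesis using vec_expand[of y] by simp
  qed
  have "(\<Sum>k\<in>?L. sT (?s k) (\<beta> (vec k) (vec (- k))))
      = (\<Sum>k\<in>?L. \<Sum>l\<in>?L. sT (inverse d * ?s l) (sT (?s k * form (vec k) (g (vec (- l)))) (\<beta> (g (vec l)) (vec (- k)))))"
  proof (rule sum.cong[OF refl])
    fix k
    have "\<beta> (vec k) (vec (- k)) = \<beta> (\<Sum>l\<in>?L. sV (inverse d * (?s l * form (vec k) (g (vec (- l))))) (g (vec l))) (vec (- k))"
      using expand1[of "vec k"] by simp
    then show "sT (?s k) (\<beta> (vec k) (vec (- k)))
      = (\<Sum>l\<in>?L. sT (inverse d * ?s l) (sT (?s k * form (vec k) (g (vec (- l)))) (\<beta> (g (vec l)) (vec (- k)))))"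
      by (simp add: linear_sum[OF left] linear_scale[OF left] T.scale_sum_right mult_ac)
  qed
  also have "\<dots> = (\<Sum>l\<in>?L. \<Sum>k\<in>?L. sT (inverse d * ?s l) (sT (?s k * form (vec k) (g (vec (- l)))) (\<beta> (g (vec l)) (vec (- k)))))"
    by (rule sum.swap)
  also have "\<dots> = (\<Sum>l\<in>?L. sT (inverse d * ?s l) (\<beta> (g (vec l)) (\<Sum>k\<in>?L. sV (?s k * form (vec k) (g (vec (- l)))) (vec (- k)))))"
    by (simp add: linear_sum[OF right] linear_scale[OF right] T.scale_sum_right)
  also have "\<dots> = sT (inverse d) (\<Sum>l\<in>?L. sT (?s l) (\<beta> (g (vec l)) (g (vec (- l)))))"
    by (simp only: expand2 T.scale_sum_right T.scale_scale)
  finally show ?thesis using g(3) by simp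
qed

text \<open>
  For a similitude with factor \<open>d\<close>, the contraction in the operator \<open>e_j\<close> produces the factor \<open>d\<close> when
  the group acts first, and the canonical tensor produces it when the group acts last.
\<close>
lemma gen_op_commutes:
  assumes g: "g \<in> GSp sV form" and h: "h \<in> brauer_gens n"
  shows "gop h (tensor_action n sT \<tau> g t) = tensor_action n sT \<tau> g (gop h t)"
proof -
  obtain d where d: "Vector_Spaces.linear sV sV g" "bij g" "d \<noteq> 0" "\<And>x y. form (g x) (g y) = d * form x y"
    using GSpD[OF g] by blast
  let ?g = "tensor_action n sT \<tau> g"
  note act = tensor_action[OF d(1)]
  have "gop h \<circ> ?g = ?g \<circ> gop h"
  proof (rule linear_eq_pure)
    show "Vector_Spaces.linear sT sT (gop h \<circ> ?g)"
      by (rule Vector_Spaces.linear_compose[OF act(1) gen_op_linear[OF h]])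
    show "Vector_Spaces.linear sT sT (?g \<circ> gop h)"
      by (rule Vector_Spaces.linear_compose[OF gen_op_linear[OF h] act(1)])
    fix xs :: "'v list" assume xs: "length xs = n"
    show "(gop h \<circ> ?g) (\<tau> xs) = (?g \<circ> gop h) (\<tau> xs)"
    proof (cases h)
      case (GenS j)
      then have j: "1 \<le> j" "j < n" using h by auto
      show ?thesis
        using GenS j xs by (simp add: act(2) s_op_pure linear_uminus[OF act(1)] map_update)
    next
      case (GenE j)
      then have j: "1 \<le> j" "j < n" using h by auto
      let ?\<beta> = "\<lambda>x y. \<tau> ((map g xs)[j - 1 := x, j := y])"
      have left: "Vector_Spaces.linear sV sT (\<lambda>x. ?\<beta> x y)" for y
      proof -
        have "(map g xs)[j - 1 := x, j := y] = ((map g xs)[j := y])[j - 1 := x]" for x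
          using j by (intro list_update_swap) auto
        then show ?thesis using tau_update_linear[of "(map g xs)[j := y]" "j - 1"] j xs by simp
      qed
      have right: "Vector_Spaces.linear sV sT (\<lambda>y. ?\<beta> x y)" for x
        using tau_update_linear[of "(map g xs)[j - 1 := x]" j] j xs by simp
      note canon = canonical_tensor_invariant[OF left right d]
      have neg: "(\<Sum>l\<in>alphabet m. sT (- of_int (sgn l)) (F l)) = - (\<Sum>l\<in>alphabet m. sT (of_int (sgn l)) (F l))" for F
        by (simp add: sum_negf)
      have "(?g \<circ> gop h) (\<tau> xs) = sT (form (xs ! (j - 1)) (xs ! j))
          (\<Sum>l\<in>alphabet m. sT (- of_int (sgn l)) (?\<beta> (g (vec l)) (g (vec (- l)))))"
        using GenE xs by (simp add: e_op_pure[OF j xs] linear_scale[OF act(1)] linear_sum[OF act(1)]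
            linear_uminus[OF act(1)] act(2) map_update)
      also have "\<dots> = sT (form (xs ! (j - 1)) (xs ! j)) (sT d
          (\<Sum>l\<in>alphabet m. sT (- of_int (sgn l)) (?\<beta> (vec l) (vec (- l)))))"
        unfolding neg canon by simp
      also have "\<dots> = (gop h \<circ> ?g) (\<tau> xs)"
        using GenE xs j d(4) by (simp add: act(2) e_op_pure mult.commute)
      finally show ?thesis by simp
    qed
  qed
  from fun_cong[OF this, of t] show ?thesis by simp
qed

lemma fa_commutes:
  assumes g: "g \<in> GSp sV form" and p: "p \<in> BP.C"
  shows "fa p (tensor_action n sT \<tau> g t) = tensor_action n sT \<tau> g (fa p t)"
proof -
  have lin: "Vector_Spaces.linear sT sT (tensor_action n sT \<tau> g)"
    using g tensor_action(1) by (blast elim: GSpD)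
  have "fold gop u (tensor_action n sT \<tau> g t) = tensor_action n sT \<tau> g (fold gop u t)"
    if "set u \<subseteq> brauer_gens n" for u t
    using that by (induction u arbitrary: t) (auto simp: gen_op_commutes[OF g])
  then show ?thesis
    using p by (auto simp: free_action_def linear_sum[OF lin] linear_scale[OF lin] free_carrier_iff intro!: sum.cong)
qed

lemma End_group_algebra_iff:
  assumes G: "G \<subseteq> GL sV"
  shows "F \<in> carrier (End_group_algebra n sT \<tau> G) \<longleftrightarrow>
    Vector_Spaces.linear sT sT F \<and> (\<forall>g\<in>G. \<forall>t. F (tensor_action n sT \<tau> g t) = tensor_action n sT \<tau> g (F t))"
proof
  assume F: "F \<in> carrier (End_group_algebra n sT \<tau> G)"
  have "F (tensor_action n sT \<tau> g t) = tensor_action n sT \<tau> g (F t)" if "g \<in> G" for g t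
  proof -
    have "Poly_Mapping.single g (1 :: 'k) \<in> group_algebra G" using that by (simp add: group_algebra_def)
    then have "F (group_algebra_action n sT \<tau> (Poly_Mapping.single g (1 :: 'k)) t)
        = group_algebra_action n sT \<tau> (Poly_Mapping.single g (1 :: 'k)) (F t)"
      using F by (simp add: End_group_algebra_def)
    then show ?thesis by (simp add: group_algebra_action_def)
  qed
  then show "Vector_Spaces.linear sT sT F \<and> (\<forall>g\<in>G. \<forall>t. F (tensor_action n sT \<tau> g t) = tensor_action n sT \<tau> g (F t))"
    using F by (simp add: End_group_algebra_def End_alg_def)
next
  assume F: "Vector_Spaces.linear sT sT F \<and> (\<forall>g\<in>G. \<forall>t. F (tensor_action n sT \<tau> g t) = tensor_action n sT \<tau> g (F t))"
  then have lin: "Vector_Spaces.linear sT sT F" by blast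
  have "F (group_algebra_action n sT \<tau> a t) = group_algebra_action n sT \<tau> a (F t)" if "a \<in> group_algebra G" for a t
    using that F by (auto simp: group_algebra_action_def linear_sum[OF lin] linear_scale[OF lin] group_algebra_def intro!: sum.cong)
  then show "F \<in> carrier (End_group_algebra n sT \<tau> G)"
    using lin by (simp add: End_group_algebra_def End_alg_def)
qed

lemma Sp_subset_GSp: "Sp sV form \<subseteq> GSp sV form"
  unfolding Sp_def GSp_def by (auto intro!: exI[of _ 1])

lemma GSp_subset_GL: "GSp sV form \<subseteq> GL sV"
  by (auto simp: GSp_def)

lemma image_subset_End_GSp: "fa ` BP.C \<subseteq> carrier (End_group_algebra n sT \<tau> (GSp sV form))"
  using fa_linear fa_commutes by (auto simp: End_group_algebra_iff[OF GSp_subset_GL])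

lemma End_GSp_subset_End_Sp:
  "carrier (End_group_algebra n sT \<tau> (GSp sV form)) \<subseteq> carrier (End_group_algebra n sT \<tau> (Sp sV form))"
  using Sp_subset_GSp GSp_subset_GL by (auto simp: End_group_algebra_iff subset_iff)

lemma matching_form_polynomials:
  obtains P where "\<And>c. c \<in> codes n \<Longrightarrow> P c \<in> BP.C"
    "\<And>c w. c \<in> codes n \<Longrightarrow> w \<in> words m (2 * n) \<Longrightarrow> matching_form c w = functional (fa (P c)) w"
proof -
  have "\<forall>c\<in>codes n. \<exists>p. p \<in> BP.C \<and> (\<forall>w\<in>words m (2 * n). matching_form c w = functional (fa p) w)"
    using matching_form_realizable unfolding realizable_def by blast
  from bchoice[OF this] show ?thesis using that by blast
qed

text \<open>
  The form of an endomorphism that commutes with the symplectic group is a combination of matching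
  forms, and each of these comes from the Brauer algebra.
\<close>
lemma End_Sp_subset_image:
  assumes inf: "infinite (UNIV :: 'k set)"
  shows "carrier (End_group_algebra n sT \<tau> (Sp sV form)) \<subseteq> fa ` BP.C"
proof
  fix F assume "F \<in> carrier (End_group_algebra n sT \<tau> (Sp sV form))"
  moreover have "Sp sV form \<subseteq> GL sV" using Sp_subset_GSp GSp_subset_GL by blast
  ultimately have F: "Vector_Spaces.linear sT sT F"
      "\<And>g t. g \<in> Sp sV form \<Longrightarrow> F (tensor_action n sT \<tau> g t) = tensor_action n sT \<tau> g (F t)"
    by (auto simp: End_group_algebra_iff)
  obtain a where a: "\<And>w. w \<in> words m (2 * n) \<Longrightarrow> functional F w = (\<Sum>c\<in>codes n. a c * matching_form c w)"
    using invariant_forms_spanned_by_matchings[OF inf m_pos functional_invariant[OF F]] by blast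
  obtain P where P: "\<And>c. c \<in> codes n \<Longrightarrow> P c \<in> BP.C"
    "\<And>c w. c \<in> codes n \<Longrightarrow> w \<in> words m (2 * n) \<Longrightarrow> matching_form c w = functional (fa (P c)) w"
    using matching_form_polynomials by blast
  define p where "p = (\<Sum>c\<in>codes n. monomial (a c) [] * P c)"
  have p: "p \<in> BP.C" unfolding p_def using P(1) by (intro free_carrier_sum) auto
  have "F = fa p"
  proof (rule functional_inject[OF F(1) fa_linear[OF p]])
    fix w assume w: "w \<in> words m (2 * n)"
    show "functional F w = functional (fa p) w"
      unfolding a[OF w] p_def functional_sum using P w by (intro sum.cong refl) (simp add: functional_scale)
  qed
  then show "F \<in> fa ` BP.C" using p by blast
qed

text \<open>
  For \<open>n \<le> m\<close> the matching forms are independent, and they lie in the image of the Brauer algebra.  As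
  this algebra is spanned by no more elements than there are matching forms, the images of the
  spanning elements are independent.
\<close>
lemma faithful:
  assumes nm: "n \<le> m" and p: "p \<in> BP.C" and zero: "\<And>t. fa p t = 0"
  shows "p \<in> BP.I"
proof -
  obtain Y where Y: "finite Y" "card Y \<le> num_matchings n" "Y \<subseteq> BP.C"
    and sp: "\<forall>p\<in>BP.C. \<exists>c. p - (\<Sum>q\<in>Y. monomial (c q) [] * q) \<in> BP.I"
    using BP.brauer_spanning_set by blast
  obtain P where P: "\<And>c. c \<in> codes n \<Longrightarrow> P c \<in> BP.C"
    "\<And>c w. c \<in> codes n \<Longrightarrow> w \<in> words m (2 * n) \<Longrightarrow> matching_form c w = functional (fa (P c)) w"
    using matching_form_polynomials by blast
  have fun_eq: "functional (fa r) w = (\<Sum>q\<in>Y. c q * functional (fa q) w)"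
    if r: "r - (\<Sum>q\<in>Y. monomial (c q) [] * q) \<in> BP.I" for r c w
  proof -
    have "fa r t = fa (\<Sum>q\<in>Y. monomial (c q) [] * q) t" for t
      using ideal_acts_zero[OF r, of t] by (simp add: fa_diff)
    then have "functional (fa r) w = functional (fa (\<Sum>q\<in>Y. monomial (c q) [] * q)) w"
      by (simp add: functional_def)
    also have "\<dots> = (\<Sum>q\<in>Y. c q * functional (fa q) w)"
      unfolding functional_sum using Y(3) by (intro sum.cong refl) (auto simp: functional_scale)
    finally show ?thesis .
  qed
  obtain d where d: "p - (\<Sum>q\<in>Y. monomial (d q) [] * q) \<in> BP.I" using sp p by blast
  have "\<forall>c\<in>codes n. \<exists>a. P c - (\<Sum>q\<in>Y. monomial (a q) [] * q) \<in> BP.I" using sp P(1) by blast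
  from bchoice[OF this] obtain a where a: "\<And>c. c \<in> codes n \<Longrightarrow> P c - (\<Sum>q\<in>Y. monomial (a c q) [] * q) \<in> BP.I"
    by blast
  have "d q = 0" if "q \<in> Y" for q
  proof (rule independent_spanning_family[of "codes n" Y "words m (2 * n)" matching_form a "\<lambda>q. functional (fa q)" d q])
    show "card Y \<le> card (codes n)" using Y(2) by (simp add: card_codes)
    fix b c assume b: "\<And>w. w \<in> words m (2 * n) \<Longrightarrow> (\<Sum>c\<in>codes n. b c * (matching_form c w :: 'k)) = 0" and c: "c \<in> codes n"
    show "b c = 0"
      using words_mono[OF nm, of "2 * n"] b by (intro matching_forms_independent[of n b, OF _ c]) blast
  next
    fix c w assume "c \<in> codes n" "w \<in> words m (2 * n)"
    then show "matching_form c w = (\<Sum>q\<in>Y. a c q * functional (fa q) w)"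
      using P(2) fun_eq[OF a] by simp
  next
    fix w assume "w \<in> words m (2 * n)"
    have "functional (fa p) w = 0" using zero linear_zero[OF dual_linear] by (simp add: functional_def)
    then show "(\<Sum>q\<in>Y. d q * functional (fa q) w) = 0" using fun_eq[OF d, of w] by simp
  qed (use Y that in auto)
  then have "(\<Sum>q\<in>Y. monomial (d q) [] * q) = 0" by (intro sum.neutral) auto
  then show ?thesis using d by simp
qed

end

theorem theorem1p4:
  fixes sV :: "'k::field \<Rightarrow> 'v::ab_group_add \<Rightarrow> 'v"
    and form :: "'v \<Rightarrow> 'v \<Rightarrow> 'k"
    and v :: "nat \<Rightarrow> 'v"
    and sT :: "'k \<Rightarrow> 't::ab_group_add \<Rightarrow> 't"
    and \<tau> :: "'v list \<Rightarrow> 't"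
    and m n :: nat
  defines "B \<equiv> brauer_algebra n (- of_nat (2 * m) :: 'k)"
    and "\<phi> \<equiv> brauer_phi m n v sT \<tau>"
    and "End_GSp \<equiv> End_group_algebra n sT \<tau> (GSp sV form)"
    and "End_Sp \<equiv> End_group_algebra n sT \<tau> (Sp sV form)"
  assumes "infinite (UNIV :: 'k set)"
    and "1 \<le> m" and "1 \<le> n"
    and "symplectic_space sV form m"
    and "symplectic_basis sV form m v"
    and "tensor_power sV n sT \<tau>"
  shows "\<phi> \<in> alg_hom (opposite B) (End_alg sT)
       \<and> \<phi> ` carrier B = carrier End_GSp
       \<and> carrier End_GSp = carrier End_Sp
       \<and> (n \<le> m \<longrightarrow> inj_on \<phi> (carrier B) \<and> \<phi> \<in> alg_iso (opposite B) End_GSp)"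
proof -
  interpret symplectic_tensor sV form v sT \<tau> m n
    using assms(6,8-10) by unfold_locales
  have B: "B = Br" by (simp add: B_def loop_value_def)
  have hom: "\<phi> \<in> alg_hom (opposite B) (End_alg sT)"
    unfolding B \<phi>_def by (rule phi_hom)
  have img: "\<phi> ` carrier B = fa ` BP.C"
    unfolding B \<phi>_def by (rule phi_image)
  have eq1: "\<phi> ` carrier B = carrier End_GSp" and eq2: "carrier End_GSp = carrier End_Sp"
  proof -
    have "fa ` BP.C \<subseteq> carrier End_GSp" "carrier End_GSp \<subseteq> carrier End_Sp" "carrier End_Sp \<subseteq> fa ` BP.C"
      unfolding End_GSp_def End_Sp_def
      by (rule image_subset_End_GSp, rule End_GSp_subset_End_Sp, rule End_Sp_subset_image[OF assms(5)])
    then show "\<phi> ` carrier B = carrier End_GSp" "carrier End_GSp = carrier End_Sp"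
      unfolding img by (auto simp only:)
  qed
  have inj: "inj_on \<phi> (carrier B)" if "n \<le> m"
    unfolding B \<phi>_def using faithful[OF that] by (intro phi_inj_on) blast
  have "\<phi> \<in> alg_iso (opposite B) End_GSp" if nm: "n \<le> m"
    unfolding alg_iso_def
  proof (intro CollectI conjI)
    have carr: "carrier (opposite B) = carrier B" by (simp add: opposite_def)
    show "bij_betw \<phi> (carrier (opposite B)) (carrier End_GSp)"
      unfolding carr bij_betw_def using inj[OF nm] eq1 by blast
    have "\<phi> X \<in> carrier End_GSp" if "X \<in> carrier (opposite B)" for X
      using that eq1 carr by blast
    then show "\<phi> \<in> alg_hom (opposite B) End_GSp"
      using hom by (auto simp: alg_hom_def ring_hom_def End_GSp_def End_group_algebra_def)
  qed
  then show ?thesis using hom eq1 eq2 inj by blast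
qed

end
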